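(* Let $m,n\ge1$ and $r\ge1$ be integers. The elements $\eta_r^{\mathrm{cl}}(c_\lambda)$, $\lambda\in H^{\vee}(m|n,r)$, form a $\mathbb{C}$-basis of the center $\mathscr{Z}(\mathcal{S}(m|n,r))$ of the classical Schur superalgebra $\mathcal{S}(m|n,r)$.
   Context: $H(a|b,r)$ is the set of partitions $\lambda$ of $r$ with $\lambda_{a+1}\le b$ (missing parts are $0$), and $H^{\vee}(m|n,r):=H(\min(m,n)\,|\,\max(m,n),r)$. For $1\le a\le m+n$ put $\bar a=\bar 0$ if $a\le m$ and $\bar a=\bar 1$ if $a>m$. Let $V=\mathbb{C}^{m|n}$ have basis $e_1,\dots,e_{m+n}$ with $e_a$ of parity $\bar a$. The general linear Lie superalgebra $\mathfrak{gl}_{m|n}(\mathbb{C})$ has basis the matrix units $E_{ij}$ of parity $\bar i+\bar j$; it acts naturally on $V$ and on $V^{\otimes r}$ by $X(x_1\otimes\dots\otimes x_r)=\sum_{k}(-1)^{\bar X(\bar x_1+\dots+\bar x_{k-1})}x_1\otimes\dots\otimes Xx_k\otimes\dots\otimes x_r$ for homogeneous $X,x_i$. $\mathcal{S}(m|n,r)$ is the image of the universal enveloping algebra $\mathcal{U}(\mathfrak{gl}_{m|n})$ in $\mathrm{End}_{\mathbb{C}}(V^{\otimes r})$ under this representation. $\mathscr{Z}(\cdot)$ denotes the ordinary center. $\eta_r^{\mathrm{cl}}:(\mathbb{C}\mathfrak{S}_r)^{\mathrm{op}}\to\mathrm{End}_{\mathbb{C}}(V^{\otimes r})$ is the signed permutation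 action: the simple transposition $(k,k+1)$ sends $e_{i_1}\otimes\dots\otimes e_{i_r}$ to $(-1)^{\bar i_k\bar i_{k+1}}e_{i_1}\otimes\dots\otimes e_{i_{k+1}}\otimes e_{i_k}\otimes\dots\otimes e_{i_r}$. For a partition $\lambda$ of $r$, $c_\lambda\in\mathbb{C}\mathfrak{S}_r$ is the sum of all permutations of cycle type $\lambda$. *)

theory Defs
  imports
    "HOL.Complex"
    "HOL-Library.Function_Algebras"
    "HOL-Library.Poly_Mapping"
    "HOL-Library.Multiset"
    "HOL-Combinatorics.Permutations"
    "HOL-Combinatorics.Orbits"
    "HOL-Algebra.QuotRing"
begin

subsection \<open>Hook partitions\<close>

text \<open>
  Partitions are weakly decreasing lists of positive parts. List positions start at 0, so the
  part \<open>p\<^sub>a\<^sub>+\<^sub>1\<close> of \<open>p\<close> is \<open>p ! a\<close>, or 0 if the list is too short.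
\<close>

definition hook_partitions :: "nat \<Rightarrow> nat \<Rightarrow> nat \<Rightarrow> nat list set" where
  "hook_partitions a b r =
     {p. sorted_wrt (\<ge>) p \<and> 0 \<notin> set p \<and> sum_list p = r \<and> (if a < length p then p ! a else 0) \<le> b}"

definition hook_partitions_vee :: "nat \<Rightarrow> nat \<Rightarrow> nat \<Rightarrow> nat list set" where
  "hook_partitions_vee m n r = hook_partitions (min m n) (max m n) r"


subsection \<open>The superspace \<open>V\<^sup>\<otimes>\<^sup>r\<close> and its operators\<close>

definition parity :: "nat \<Rightarrow> nat \<Rightarrow> nat" where
  "parity m a = (if a \<le> m then 0 else 1)"

text \<open>
  A word \<open>[i\<^sub>1, \<dots>, i\<^sub>r]\<close> over \<open>{1..m+n}\<close> stands for the basis tensor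
  \<open>e\<^bsub>i\<^sub>1\<^esub> \<otimes> \<dots> \<otimes> e\<^bsub>i\<^sub>r\<^esub>\<close>; a tensor is its coefficient function, and \<open>V\<^sup>\<otimes>\<^sup>r\<close> consists of the coefficient
  functions vanishing off \<open>tensor_words m n r\<close>. The first tensor factor has list position 0.
\<close>

definition tensor_words :: "nat \<Rightarrow> nat \<Rightarrow> nat \<Rightarrow> nat list set" where
  "tensor_words m n r = {w. length w = r \<and> set w \<subseteq> {1..m + n}}"

type_synonym tensor = "nat list \<Rightarrow> complex"
type_synonym tensor_op = "tensor \<Rightarrow> tensor"

definition basis_tensor :: "nat list \<Rightarrow> tensor" where
  "basis_tensor w = (\<lambda>u. if u = w then 1 else 0)"

definition tscale :: "complex \<Rightarrow> tensor \<Rightarrow> tensor" where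
  "tscale c v = (\<lambda>u. c * v u)"

definition opscale :: "complex \<Rightarrow> tensor_op \<Rightarrow> tensor_op" where
  "opscale c T = (\<lambda>v. tscale c (T v))"

interpretation tensor_op: vector_space opscale
  by unfold_locales (auto simp: opscale_def tscale_def fun_eq_iff algebra_simps)

text \<open>
  The endomorphism of \<open>V\<^sup>\<otimes>\<^sup>r\<close> sending the basis tensor of each word \<open>w\<close> to \<open>f w\<close>. As functions in HOL
  are total, an endomorphism is extended to all coefficient functions by ignoring the coefficients
  off \<open>tensor_words m n r\<close>. This makes equality of operators coincide with equality on \<open>V\<^sup>\<otimes>\<^sup>r\<close>, and
  the identity of \<open>V\<^sup>\<otimes>\<^sup>r\<close> is represented by \<open>tensor_id m n r\<close>.
\<close>

definition lin_ext :: "nat \<Rightarrow> nat \<Rightarrow> nat \<Rightarrow> (nat list \<Rightarrow> tensor) \<Rightarrow> tensor_op" where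
  "lin_ext m n r f = (\<lambda>v. \<Sum>w\<in>tensor_words m n r. tscale (v w) (f w))"

definition tensor_id :: "nat \<Rightarrow> nat \<Rightarrow> nat \<Rightarrow> tensor_op" where
  "tensor_id m n r = lin_ext m n r basis_tensor"


subsection \<open>The universal enveloping algebra of \<open>gl\<^sub>m\<^sub>|\<^sub>n\<close>\<close>

text \<open>
  Words under concatenation, written additively, so that \<open>'a fword \<Rightarrow>\<^sub>0 complex\<close> with the convolution
  product of \<^theory>\<open>HOL-Library.Poly_Mapping\<close> is the free associative unital algebra on \<open>'a\<close>.
\<close>

datatype 'a fword = FWord (letters: "'a list")

instantiation fword :: (type) monoid_add
begin
definition zero_fword :: "'a fword" where "zero_fword = FWord []"
definition plus_fword :: "'a fword \<Rightarrow> 'a fword \<Rightarrow> 'a fword" where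
  "plus_fword u v = FWord (letters u @ letters v)"
instance by standard (auto simp: zero_fword_def plus_fword_def)
end

type_synonym gl_tensor = "(nat \<times> nat) fword \<Rightarrow>\<^sub>0 complex"

text \<open>The tensor algebra of \<open>gl\<^sub>m\<^sub>|\<^sub>n\<close>: the free algebra on the basis of matrix units \<open>E\<^sub>i\<^sub>j\<close>.\<close>

definition gl_tensor_algebra :: "nat \<Rightarrow> nat \<Rightarrow> gl_tensor ring" where
  "gl_tensor_algebra m n =
     \<lparr>carrier = {x. \<forall>w\<in>Poly_Mapping.keys x. set (letters w) \<subseteq> {1..m + n} \<times> {1..m + n}},
      monoid.mult = (*), one = 1, zero = 0, add = (+)\<rparr>"

definition matrix_unit :: "nat \<Rightarrow> nat \<Rightarrow> gl_tensor" where
  "matrix_unit i j = Poly_Mapping.single (FWord [(i, j)]) 1"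

text \<open>
  \<open>E\<^sub>i\<^sub>j \<otimes> E\<^sub>k\<^sub>l - (-1)\<^bsup>|E\<^sub>i\<^sub>j||E\<^sub>k\<^sub>l|\<^esup> E\<^sub>k\<^sub>l \<otimes> E\<^sub>i\<^sub>j - [E\<^sub>i\<^sub>j, E\<^sub>k\<^sub>l]\<close>, where the supercommutator in \<open>gl\<^sub>m\<^sub>|\<^sub>n\<close> is
  \<open>[E\<^sub>i\<^sub>j, E\<^sub>k\<^sub>l] = \<delta>\<^sub>j\<^sub>k E\<^sub>i\<^sub>l - (-1)\<^bsup>|E\<^sub>i\<^sub>j||E\<^sub>k\<^sub>l|\<^esup> \<delta>\<^sub>i\<^sub>l E\<^sub>k\<^sub>j\<close>.
\<close>

definition gl_relator :: "nat \<Rightarrow> nat \<Rightarrow> nat \<Rightarrow> nat \<Rightarrow> nat \<Rightarrow> gl_tensor" where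
  "gl_relator m i j k l =
     (let s = (-1) ^ ((parity m i + parity m j) * (parity m k + parity m l)) in
      matrix_unit i j * matrix_unit k l - s * matrix_unit k l * matrix_unit i j
      - ((if j = k then matrix_unit i l else 0) - s * (if i = l then matrix_unit k j else 0)))"

definition gl_ideal :: "nat \<Rightarrow> nat \<Rightarrow> gl_tensor set" where
  "gl_ideal m n = Idl\<^bsub>gl_tensor_algebra m n\<^esub>
     {gl_relator m i j k l | i j k l. {i, j, k, l} \<subseteq> {1..m + n}}"

definition gl_enveloping :: "nat \<Rightarrow> nat \<Rightarrow> gl_tensor set ring" where
  "gl_enveloping m n = gl_tensor_algebra m n Quot gl_ideal m n"


subsection \<open>The Schur superalgebra\<close>

definition matrix_unit_op :: "nat \<Rightarrow> nat \<Rightarrow> nat \<Rightarrow> nat \<Rightarrow> nat \<Rightarrow> tensor_op" where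
  "matrix_unit_op m n r i j = lin_ext m n r (\<lambda>w. \<Sum>k<r.
     if w ! k = j
     then tscale ((-1) ^ ((parity m i + parity m j) * (\<Sum>l<k. parity m (w ! l))))
            (basis_tensor (w[k := i]))
     else 0)"

definition gl_word_op :: "nat \<Rightarrow> nat \<Rightarrow> nat \<Rightarrow> (nat \<times> nat) list \<Rightarrow> tensor_op" where
  "gl_word_op m n r ps = foldr (\<lambda>(i, j) T. matrix_unit_op m n r i j \<circ> T) ps (tensor_id m n r)"

text \<open>The extension of the action of \<open>gl\<^sub>m\<^sub>|\<^sub>n\<close> to its tensor algebra.\<close>

definition gl_tensor_rep :: "nat \<Rightarrow> nat \<Rightarrow> nat \<Rightarrow> gl_tensor \<Rightarrow> tensor_op" where
  "gl_tensor_rep m n r x =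
     (\<Sum>w\<in>Poly_Mapping.keys x. opscale (Poly_Mapping.lookup x w) (gl_word_op m n r (letters w)))"

text \<open>
  The induced representation of the enveloping algebra, whose elements are cosets on which
  \<open>gl_tensor_rep\<close> is constant (lemma \<open>gl_rep_coset\<close> below).
\<close>

definition gl_rep :: "nat \<Rightarrow> nat \<Rightarrow> nat \<Rightarrow> gl_tensor set \<Rightarrow> tensor_op" where
  "gl_rep m n r X = the_elem (gl_tensor_rep m n r ` X)"

definition schur_superalgebra :: "nat \<Rightarrow> nat \<Rightarrow> nat \<Rightarrow> tensor_op set" where
  "schur_superalgebra m n r = gl_rep m n r ` carrier (gl_enveloping m n)"

definition op_center :: "tensor_op set \<Rightarrow> tensor_op set" where
  "op_center A = {z \<in> A. \<forall>x\<in>A. z \<circ> x = x \<circ> z}"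


subsection \<open>The signed permutation action\<close>

text \<open>
  \<open>S\<^sub>r\<close> is the group of permutations of the list positions \<open>{..<r}\<close>, and an element of its group
  algebra is a coefficient function on permutations. The right action permutes tensor factors, and
  its sign counts the pairs of odd factors that are interchanged. By \<open>signed_perm_op_transpose\<close>
  and \<open>signed_perm_op_compose\<close> below it is the action determined by the simple transpositions.
\<close>

definition odd_inversion_sign :: "nat \<Rightarrow> (nat \<Rightarrow> nat) \<Rightarrow> nat list \<Rightarrow> complex" where
  "odd_inversion_sign m \<sigma> w = (-1) ^ card {(k, l). k < l \<and> l < length w \<and> \<sigma> l < \<sigma> k \<and>
     parity m (w ! \<sigma> k) = 1 \<and> parity m (w ! \<sigma> l) = 1}"

definition signed_perm_op :: "nat \<Rightarrow> nat \<Rightarrow> nat \<Rightarrow> (nat \<Rightarrow> nat) \<Rightarrow> tensor_op" where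
  "signed_perm_op m n r \<sigma> =
     lin_ext m n r (\<lambda>w. tscale (odd_inversion_sign m \<sigma> w) (basis_tensor (permute_list \<sigma> w)))"

definition eta_cl :: "nat \<Rightarrow> nat \<Rightarrow> nat \<Rightarrow> ((nat \<Rightarrow> nat) \<Rightarrow> complex) \<Rightarrow> tensor_op" where
  "eta_cl m n r c = (\<Sum>\<sigma> | \<sigma> permutes {..<r}. opscale (c \<sigma>) (signed_perm_op m n r \<sigma>))"

definition cycle_type :: "nat \<Rightarrow> (nat \<Rightarrow> nat) \<Rightarrow> nat multiset" where
  "cycle_type r \<sigma> = image_mset card (mset_set (orbit \<sigma> ` {..<r}))"

definition class_sum :: "nat \<Rightarrow> nat list \<Rightarrow> (nat \<Rightarrow> nat) \<Rightarrow> complex" where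
  "class_sum r p = (\<lambda>\<sigma>. if \<sigma> permutes {..<r} \<and> cycle_type r \<sigma> = mset p then 1 else 0)"


subsection \<open>Linear extension\<close>

lemma tscale_simps:
  "tscale c (u + v) = tscale c u + tscale c v" "tscale c (u - v) = tscale c u - tscale c v"
  "tscale c 0 = 0" "tscale 0 u = 0" "tscale 1 u = u" "tscale c (tscale d u) = tscale (c * d) u"
  "tscale (c + d) u = tscale c u + tscale d u" "tscale (- c) u = - tscale c u"
  "tscale c (- u) = - tscale c u"
  by (auto simp: tscale_def fun_eq_iff algebra_simps)

lemma tscale_sum: "tscale c (sum f A) = (\<Sum>x\<in>A. tscale c (f x))"
  by (induction A rule: infinite_finite_induct) (simp_all add: tscale_simps del: zero_fun_apply plus_fun_apply)

lemma finite_tensor_words: "finite (tensor_words m n r)"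
  using finite_lists_length_eq[of "{1..m+n}" r] by (simp add: tensor_words_def conj_commute)

lemma sum_fun_apply: "(sum f A) x = (\<Sum>a\<in>A. f a x)"
  by (induction A rule: infinite_finite_induct) auto

lemma lin_ext_basis: "lin_ext m n r f (basis_tensor w) = (if w \<in> tensor_words m n r then f w else 0)"
proof -
  have "lin_ext m n r f (basis_tensor w) = (\<Sum>u\<in>tensor_words m n r. if u = w then f w else 0)"
    unfolding lin_ext_def by (rule sum.cong) (auto simp: basis_tensor_def tscale_simps)
  then show ?thesis by (simp add: finite_tensor_words)
qed

lemma lin_ext_lin:
  "lin_ext m n r f (u + v) = lin_ext m n r f u + lin_ext m n r f v"
  "lin_ext m n r f (tscale c v) = tscale c (lin_ext m n r f v)"
  "lin_ext m n r f 0 = 0"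
  by (auto simp: lin_ext_def tscale_simps tscale_sum sum.distrib tscale_def[of c v])

lemma lin_ext_sum: "lin_ext m n r f (sum g A) = (\<Sum>x\<in>A. lin_ext m n r f (g x))"
  by (induction A rule: infinite_finite_induct) (simp_all add: lin_ext_lin del: zero_fun_apply plus_fun_apply)

lemma lin_ext_comp:
  "lin_ext m n r f \<circ> lin_ext m n r g = lin_ext m n r (\<lambda>w. lin_ext m n r f (g w))"
  by (rule ext) (simp add: lin_ext_def[of m n r g] lin_ext_def[of m n r "\<lambda>w. lin_ext m n r f (g w)"]
    lin_ext_sum lin_ext_lin)

lemma lin_ext_cong:
  "(\<And>w. w \<in> tensor_words m n r \<Longrightarrow> f w = g w) \<Longrightarrow> lin_ext m n r f = lin_ext m n r g"
  unfolding lin_ext_def by (rule ext, rule sum.cong) simp_all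

lemma lin_ext_add: "lin_ext m n r f + lin_ext m n r g = lin_ext m n r (\<lambda>w. f w + g w)"
  by (rule ext) (simp add: lin_ext_def tscale_simps sum.distrib)

lemma lin_ext_diff: "lin_ext m n r f - lin_ext m n r g = lin_ext m n r (\<lambda>w. f w - g w)"
  by (rule ext) (simp add: lin_ext_def tscale_simps sum_subtractf)

lemma lin_ext_zero: "lin_ext m n r (\<lambda>w. 0) = 0"
  by (rule ext) (simp add: lin_ext_def tscale_simps)

lemma opscale_lin_ext: "opscale c (lin_ext m n r f) = lin_ext m n r (\<lambda>w. tscale c (f w))"
  by (rule ext) (simp add: lin_ext_def opscale_def tscale_simps tscale_sum mult.commute)


subsection \<open>The signed permutation action is the one determined by simple transpositions\<close>

definition index_pairs where "index_pairs r = {(k, l). k < l \<and> l < (r::nat)}"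

lemma finite_index_pairs: "finite (index_pairs r)"
  by (rule finite_subset[of _ "{..<r} \<times> {..<r}"]) (auto simp: index_pairs_def)

lemma odd_inversion_sign_prod:
  "odd_inversion_sign m \<sigma> w = (\<Prod>(k, l)\<in>index_pairs (length w). if \<sigma> l < \<sigma> k \<and>
     parity m (w ! \<sigma> k) = 1 \<and> parity m (w ! \<sigma> l) = 1 then - 1 else 1)"
proof -
  have "{(k, l). k < l \<and> l < length w \<and> \<sigma> l < \<sigma> k \<and>
     parity m (w ! \<sigma> k) = 1 \<and> parity m (w ! \<sigma> l) = 1} = index_pairs (length w) \<inter>
     {p. \<sigma> (snd p) < \<sigma> (fst p) \<and> parity m (w ! \<sigma> (fst p)) = 1 \<and> parity m (w ! \<sigma> (snd p)) = 1}"
    by (auto simp: index_pairs_def)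
  then show ?thesis
    by (simp add: odd_inversion_sign_def prod.If_cases finite_index_pairs case_prod_unfold)
qed

lemma odd_inversion_sign_compose:
  assumes s: "\<sigma> permutes {..<length w}" and t: "\<tau> permutes {..<length w}"
  shows "odd_inversion_sign m (\<sigma> \<circ> \<tau>) w
    = odd_inversion_sign m \<sigma> w * odd_inversion_sign m \<tau> (permute_list \<sigma> w)"
proof -
  let ?r = "length w"
  let ?P = "index_pairs ?r"
  define g where "g = (\<lambda>(k, l). (min (\<tau> k) (\<tau> l), max (\<tau> k) (\<tau> l)))"
  have tinj: "\<tau> k = \<tau> l \<longleftrightarrow> k = l" for k l
    using permutes_inj[OF t] by (auto dest: injD)
  have sinj: "\<sigma> k = \<sigma> l \<longleftrightarrow> k = l" for k l
    using permutes_inj[OF s] by (auto dest: injD)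
  have tr: "\<tau> k < ?r \<longleftrightarrow> k < ?r" for k
    using permutes_in_image[OF t, of k] by simp
  have "g ` ?P \<subseteq> ?P"
  proof (rule image_subsetI)
    fix p assume "p \<in> ?P"
    then obtain k l where p: "p = (k, l)" "k < ?r" "l < ?r" "\<tau> k \<noteq> \<tau> l" by (auto simp: index_pairs_def tinj)
    with tr[of k] tr[of l] show "g p \<in> ?P" by (auto simp: g_def index_pairs_def)
  qed
  moreover have inj: "inj_on g ?P"
    by (auto simp: inj_on_def g_def index_pairs_def min_def max_def tinj split: if_splits)
  ultimately have "g ` ?P = ?P"
    by (intro card_subset_eq) (auto simp: finite_index_pairs card_image)
  with inj have bij: "bij_betw g ?P ?P" by (simp add: bij_betw_def)
  have "odd_inversion_sign m \<sigma> w = (\<Prod>p\<in>?P. case g p of (k, l) \<Rightarrow> if \<sigma> l < \<sigma> k \<and>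
     parity m (w ! \<sigma> k) = 1 \<and> parity m (w ! \<sigma> l) = 1 then - 1 else 1)"
    unfolding odd_inversion_sign_prod by (rule prod.reindex_bij_betw[OF bij, symmetric])
  moreover have "odd_inversion_sign m \<tau> (permute_list \<sigma> w) = (\<Prod>(k, l)\<in>?P. if \<tau> l < \<tau> k \<and>
     parity m (w ! \<sigma> (\<tau> k)) = 1 \<and> parity m (w ! \<sigma> (\<tau> l)) = 1 then - 1 else 1)"
    unfolding odd_inversion_sign_prod
    by (rule prod.cong) (auto simp: index_pairs_def permute_list_nth[OF s] tr)
  ultimately show ?thesis
    unfolding odd_inversion_sign_prod[of _ "\<sigma> \<circ> \<tau>"] prod.distrib[symmetric]
    apply (simp only:)
    apply (subst prod.distrib[symmetric])
    apply (rule prod.cong[OF refl])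
    subgoal for p
      using tinj[of "fst p" "snd p"] sinj[of "\<tau> (fst p)" "\<tau> (snd p)"]
      by (auto simp: g_def min_def max_def index_pairs_def case_prod_unfold)
    done
qed

lemma permute_list_in_tensor_words:
  "\<sigma> permutes {..<r} \<Longrightarrow> w \<in> tensor_words m n r \<Longrightarrow> permute_list \<sigma> w \<in> tensor_words m n r"
  by (auto simp: tensor_words_def)

lemma signed_perm_op_compose:
  assumes "\<sigma> permutes {..<r}" "\<tau> permutes {..<r}"
  shows "signed_perm_op m n r (\<sigma> \<circ> \<tau>) = signed_perm_op m n r \<tau> \<circ> signed_perm_op m n r \<sigma>"
  unfolding signed_perm_op_def lin_ext_comp
proof (rule lin_ext_cong)
  fix w assume w: "w \<in> tensor_words m n r"
  then have l: "length w = r" by (simp add: tensor_words_def)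
  show "tscale (odd_inversion_sign m (\<sigma> \<circ> \<tau>) w) (basis_tensor (permute_list (\<sigma> \<circ> \<tau>) w)) =
    lin_ext m n r (\<lambda>w. tscale (odd_inversion_sign m \<tau> w) (basis_tensor (permute_list \<tau> w)))
      (tscale (odd_inversion_sign m \<sigma> w) (basis_tensor (permute_list \<sigma> w)))"
    using assms l permute_list_in_tensor_words[OF assms(1) w]
    by (simp add: lin_ext_lin lin_ext_basis tscale_simps odd_inversion_sign_compose
      permute_list_compose)
qed

lemma signed_perm_op_transpose:
  assumes "Suc k < r" "w \<in> tensor_words m n r"
  shows "signed_perm_op m n r (transpose k (Suc k)) (basis_tensor w) =
    tscale ((-1) ^ (parity m (w ! k) * parity m (w ! Suc k)))
      (basis_tensor (w[k := w ! Suc k, Suc k := w ! k]))"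
proof -
  have l: "length w = r" using assms by (simp add: tensor_words_def)
  have "permute_list (transpose k (Suc k)) w = w[k := w ! Suc k, Suc k := w ! k]"
    by (rule nth_equalityI)
      (use assms l in \<open>auto simp: permute_list_def nth_list_update transpose_def\<close>)
  moreover have "{(i, j). i < j \<and> j < length w \<and> transpose k (Suc k) j < transpose k (Suc k) i \<and>
     parity m (w ! transpose k (Suc k) i) = 1 \<and> parity m (w ! transpose k (Suc k) j) = 1}
     = (if parity m (w ! k) = 1 \<and> parity m (w ! Suc k) = 1 then {(k, Suc k)} else {})"
    using assms l by (auto simp: transpose_def split: if_splits)
  ultimately show ?thesis
    using assms(2)
    by (simp add: signed_perm_op_def lin_ext_basis odd_inversion_sign_def) (auto simp: parity_def)
qed

lemma signed_perm_op_id: "signed_perm_op m n r id = tensor_id m n r"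
proof -
  have "odd_inversion_sign m id w = 1" for w
  proof -
    have "{(k, l). k < l \<and> l < length w \<and> id l < id k \<and>
      parity m (w ! id k) = 1 \<and> parity m (w ! id l) = 1} = {}" by auto
    then show ?thesis unfolding odd_inversion_sign_def by (simp only: card.empty power_0)
  qed
  then show ?thesis
    by (simp add: signed_perm_op_def tensor_id_def tscale_simps)
qed

subsection \<open>The enveloping algebra acts\<close>

definition leading_sign where "leading_sign m a p w = ((-1) ^ (a * (\<Sum>l<p. parity m (w ! l))) :: complex)"

lemma leading_sign_update:
  assumes "p < length w"
  shows "leading_sign m a q (w[p := k])
    = (if p < q then (-1) ^ (a * (parity m k + parity m (w ! p))) else 1) * leading_sign m a q w"
proof (cases "p < q")
  case False
  then have "(\<Sum>l<q. parity m (w[p := k] ! l)) = (\<Sum>l<q. parity m (w ! l))"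
    by (intro sum.cong) auto
  with False show ?thesis by (simp add: leading_sign_def)
next
  case True
  have e: "(\<Sum>l<q. f l) = f p + (\<Sum>l\<in>{..<q} - {p}. f l)" for f :: "nat \<Rightarrow> nat"
    using True by (simp add: sum.remove)
  have "(\<Sum>l\<in>{..<q} - {p}. parity m (w[p := k] ! l)) = (\<Sum>l\<in>{..<q} - {p}. parity m (w ! l))"
    by (intro sum.cong) auto
  then have "(\<Sum>l<q. parity m (w[p := k] ! l)) + parity m (w ! p)
    = parity m k + (\<Sum>l<q. parity m (w ! l))"
    unfolding e using assms by simp
  then have "(\<Sum>l<q. parity m (w[p := k] ! l)) + 2 * parity m (w ! p)
    = parity m k + parity m (w ! p) + (\<Sum>l<q. parity m (w ! l))" by simp
  then have "(-1::complex) ^ (a * ((\<Sum>l<q. parity m (w[p := k] ! l)) + 2 * parity m (w ! p)))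
    = (-1) ^ (a * (parity m k + parity m (w ! p) + (\<Sum>l<q. parity m (w ! l))))"
    by (simp only:)
  then show ?thesis using True
    by (simp add: leading_sign_def distrib_left power_add power_mult[symmetric] mult.assoc mult.left_commute)
qed

lemma list_update_in_tensor_words:
  "w \<in> tensor_words m n r \<Longrightarrow> i \<in> {1..m + n} \<Longrightarrow> w[k := i] \<in> tensor_words m n r"
  using set_update_subset_insert[of w k i] by (auto simp: tensor_words_def)

definition unit_vec where "unit_vec m i j w = (\<Sum>k<length w. if w ! k = j
     then tscale (leading_sign m (parity m i + parity m j) k w) (basis_tensor (w[k := i])) else 0)"

lemma matrix_unit_op_alt: "matrix_unit_op m n r i j = lin_ext m n r (unit_vec m i j)"
  unfolding matrix_unit_op_def
  by (rule lin_ext_cong) (auto simp: unit_vec_def leading_sign_def tensor_words_def intro!: sum.cong)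

definition two_unit_term where "two_unit_term m i j k l w p q =
   (if w ! p = l \<and> w[p := k] ! q = j
    then tscale (leading_sign m (parity m k + parity m l) p w * leading_sign m (parity m i + parity m j) q (w[p := k]))
           (basis_tensor (w[p := k, q := i])) else 0)"

lemma unit_comp:
  assumes "w \<in> tensor_words m n r" "k \<in> {1..m + n}"
  shows "lin_ext m n r (unit_vec m i j) (unit_vec m k l w)
    = (\<Sum>p<length w. \<Sum>q<length w. two_unit_term m i j k l w p q)"
  unfolding unit_vec_def[of m k l w] lin_ext_sum
proof (rule sum.cong[OF refl])
  fix p
  show "lin_ext m n r (unit_vec m i j) (if w ! p = l then tscale (leading_sign m (parity m k + parity m l) p w)
       (basis_tensor (w[p := k])) else 0) = (\<Sum>q<length w. two_unit_term m i j k l w p q)"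
  proof (cases "w ! p = l")
    case True
    then show ?thesis
      using list_update_in_tensor_words[OF assms, of p]
      by (auto simp: lin_ext_lin lin_ext_basis unit_vec_def two_unit_term_def tscale_sum tscale_simps
        intro!: sum.cong)
  next
    case False
    then show ?thesis by (simp add: two_unit_term_def lin_ext_lin)
  qed
qed

lemma sum_two_unit_term:
  "(\<Sum>p<length w. \<Sum>q<length w. two_unit_term m i j k l w p q) =
   (if j = k then unit_vec m i l w else 0)
   + (\<Sum>(p, q)\<in>{(p, q). p < length w \<and> q < length w \<and> p \<noteq> q}. two_unit_term m i j k l w p q)"
proof -
  let ?N = "{..<length w}"
  have D: "(\<Sum>p\<in>?N. two_unit_term m i j k l w p p) = (if j = k then unit_vec m i l w else 0)"
  proof (cases "j = k")
    case True
    have "leading_sign m (parity m k + parity m l) p w * leading_sign m (parity m i + parity m k) p w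
      = leading_sign m (parity m i + parity m l) p w" for p
      by (auto simp: leading_sign_def parity_def power_add distrib_right simp flip: power_mult_distrib)
    with True show ?thesis
      by (auto simp: unit_vec_def two_unit_term_def leading_sign_update intro!: sum.cong)
  next
    case False
    then show ?thesis by (simp add: two_unit_term_def)
  qed
  have "(\<Sum>p\<in>?N. \<Sum>q\<in>?N. two_unit_term m i j k l w p q) = (\<Sum>(p,q)\<in>?N\<times>?N. two_unit_term m i j k l w p q)"
    by (simp add: sum.cartesian_product)
  also have "?N \<times> ?N = (\<lambda>p. (p, p)) ` ?N \<union> {(p, q). p < length w \<and> q < length w \<and> p \<noteq> q}"
    by auto
  also have "(\<Sum>(p,q)\<in>\<dots>. two_unit_term m i j k l w p q) = (\<Sum>(p,q)\<in>(\<lambda>p. (p, p)) ` ?N. two_unit_term m i j k l w p q) +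
    (\<Sum>(p, q)\<in>{(p, q). p < length w \<and> q < length w \<and> p \<noteq> q}. two_unit_term m i j k l w p q)"
    by (rule sum.union_disjoint)
       (auto intro: finite_subset[of _ "?N \<times> ?N"])
  also have "(\<Sum>(p,q)\<in>(\<lambda>p. (p, p)) ` ?N. two_unit_term m i j k l w p q) = (\<Sum>p\<in>?N. two_unit_term m i j k l w p p)"
    by (subst sum.reindex) (auto simp: inj_on_def)
  finally show ?thesis unfolding D .
qed

lemma two_unit_term_swap:
  assumes "p < length w" "q < length w" "p \<noteq> q"
  shows "two_unit_term m i j k l w p q =
    tscale ((-1) ^ ((parity m i + parity m j) * (parity m k + parity m l))) (two_unit_term m k l i j w q p)"
proof (cases "w ! p = l \<and> w ! q = j")
  case True
  have "(-1::complex) ^ (a * b) * ((-1) ^ (b * a) * x) = x" for a b x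
    by (simp add: mult.commute[of b a] flip: mult.assoc power_mult_distrib power_add mult_2)
  with True assms show ?thesis
    by (auto simp: two_unit_term_def leading_sign_update tscale_simps list_update_swap mult_ac)
next
  case False
  with assms show ?thesis by (auto simp: two_unit_term_def tscale_simps)
qed

lemma matrix_unit_op_supercommutator:
  fixes m :: nat
  assumes "{i, j, k, l} \<subseteq> {1..m + n}"
  defines "s \<equiv> (-1) ^ ((parity m i + parity m j) * (parity m k + parity m l))"
  shows "(matrix_unit_op m n r i j \<circ> matrix_unit_op m n r k l)
      - opscale s (matrix_unit_op m n r k l \<circ> matrix_unit_op m n r i j)
    = (if j = k then matrix_unit_op m n r i l else 0)
      - opscale s (if i = l then matrix_unit_op m n r k j else 0)"
proof -
  have Z: "(if b then lin_ext m n r f else 0) = lin_ext m n r (\<lambda>w. if b then f w else 0)" for b f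
    by (cases b) (simp_all only: if_True if_False lin_ext_zero)
  have R: "(if j = k then matrix_unit_op m n r i l else 0)
      - opscale s (if i = l then matrix_unit_op m n r k j else 0)
    = lin_ext m n r (\<lambda>w. (if j = k then unit_vec m i l w else 0)
       - tscale s (if i = l then unit_vec m k j w else 0))"
    by (simp only: matrix_unit_op_alt opscale_lin_ext lin_ext_diff Z)
  show ?thesis
    unfolding R unfolding matrix_unit_op_alt lin_ext_comp opscale_lin_ext lin_ext_diff
  proof (rule lin_ext_cong)
    fix w assume w: "w \<in> tensor_words m n r"
    let ?O = "{(p, q). p < length w \<and> q < length w \<and> p \<noteq> q}"
    have sw: "(\<Sum>(p, q)\<in>?O. two_unit_term m i j k l w p q) = tscale s (\<Sum>(p, q)\<in>?O. two_unit_term m k l i j w p q)"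
    proof -
      have "(\<Sum>(p, q)\<in>?O. two_unit_term m i j k l w p q) = (\<Sum>(p, q)\<in>?O. tscale s (two_unit_term m k l i j w q p))"
        by (rule sum.cong) (auto simp: s_def two_unit_term_swap[of _ w _ m i j k l])
      also have "\<dots> = (\<Sum>(p, q)\<in>?O. tscale s (two_unit_term m k l i j w p q))"
        by (rule sum.reindex_bij_witness[of _ prod.swap prod.swap]) auto
      finally show ?thesis by (simp add: tscale_sum case_prod_unfold)
    qed
    show "lin_ext m n r (unit_vec m i j) (unit_vec m k l w)
        - tscale s (lin_ext m n r (unit_vec m k l) (unit_vec m i j w))
      = (if j = k then unit_vec m i l w else 0) - tscale s (if i = l then unit_vec m k j w else 0)"
    proof -
      have "k \<in> {1..m + n}" "i \<in> {1..m + n}" using assms(1) by auto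
      then show ?thesis
        by (simp only: unit_comp[OF w] sum_two_unit_term sw tscale_simps eq_commute[of l i]) simp
    qed
  qed
qed

lemma gl_tensor_rep_superset:
  assumes "finite A" "Poly_Mapping.keys x \<subseteq> A"
  shows "gl_tensor_rep m n r x
    = (\<Sum>w\<in>A. opscale (Poly_Mapping.lookup x w) (gl_word_op m n r (letters w)))"
  unfolding gl_tensor_rep_def
  by (rule sum.mono_neutral_left) (use assms in \<open>auto simp: in_keys_iff tensor_op.scale_zero_left simp del: zero_fun_apply\<close>)

lemma gl_tensor_rep_add: "gl_tensor_rep m n r (x + y) = gl_tensor_rep m n r x + gl_tensor_rep m n r y"
proof -
  let ?A = "Poly_Mapping.keys x \<union> Poly_Mapping.keys y"
  have "Poly_Mapping.keys (x + y) \<subseteq> ?A" by (rule Poly_Mapping.keys_add)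
  then show ?thesis
    using gl_tensor_rep_superset[of ?A "x + y"] gl_tensor_rep_superset[of ?A x] gl_tensor_rep_superset[of ?A y]
    by (simp add: lookup_add tensor_op.scale_left_distrib sum.distrib del: plus_fun_apply)
qed

lemma gl_tensor_rep_zero: "gl_tensor_rep m n r 0 = 0"
  by (simp add: gl_tensor_rep_def)

lemma gl_tensor_rep_uminus: "gl_tensor_rep m n r (- x) = - gl_tensor_rep m n r x"
  using gl_tensor_rep_add[of m n r "- x" x] by (simp add: gl_tensor_rep_zero eq_neg_iff_add_eq_0 del: plus_fun_apply)

lemma gl_tensor_rep_diff: "gl_tensor_rep m n r (x - y) = gl_tensor_rep m n r x - gl_tensor_rep m n r y"
  using gl_tensor_rep_add[of m n r x "- y"] by (simp add: gl_tensor_rep_uminus)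

lemma gl_tensor_rep_sum: "gl_tensor_rep m n r (sum f A) = (\<Sum>a\<in>A. gl_tensor_rep m n r (f a))"
  by (induction A rule: infinite_finite_induct)
     (simp_all add: gl_tensor_rep_zero gl_tensor_rep_add del: plus_fun_apply zero_fun_apply)

lemma gl_tensor_rep_single:
  "gl_tensor_rep m n r (Poly_Mapping.single w c) = opscale c (gl_word_op m n r (letters w))"
  by (subst gl_tensor_rep_superset[of "{w}"]) auto

lemma poly_mapping_expand:
  "(x :: 'a \<Rightarrow>\<^sub>0 'b::comm_monoid_add) = (\<Sum>a\<in>Poly_Mapping.keys x. Poly_Mapping.single a (Poly_Mapping.lookup x a))"
  by (rule poly_mapping_eqI)
     (auto simp: lookup_sum lookup_single when_def in_keys_iff)

definition gl_words :: "nat \<Rightarrow> nat \<Rightarrow> (nat \<times> nat) list set" where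
  "gl_words m n = {ps. set ps \<subseteq> {1..m + n} \<times> {1..m + n}}"

lemma tensor_id_comp_unit:
  assumes "i \<in> {1..m + n}"
  shows "tensor_id m n r \<circ> matrix_unit_op m n r i j = matrix_unit_op m n r i j"
  unfolding tensor_id_def matrix_unit_op_alt lin_ext_comp
proof (rule lin_ext_cong)
  fix w assume "w \<in> tensor_words m n r"
  then have "w[k := i] \<in> tensor_words m n r" for k
    using assms by (rule list_update_in_tensor_words)
  then show "lin_ext m n r basis_tensor (unit_vec m i j w) = unit_vec m i j w"
    unfolding unit_vec_def lin_ext_sum
    by (intro sum.cong) (simp_all add: lin_ext_lin lin_ext_basis)
qed

lemma tensor_id_idem: "tensor_id m n r \<circ> tensor_id m n r = tensor_id m n r"
  unfolding tensor_id_def lin_ext_comp by (rule lin_ext_cong) (simp add: lin_ext_basis)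

lemma tensor_id_comp_word:
  "ps \<in> gl_words m n \<Longrightarrow> tensor_id m n r \<circ> gl_word_op m n r ps = gl_word_op m n r ps"
  by (cases ps) (auto simp: gl_words_def gl_word_op_def tensor_id_idem tensor_id_comp_unit
    simp flip: comp_assoc)

lemma gl_word_op_append:
  assumes "qs \<in> gl_words m n"
  shows "gl_word_op m n r (ps @ qs) = gl_word_op m n r ps \<circ> gl_word_op m n r qs"
proof (induction ps)
  case Nil
  then show ?case using tensor_id_comp_word[OF assms] by (simp add: gl_word_op_def)
next
  case (Cons p ps)
  then show ?case by (cases p) (simp add: gl_word_op_def comp_assoc)
qed

lemma gl_word_op_linear: "\<exists>f. gl_word_op m n r ps = lin_ext m n r f"
proof (induction ps)
  case Nil
  then show ?case by (auto simp: gl_word_op_def tensor_id_def)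
next
  case (Cons p ps)
  then obtain f where "gl_word_op m n r ps = lin_ext m n r f" by blast
  then show ?case
    by (cases p) (auto simp: gl_word_op_def matrix_unit_op_alt lin_ext_comp)
qed

lemma gl_word_op_apply:
  "gl_word_op m n r ps (tscale c v) = tscale c (gl_word_op m n r ps v)"
  "gl_word_op m n r ps (sum g A) = (\<Sum>x\<in>A. gl_word_op m n r ps (g x))"
  using gl_word_op_linear[of m n r ps] by (auto simp: lin_ext_lin lin_ext_sum)

lemma gl_tensor_algebra_carrier_iff: "x \<in> carrier (gl_tensor_algebra m n) \<longleftrightarrow> letters ` Poly_Mapping.keys x \<subseteq> gl_words m n"
  by (auto simp: gl_tensor_algebra_def gl_words_def)

lemma gl_tensor_rep_mult:
  assumes "y \<in> carrier (gl_tensor_algebra m n)"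
  shows "gl_tensor_rep m n r (x * y) = gl_tensor_rep m n r x \<circ> gl_tensor_rep m n r y"
proof -
  let ?c = "\<lambda>u v. Poly_Mapping.lookup x u * Poly_Mapping.lookup y v"
  have "x * y = (\<Sum>u\<in>Poly_Mapping.keys x. \<Sum>v\<in>Poly_Mapping.keys y. Poly_Mapping.single (u + v) (?c u v))"
    by (subst (1) poly_mapping_expand[of x], subst (1) poly_mapping_expand[of y])
       (simp add: sum_product mult_single)
  then have "gl_tensor_rep m n r (x * y) = (\<Sum>u\<in>Poly_Mapping.keys x. \<Sum>v\<in>Poly_Mapping.keys y.
      opscale (?c u v) (gl_word_op m n r (letters u) \<circ> gl_word_op m n r (letters v)))"
    using assms
    by (auto simp: gl_tensor_rep_sum gl_tensor_rep_single plus_fword_def gl_word_op_append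
      gl_tensor_algebra_carrier_iff image_subset_iff intro!: sum.cong)
  also have "\<dots> = gl_tensor_rep m n r x \<circ> gl_tensor_rep m n r y"
    by (rule ext) (simp add: gl_tensor_rep_def sum_fun_apply opscale_def gl_word_op_apply tscale_sum
      tscale_simps)
  finally show ?thesis .
qed

lemma gl_tensor_algebra_ops:
  "x \<oplus>\<^bsub>gl_tensor_algebra m n\<^esub> y = x + y" "x \<otimes>\<^bsub>gl_tensor_algebra m n\<^esub> y = x * y"
  "\<zero>\<^bsub>gl_tensor_algebra m n\<^esub> = 0" "\<one>\<^bsub>gl_tensor_algebra m n\<^esub> = 1"
  by (simp_all add: gl_tensor_algebra_def)

lemma ring_gl_tensor_algebra: "ring (gl_tensor_algebra m n)"
proof (rule ringI)
  have p: "x + y \<in> carrier (gl_tensor_algebra m n)" if "x \<in> carrier (gl_tensor_algebra m n)" "y \<in> carrier (gl_tensor_algebra m n)" for x y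
    using that Poly_Mapping.keys_add[of x y] unfolding gl_tensor_algebra_carrier_iff by blast
  show "abelian_group (gl_tensor_algebra m n)"
  proof (rule abelian_groupI)
    fix x assume "x \<in> carrier (gl_tensor_algebra m n)"
    then have "- x \<in> carrier (gl_tensor_algebra m n)" by (simp add: gl_tensor_algebra_carrier_iff)
    then show "\<exists>y\<in>carrier (gl_tensor_algebra m n). y \<oplus>\<^bsub>gl_tensor_algebra m n\<^esub> x = \<zero>\<^bsub>gl_tensor_algebra m n\<^esub>"
      by (intro bexI[of _ "- x"]) (simp_all add: gl_tensor_algebra_ops)
  next
    fix x y assume "x \<in> carrier (gl_tensor_algebra m n)" "y \<in> carrier (gl_tensor_algebra m n)"
    with p[of x y] show "x \<oplus>\<^bsub>gl_tensor_algebra m n\<^esub> y \<in> carrier (gl_tensor_algebra m n)"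
      by (simp add: gl_tensor_algebra_ops)
  qed (simp_all add: gl_tensor_algebra_ops gl_tensor_algebra_carrier_iff add.assoc add.commute)
  show "monoid (gl_tensor_algebra m n)"
  proof (rule monoidI)
    fix x y assume xy: "x \<in> carrier (gl_tensor_algebra m n)" "y \<in> carrier (gl_tensor_algebra m n)"
    have "letters w \<in> gl_words m n" if w: "w \<in> Poly_Mapping.keys (x * y)" for w
    proof -
      obtain u v where "w = u + v" "u \<in> Poly_Mapping.keys x" "v \<in> Poly_Mapping.keys y"
        using subsetD[OF keys_mult w] by auto
      then have "letters w = letters u @ letters v" "letters u \<in> gl_words m n" "letters v \<in> gl_words m n"
        using xy by (auto simp: gl_tensor_algebra_carrier_iff plus_fword_def)
      then show ?thesis by (simp add: gl_words_def)
    qed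
    then have "x * y \<in> carrier (gl_tensor_algebra m n)"
      by (auto simp: gl_tensor_algebra_carrier_iff)
    then show "x \<otimes>\<^bsub>gl_tensor_algebra m n\<^esub> y \<in> carrier (gl_tensor_algebra m n)"
      by (simp add: gl_tensor_algebra_ops)
  qed (simp_all add: gl_tensor_algebra_ops mult.assoc gl_tensor_algebra_carrier_iff gl_words_def zero_fword_def)
qed (simp_all add: gl_tensor_algebra_ops distrib_left distrib_right)

lemma matrix_unit_carrier:
  "i \<in> {1..m + n} \<Longrightarrow> j \<in> {1..m + n} \<Longrightarrow> matrix_unit i j \<in> carrier (gl_tensor_algebra m n)"
  by (auto simp: gl_tensor_algebra_def matrix_unit_def)

lemma gl_tensor_rep_unit:
  "gl_tensor_rep m n r (matrix_unit i j) = matrix_unit_op m n r i j"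
proof -
  have "matrix_unit_op m n r i j \<circ> tensor_id m n r = matrix_unit_op m n r i j"
    unfolding tensor_id_def matrix_unit_op_alt lin_ext_comp
    by (rule lin_ext_cong) (simp add: lin_ext_basis)
  then show ?thesis
    by (simp add: matrix_unit_def gl_tensor_rep_single gl_word_op_def)
qed

lemma gl_relator_carrier:
  assumes "{i, j, k, l} \<subseteq> {1..m + n}"
  shows "gl_relator m i j k l \<in> carrier (gl_tensor_algebra m n)"
proof -
  interpret ring "gl_tensor_algebra m n" by (rule ring_gl_tensor_algebra)
  have a: "x + y \<in> carrier (gl_tensor_algebra m n)" "x * y \<in> carrier (gl_tensor_algebra m n)"
    if "x \<in> carrier (gl_tensor_algebra m n)" "y \<in> carrier (gl_tensor_algebra m n)" for x y
    using a_closed[OF that] m_closed[OF that] by (simp_all add: gl_tensor_algebra_def)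
  have u: "- x \<in> carrier (gl_tensor_algebra m n)" if "x \<in> carrier (gl_tensor_algebra m n)" for x
    using that by (simp add: gl_tensor_algebra_carrier_iff)
  have d: "x - y \<in> carrier (gl_tensor_algebra m n)" if "x \<in> carrier (gl_tensor_algebra m n)" "y \<in> carrier (gl_tensor_algebra m n)" for x y
    using a(1)[OF that(1) u[OF that(2)]] by simp
  have z: "0 \<in> carrier (gl_tensor_algebra m n)" "1 \<in> carrier (gl_tensor_algebra m n)"
    by (auto simp: gl_tensor_algebra_def zero_fword_def)
  have p: "(-1) ^ e \<in> carrier (gl_tensor_algebra m n)" for e by (induction e) (simp_all add: u z)
  have e: "matrix_unit x y \<in> carrier (gl_tensor_algebra m n)" if "x \<in> {i, j, k, l}" "y \<in> {i, j, k, l}" for x y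
    using that assms by (blast intro: matrix_unit_carrier)
  show ?thesis
    unfolding gl_relator_def Let_def by (intro a d p) (simp_all add: z e)
qed

lemma gl_tensor_rep_relator:
  assumes "{i, j, k, l} \<subseteq> {1..m + n}"
  shows "gl_tensor_rep m n r (gl_relator m i j k l) = 0"
proof -
  define N where "N = (parity m i + parity m j) * (parity m k + parity m l)"
  have s: "gl_tensor_rep m n r ((-1) ^ N * x) = opscale ((-1) ^ N) (gl_tensor_rep m n r x)" for x
    by (cases "even N") (simp_all add: gl_tensor_rep_uminus)
  have c: "x \<in> {1..m + n}" if "x \<in> {i, j, k, l}" for x
    using assms that by blast
  have mu: "matrix_unit x y \<in> carrier (gl_tensor_algebra m n)" if "x \<in> {i, j, k, l}" "y \<in> {i, j, k, l}" for x y
    using that by (intro matrix_unit_carrier c)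
  have "gl_tensor_rep m n r (gl_relator m i j k l) =
    (matrix_unit_op m n r i j \<circ> matrix_unit_op m n r k l)
      - opscale ((-1) ^ N) (matrix_unit_op m n r k l \<circ> matrix_unit_op m n r i j)
    - ((if j = k then matrix_unit_op m n r i l else 0)
      - opscale ((-1) ^ N) (if i = l then matrix_unit_op m n r k j else 0))"
    unfolding gl_relator_def Let_def N_def[symmetric] mult.assoc gl_tensor_rep_diff s
    by (intro arg_cong2[where f = "(-)"] arg_cong[where f = "opscale _"])
       (auto simp: gl_tensor_rep_mult mu gl_tensor_rep_unit gl_tensor_rep_zero)
  also have "\<dots> = 0"
    unfolding N_def matrix_unit_op_supercommutator[OF assms, of r] by (rule diff_self)
  finally show ?thesis .
qed

lemma gl_ideal_kernel: "gl_ideal m n \<subseteq> {x \<in> carrier (gl_tensor_algebra m n). gl_tensor_rep m n r x = 0}" (is "_ \<subseteq> ?K")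
proof -
  interpret ring "gl_tensor_algebra m n" by (rule ring_gl_tensor_algebra)
  have w0: "gl_word_op m n r ps 0 = 0" for ps
    using gl_word_op_apply(1)[of m n r ps 0 0] by (simp add: tscale_simps)
  have r0: "gl_tensor_rep m n r x \<circ> 0 = 0" for x
    by (rule ext) (simp add: gl_tensor_rep_def sum_fun_apply opscale_def w0 tscale_simps)
  have z0: "(0 :: tensor_op) \<circ> T = 0" for T :: tensor_op by (rule ext) simp
  have "ideal ?K (gl_tensor_algebra m n)"
  proof (rule idealI)
    show "ring (gl_tensor_algebra m n)" by (rule ring_gl_tensor_algebra)
    show "subgroup ?K (add_monoid (gl_tensor_algebra m n))"
    proof (rule add.subgroupI)
      have "0 \<in> ?K" using zero_closed by (simp add: gl_tensor_rep_zero gl_tensor_algebra_def)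
      then show "?K \<noteq> {}" by blast
    next
      fix a assume a: "a \<in> ?K"
      then have "\<ominus>\<^bsub>gl_tensor_algebra m n\<^esub> a = - a"
        by (intro minus_equality) (auto simp: gl_tensor_algebra_def)
      with a show "\<ominus>\<^bsub>gl_tensor_algebra m n\<^esub> a \<in> ?K" by (simp add: gl_tensor_rep_uminus gl_tensor_algebra_carrier_iff)
    next
      fix a b assume "a \<in> ?K" "b \<in> ?K"
      then show "a \<oplus>\<^bsub>gl_tensor_algebra m n\<^esub> b \<in> ?K"
        using a_closed[of a b] by (auto simp: gl_tensor_algebra_def gl_tensor_rep_add)
    qed auto
  next
    fix a x assume a: "a \<in> ?K" "x \<in> carrier (gl_tensor_algebra m n)"
    then have "gl_tensor_rep m n r (x * a) = 0" "gl_tensor_rep m n r (a * x) = 0"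
      using r0 z0 by (simp_all add: gl_tensor_rep_mult)
    with a m_closed[of x a] m_closed[of a x]
    show "x \<otimes>\<^bsub>gl_tensor_algebra m n\<^esub> a \<in> ?K" "a \<otimes>\<^bsub>gl_tensor_algebra m n\<^esub> x \<in> ?K"
      by (auto simp: gl_tensor_algebra_def)
  qed
  then show ?thesis
    unfolding gl_ideal_def
    by (rule genideal_minimal) (auto simp: gl_relator_carrier gl_tensor_rep_relator)
qed

lemma gl_rep_coset:
  assumes "x \<in> carrier (gl_tensor_algebra m n)"
  shows "gl_rep m n r (gl_ideal m n +>\<^bsub>gl_tensor_algebra m n\<^esub> x) = gl_tensor_rep m n r x"
proof -
  interpret ring "gl_tensor_algebra m n" by (rule ring_gl_tensor_algebra)
  have "ideal (gl_ideal m n) (gl_tensor_algebra m n)"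
    unfolding gl_ideal_def by (rule genideal_ideal) (auto simp: gl_relator_carrier)
  then have "\<zero>\<^bsub>gl_tensor_algebra m n\<^esub> \<in> gl_ideal m n"
    by (intro additive_subgroup.zero_closed ideal.axioms)
  moreover have "gl_ideal m n +>\<^bsub>gl_tensor_algebra m n\<^esub> x = (\<lambda>a. a + x) ` gl_ideal m n"
    by (auto simp: a_r_coset_def r_coset_def gl_tensor_algebra_def)
  moreover have "gl_tensor_rep m n r (a + x) = gl_tensor_rep m n r x" if "a \<in> gl_ideal m n" for a
    using that gl_ideal_kernel[of m n r] by (auto simp: gl_tensor_rep_add)
  ultimately have "gl_tensor_rep m n r ` (gl_ideal m n +>\<^bsub>gl_tensor_algebra m n\<^esub> x) = {gl_tensor_rep m n r x}"
    by (auto simp: image_iff)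
  then show ?thesis by (simp add: gl_rep_def)
qed

lemma schur_superalgebra_eq:
  "schur_superalgebra m n r = gl_tensor_rep m n r ` carrier (gl_tensor_algebra m n)"
proof -
  have "carrier (gl_enveloping m n) = (\<lambda>x. gl_ideal m n +>\<^bsub>gl_tensor_algebra m n\<^esub> x) ` carrier (gl_tensor_algebra m n)"
    by (auto simp: gl_enveloping_def FactRing_def A_RCOSETS_def')
  then show ?thesis
    by (auto simp: schur_superalgebra_def gl_rep_coset image_image)
qed

end

theory Submission
  imports
    Defs
    "HOL-Combinatorics.Cycles"
    "HOL-Computational_Algebra.Computational_Algebra"
    "Jordan_Normal_Form.Determinant"
begin

text \<open>
  Write \<open>\<eta>\<close> for the signed permutation action, \<open>S\<close> for the Schur superalgebra and \<open>H\<close> for the set of hook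
  partitions. Three facts give the theorem: every \<open>\<eta>(c\<^sub>p)\<close> lies in the center of \<open>S\<close>, the operators
  \<open>\<eta>(c\<^sub>p)\<close> with \<open>p \<in> H\<close> are linearly independent, and the center has dimension at most \<open>|H|\<close>.
  
  \<^emph>\<open>Centrality.\<close> Permutations commute with the matrix units (\<open>matrix_unit_op_perm_commute\<close>). Conversely an
  operator that commutes with all permutations equals its average over \<open>S\<^sub>r\<close>, hence is a combination
  of sums, over all choices of distinct sites, of products of matrix units that act at these sites.
  Such a symmetrized product is a polynomial in the \<open>E\<^sub>i\<^sub>j\<close>, by induction on the number of sites. So it
  lies in \<open>S\<close> (\<open>commutant_in_schur\<close>), and class sums commute with all permutations.
  
  \<^emph>\<open>Independence.\<close> The trace of \<open>\<eta>(\<sigma>)\<close> against a diagonal matrix with eigenvalues \<open>x\<close> is the product of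
  the super power sums \<open>p\<^sub>k(x)\<close> over the cycle lengths \<open>k\<close> of \<open>\<sigma>\<close> (\<open>weighted_trace_perm\<close>), so it suffices
  to treat the products of the \<open>p\<^sub>k\<close> over the parts of the hook partitions. After a change of sign of the
  odd variables, \<open>\<plusminus>p\<^sub>k\<close> is \<open>\<Sum>\<xi>\<^sub>i\<^sup>k - \<Sum>\<zeta>\<^sub>j\<^sup>k\<close> with \<open>a = min m n\<close> variables \<open>\<xi>\<^sub>i\<close> and \<open>b = max m n\<close> variables \<open>\<zeta>\<^sub>j\<close>.
  It vanishes when \<open>\<zeta>\<close> is \<open>\<xi>\<close> filled up with zeros, and the idea is to expand around such a point: as
  \<open>a \<le> b\<close>, one may choose \<open>\<zeta>\<close> with \<open>\<Prod>(1 - \<zeta>\<^sub>j t) = \<Prod>(1 - \<xi>\<^sub>i t) + s\<^sup>M \<gamma>(t)\<close> for any \<open>\<gamma>\<close> of degree at most \<open>b\<close>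
  without constant term. For small \<open>s\<close>, \<open>p\<^sub>k\<close> then behaves like \<open>k s\<^sup>M\<close> times the coefficient of \<open>t\<^sup>k\<close> in
  \<open>\<gamma>(t) / \<Prod>(1 - \<xi>\<^sub>i t)\<close>. If the coefficients of \<open>\<gamma>\<close> are suitable powers of \<open>s\<close>, the order at which a
  product of \<open>p\<^sub>k\<close>'s vanishes reveals the number of parts and the multiplicity of each part below \<open>b\<close>,
  and its leading coefficient is a multiple of the product of the complete symmetric functions
  \<open>h\<^bsub>k-b\<^esub>(\<xi>)\<close> over the parts \<open>k > b\<close> (\<open>perturbation_limit\<close>). A hook partition has at most \<open>a\<close> such parts, and
  products of at most \<open>a\<close> complete symmetric functions in \<open>a\<close> variables are linearly independent
  (\<open>complete_sym_products_independent\<close>).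
  
  \<^emph>\<open>Dimension.\<close> Harish-Chandra's argument bounds the center. A central element multiplies a singular
  vector by a scalar, which depends only on the weight, and it is zero if all these scalars vanish
  (\<open>center_scalar\<close>, \<open>center_kill_weight\<close>, \<open>center_eq_0\<close>). In the standard Hermitian form \<open>E\<^sub>i\<^sub>j\<close> and \<open>E\<^sub>j\<^sub>i\<close> are
  adjoint, and nonnegativity of norms shows that the weight \<open>(\<alpha>|\<beta>)\<close> of a singular vector is dominant
  and that \<open>\<beta>\<close> has at most \<open>\<alpha>\<^sub>m\<close> nonzero entries. The rows \<open>\<alpha>\<^sub>i\<close> and, below them, the columns \<open>\<beta>\<^sub>j\<close>
  therefore form a Young diagram of hook shape, and there are at most \<open>|H|\<close> such weights
  (\<open>singular_weights_card\<close>).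
\<close>

hide_const (open) Matrix.unit_vec
hide_fact (open) Matrix.unit_vec_def
no_notation vec_index (infixl "$" 100)

section \<open>Elements of the Schur superalgebra\<close>

lemma sum_lin_ext: "(\<Sum>x\<in>A. lin_ext m n r (f x)) = lin_ext m n r (\<lambda>w. \<Sum>x\<in>A. f x w)"
  by (rule ext) (simp add: sum_fun_apply lin_ext_def tscale_sum sum.swap[of _ A])

lemma tensor_id_apply: "tensor_id m n r v = (\<lambda>u. if u \<in> tensor_words m n r then v u else 0)"
  by (rule ext) (simp add: tensor_id_def lin_ext_def sum_fun_apply tscale_def basis_tensor_def
      finite_tensor_words if_distrib cong: if_cong)

lemma lin_ext_tensor_id: "lin_ext m n r f (tensor_id m n r v) = lin_ext m n r f v"
  by (simp add: lin_ext_def tensor_id_apply cong: sum.cong)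

lemma lin_ext_comp_tensor_id: "lin_ext m n r f \<circ> tensor_id m n r = lin_ext m n r f"
  by (rule ext) (simp add: lin_ext_tensor_id)

lemma tensor_id_comp_lin_ext:
  assumes "\<And>w u. w \<in> tensor_words m n r \<Longrightarrow> u \<notin> tensor_words m n r \<Longrightarrow> f w u = 0"
  shows "tensor_id m n r \<circ> lin_ext m n r f = lin_ext m n r f"
  by (rule ext, rule ext) (simp add: tensor_id_apply lin_ext_def sum_fun_apply tscale_def assms)

lemma gl_algebra_scalar: "Poly_Mapping.single 0 c \<in> carrier (gl_tensor_algebra m n)"
  by (auto simp: gl_tensor_algebra_carrier_iff gl_words_def zero_fword_def)

lemma gl_tensor_rep_scalar: "gl_tensor_rep m n r (Poly_Mapping.single 0 c) = opscale c (tensor_id m n r)"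
  by (simp add: gl_tensor_rep_single zero_fword_def gl_word_op_def)

lemma schur_superalgebra_id: "tensor_id m n r \<in> schur_superalgebra m n r"
  unfolding schur_superalgebra_eq
  using gl_tensor_rep_scalar[of m n r 1] gl_algebra_scalar[of 1 m n] by (metis image_eqI tensor_op.scale_one)

lemma schur_superalgebra_comp:
  assumes "S \<in> schur_superalgebra m n r" "T \<in> schur_superalgebra m n r"
  shows "S \<circ> T \<in> schur_superalgebra m n r"
proof -
  interpret ring "gl_tensor_algebra m n" by (rule ring_gl_tensor_algebra)
  show ?thesis
    using assms m_closed unfolding schur_superalgebra_eq
    by (auto simp: gl_tensor_algebra_ops gl_tensor_rep_mult[symmetric])
qed

lemma schur_superalgebra_add:
  assumes "S \<in> schur_superalgebra m n r" "T \<in> schur_superalgebra m n r"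
  shows "S + T \<in> schur_superalgebra m n r"
proof -
  interpret ring "gl_tensor_algebra m n" by (rule ring_gl_tensor_algebra)
  show ?thesis
    using assms a_closed unfolding schur_superalgebra_eq
    by (auto simp: gl_tensor_algebra_ops gl_tensor_rep_add[symmetric] simp del: plus_fun_apply)
qed

lemma matrix_unit_op_in_schur:
  "i \<in> {1..m + n} \<Longrightarrow> j \<in> {1..m + n} \<Longrightarrow> matrix_unit_op m n r i j \<in> schur_superalgebra m n r"
  unfolding schur_superalgebra_eq
  by (metis gl_tensor_rep_unit image_eqI matrix_unit_carrier)

text \<open>
  Every element of the Schur superalgebra is given by a matrix, so it is determined by the images of
  the basis tensors and does not leave the span of the words.
\<close>

lemma schur_superalgebra_linear:
  assumes "T \<in> schur_superalgebra m n r"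
  obtains f where "T = lin_ext m n r f"
    "\<And>w u. w \<in> tensor_words m n r \<Longrightarrow> u \<notin> tensor_words m n r \<Longrightarrow> f w u = 0"
proof -
  obtain x where x: "x \<in> carrier (gl_tensor_algebra m n)" "T = gl_tensor_rep m n r x"
    using assms by (auto simp: schur_superalgebra_eq)
  have 1: "\<exists>f. gl_word_op m n r (letters u) = lin_ext m n r f" for u
    by (rule gl_word_op_linear)
  then obtain g where g: "\<And>u. gl_word_op m n r (letters u) = lin_ext m n r (g u)" by metis
  define f where "f = (\<lambda>w. \<Sum>u\<in>Poly_Mapping.keys x. tscale (Poly_Mapping.lookup x u) (g u w))"
  have T: "T = lin_ext m n r f"
    by (simp add: x(2) gl_tensor_rep_def g opscale_lin_ext sum_lin_ext f_def)
  have "g u w v = 0" if "u \<in> Poly_Mapping.keys x" "w \<in> tensor_words m n r" "v \<notin> tensor_words m n r" for u w v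
  proof -
    have "tensor_id m n r \<circ> gl_word_op m n r (letters u) = gl_word_op m n r (letters u)"
      using x(1) that(1) by (intro tensor_id_comp_word) (auto simp: gl_tensor_algebra_carrier_iff)
    then have "tensor_id m n r (lin_ext m n r (g u) (basis_tensor w)) = lin_ext m n r (g u) (basis_tensor w)"
      by (metis comp_apply g)
    then have "tensor_id m n r (g u w) = g u w" using that by (simp add: lin_ext_basis)
    then show ?thesis using that(3) by (simp add: tensor_id_apply fun_eq_iff) metis
  qed
  then have "\<And>w u. w \<in> tensor_words m n r \<Longrightarrow> u \<notin> tensor_words m n r \<Longrightarrow> f w u = 0"
    by (simp add: f_def sum_fun_apply tscale_def)
  with T show ?thesis by (rule that)
qed

lemma schur_superalgebra_scale:
  assumes "T \<in> schur_superalgebra m n r"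
  shows "opscale c T \<in> schur_superalgebra m n r"
proof -
  obtain f where f: "T = lin_ext m n r f"
    "\<And>w u. w \<in> tensor_words m n r \<Longrightarrow> u \<notin> tensor_words m n r \<Longrightarrow> f w u = 0"
    using schur_superalgebra_linear[OF assms] by metis
  have "opscale c (tensor_id m n r) \<circ> T = opscale c T"
  proof -
    have "tensor_id m n r \<circ> T = T"
      unfolding f(1) by (rule tensor_id_comp_lin_ext) (rule f(2))
    then have "tensor_id m n r (T v) = T v" for v by (metis comp_apply)
    then show ?thesis by (simp add: opscale_def comp_def)
  qed
  moreover have "opscale c (tensor_id m n r) \<in> schur_superalgebra m n r"
    unfolding schur_superalgebra_eq by (metis gl_tensor_rep_scalar gl_algebra_scalar image_eqI)
  ultimately show ?thesis using schur_superalgebra_comp assms by metis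
qed

lemma schur_superalgebra_zero: "0 \<in> schur_superalgebra m n r"
  using schur_superalgebra_scale[OF schur_superalgebra_id, where c = 0] by (simp del: zero_fun_apply)

lemma schur_superalgebra_sum:
  "(\<And>x. x \<in> A \<Longrightarrow> f x \<in> schur_superalgebra m n r) \<Longrightarrow> sum f A \<in> schur_superalgebra m n r"
  by (induction A rule: infinite_finite_induct)
     (simp_all add: schur_superalgebra_zero schur_superalgebra_add del: plus_fun_apply zero_fun_apply)

text \<open>
  Elements of the Schur superalgebra are combinations of words in the matrix units, and a word is
  built from the identity by composing with matrix units on the left.
\<close>

lemma schur_superalgebra_induct [consumes 1, case_names one unit add scale]:
  assumes "T \<in> schur_superalgebra m n r"
    and one: "P (tensor_id m n r)"
    and unit: "\<And>i j T. i \<in> {1..m + n} \<Longrightarrow> j \<in> {1..m + n} \<Longrightarrow> P T \<Longrightarrow> P (matrix_unit_op m n r i j \<circ> T)"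
    and add: "\<And>S T. P S \<Longrightarrow> P T \<Longrightarrow> P (S + T)"
    and scale: "\<And>c T. P T \<Longrightarrow> P (opscale c T)"
  shows "P T"
proof -
  have zero: "P 0" using scale[OF one, of 0] by (simp del: zero_fun_apply)
  have sum: "(\<And>x. x \<in> A \<Longrightarrow> P (f x)) \<Longrightarrow> P (sum f A)" for A and f :: "(nat \<times> nat) fword \<Rightarrow> _"
    by (induction A rule: infinite_finite_induct) (simp_all add: zero add del: plus_fun_apply zero_fun_apply)
  have word: "P (gl_word_op m n r ps)" if "ps \<in> gl_words m n" for ps
    using that by (induction ps) (auto simp: gl_word_op_def one unit gl_words_def)
  obtain x where x: "x \<in> carrier (gl_tensor_algebra m n)" "T = gl_tensor_rep m n r x"
    using assms(1) by (auto simp: schur_superalgebra_eq)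
  show ?thesis unfolding x(2) gl_tensor_rep_def
    by (intro sum scale word) (use x(1) in \<open>auto simp: gl_tensor_algebra_carrier_iff\<close>)
qed

text \<open>
  The transposed description of a matrix unit: the coefficient of \<open>u\<close> in the image collects the
  coefficients of the words from which \<open>u\<close> arises. Changing the letter at position \<open>k\<close> does not affect
  the sign, which only depends on the letters before \<open>k\<close>.
\<close>

lemma matrix_unit_op_apply:
  assumes "i \<in> {1..m + n}" "j \<in> {1..m + n}"
  shows "matrix_unit_op m n r i j v u = (if u \<in> tensor_words m n r
    then \<Sum>k<r. if u ! k = i then leading_sign m (parity m i + parity m j) k u * v (u[k := j]) else 0 else 0)"
proof (cases "u \<in> tensor_words m n r")
  case True
  then have l: "length u = r" by (simp add: tensor_words_def)
  have "matrix_unit_op m n r i j v u = (\<Sum>w\<in>tensor_words m n r. v w * unit_vec m i j w u)"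
    by (simp add: matrix_unit_op_alt lin_ext_def sum_fun_apply tscale_def)
  also have "\<dots> = (\<Sum>w\<in>tensor_words m n r. \<Sum>k<r. if w ! k = j \<and> u = w[k := i]
       then leading_sign m (parity m i + parity m j) k w * v w else 0)"
  proof (rule sum.cong[OF refl])
    fix w assume "w \<in> tensor_words m n r"
    then have "unit_vec m i j w u = (\<Sum>k<r. if w ! k = j \<and> u = w[k := i]
       then leading_sign m (parity m i + parity m j) k w else 0)"
      unfolding unit_vec_def sum_fun_apply
      by (intro sum.cong) (simp_all add: tscale_def basis_tensor_def tensor_words_def)
    then show "v w * unit_vec m i j w u = (\<Sum>k<r. if w ! k = j \<and> u = w[k := i]
       then leading_sign m (parity m i + parity m j) k w * v w else 0)"
      by (simp only: sum_distrib_left) (rule sum.cong, simp_all)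
  qed
  also have "\<dots> = (\<Sum>k<r. \<Sum>w\<in>tensor_words m n r. if w ! k = j \<and> u = w[k := i]
       then leading_sign m (parity m i + parity m j) k w * v w else 0)"
    by (rule sum.swap)
  also have "\<dots> = (\<Sum>k<r. if u ! k = i then leading_sign m (parity m i + parity m j) k u * v (u[k := j]) else 0)"
  proof (rule sum.cong[OF refl])
    fix k assume k: "k \<in> {..<r}"
    have eq: "w ! k = j \<and> u = w[k := i] \<longleftrightarrow> u ! k = i \<and> w = u[k := j]" if "w \<in> tensor_words m n r" for w
    proof -
      have lw: "length w = r" using that by (simp add: tensor_words_def)
      show ?thesis
      proof (intro iffI conjI; elim conjE)
        assume "w ! k = j" "u = w[k := i]"
        then show "w = u[k := j]" using list_update_id[of w k] by (simp del: list_update_id)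
      next
        assume "u ! k = i" "w = u[k := j]"
        then show "u = w[k := i]" using list_update_id[of u k] by (simp del: list_update_id)
      qed (use k l lw in simp_all)
    qed
    have "(\<Sum>w\<in>tensor_words m n r. if w ! k = j \<and> u = w[k := i]
       then leading_sign m (parity m i + parity m j) k w * v w else 0)
      = (\<Sum>w\<in>tensor_words m n r. if w = u[k := j] then (if u ! k = i then leading_sign m (parity m i + parity m j) k (u[k := j]) * v (u[k := j]) else 0) else 0)"
    proof (rule sum.cong[OF refl])
      fix w assume "w \<in> tensor_words m n r"
      from eq[OF this] show "(if w ! k = j \<and> u = w[k := i] then leading_sign m (parity m i + parity m j) k w * v w else 0)
        = (if w = u[k := j] then (if u ! k = i then leading_sign m (parity m i + parity m j) k (u[k := j]) * v (u[k := j]) else 0) else 0)"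
        by (cases "u ! k = i \<and> w = u[k := j]") (simp_all only: simp_thms if_True if_False, auto)
    qed
    also have "\<dots> = (if u ! k = i then leading_sign m (parity m i + parity m j) k (u[k := j]) * v (u[k := j]) else 0)"
      using list_update_in_tensor_words[OF True assms(2)] by (simp add: finite_tensor_words)
    also have "leading_sign m (parity m i + parity m j) k (u[k := j]) = leading_sign m (parity m i + parity m j) k u"
      using k l by (subst leading_sign_update) auto
    finally show "(\<Sum>w\<in>tensor_words m n r. if w ! k = j \<and> u = w[k := i]
       then leading_sign m (parity m i + parity m j) k w * v w else 0)
       = (if u ! k = i then leading_sign m (parity m i + parity m j) k u * v (u[k := j]) else 0)" .
  qed
  finally show ?thesis using True by simp
next
  case False
  have "tensor_id m n r (matrix_unit_op m n r i j v) = matrix_unit_op m n r i j v"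
    using tensor_id_comp_unit[OF assms(1)] by (metis comp_apply)
  then show ?thesis using False by (metis tensor_id_apply)
qed

lemma matrix_unit_op_diag:
  assumes "i \<in> {1..m + n}"
  shows "matrix_unit_op m n r i i v u = (if u \<in> tensor_words m n r then of_nat (count (mset u) i) * v u else 0)"
proof -
  have "(\<Sum>k<r. if u ! k = i then leading_sign m (parity m i + parity m i) k u * v (u[k := i]) else 0)
     = of_nat (count (mset u) i) * v u" if "u \<in> tensor_words m n r"
  proof -
    have l: "length u = r" using that by (simp add: tensor_words_def)
    have "leading_sign m (parity m i + parity m i) k u = 1" for k
      by (simp add: leading_sign_def mult_2[symmetric] mult.assoc)
    then have "(\<Sum>k<r. if u ! k = i then leading_sign m (parity m i + parity m i) k u * v (u[k := i]) else 0)
       = (\<Sum>k<r. if u ! k = i then v u else 0)" by (intro sum.cong) auto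
    also have "\<dots> = of_nat (card {k. k < r \<and> u ! k = i}) * v u"
      by (simp add: sum.If_cases Int_def)
    also have "card {k. k < r \<and> u ! k = i} = count (mset u) i"
      using l by (simp add: count_mset count_list_eq_length_filter length_filter_conv_card eq_commute)
    finally show ?thesis .
  qed
  then show ?thesis using assms by (simp add: matrix_unit_op_apply)
qed

lemma matrix_unit_op_lin:
  "matrix_unit_op m n r i j (u + v) = matrix_unit_op m n r i j u + matrix_unit_op m n r i j v"
  "matrix_unit_op m n r i j (tscale c v) = tscale c (matrix_unit_op m n r i j v)"
  "matrix_unit_op m n r i j 0 = 0"
  by (simp_all add: matrix_unit_op_alt lin_ext_lin del: plus_fun_apply zero_fun_apply)

section \<open>Operators commuting with the permutations\<close>

text \<open>
  The matrix unit \<open>E\<^sub>i\<^sub>j\<close> acting on the tensor factor at position \<open>p\<close>, with the sign by which it passes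
  the factors on its left. With this sign, units at different sites supercommute.
\<close>

definition site_op :: "nat \<Rightarrow> nat \<Rightarrow> nat \<Rightarrow> nat \<Rightarrow> nat \<Rightarrow> nat \<Rightarrow> tensor_op" where
  "site_op m n r p i j = lin_ext m n r (\<lambda>w. if w ! p = j
     then tscale (leading_sign m (parity m i + parity m j) p w) (basis_tensor (w[p := i])) else 0)"

lemma matrix_unit_op_sum_sites: "matrix_unit_op m n r i j = (\<Sum>p<r. site_op m n r p i j)"
  unfolding matrix_unit_op_alt site_op_def sum_lin_ext
  by (rule lin_ext_cong) (simp add: unit_vec_def tensor_words_def)

lemma site_op_comp:
  assumes "k \<in> {1..m + n}"
  shows "site_op m n r q i j \<circ> site_op m n r p k l = lin_ext m n r (\<lambda>w. two_unit_term m i j k l w p q)"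
  unfolding site_op_def lin_ext_comp
proof (rule lin_ext_cong)
  fix w assume w: "w \<in> tensor_words m n r"
  show "lin_ext m n r (\<lambda>w. if w ! q = j then tscale (leading_sign m (parity m i + parity m j) q w)
        (basis_tensor (w[q := i])) else 0)
     (if w ! p = l then tscale (leading_sign m (parity m k + parity m l) p w) (basis_tensor (w[p := k])) else 0)
     = two_unit_term m i j k l w p q"
    using list_update_in_tensor_words[OF w assms, of p]
    by (simp add: two_unit_term_def lin_ext_lin lin_ext_basis tscale_simps del: zero_fun_apply plus_fun_apply)
qed

lemma site_op_swap:
  assumes "i \<in> {1..m + n}" "k \<in> {1..m + n}" "p < r" "q < r" "p \<noteq> q"
  shows "site_op m n r q i j \<circ> site_op m n r p k l =
    opscale ((-1) ^ ((parity m i + parity m j) * (parity m k + parity m l)))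
      (site_op m n r p k l \<circ> site_op m n r q i j)"
  unfolding site_op_comp[OF assms(2)] site_op_comp[OF assms(1)] opscale_lin_ext
  by (rule lin_ext_cong, rule two_unit_term_swap) (use assms in \<open>auto simp: tensor_words_def\<close>)

lemma site_op_merge:
  assumes "k \<in> {1..m + n}" "p < r"
  shows "site_op m n r p i j \<circ> site_op m n r p k l = (if j = k then site_op m n r p i l else 0)"
proof (cases "j = k")
  case True
  have "leading_sign m (parity m k + parity m l) p w * leading_sign m (parity m i + parity m k) p w
      = leading_sign m (parity m i + parity m l) p w" for w
    by (auto simp: leading_sign_def parity_def power_add distrib_right simp flip: power_mult_distrib)
  with True show ?thesis unfolding site_op_comp[OF assms(1)]
    by (simp add: site_op_def, intro lin_ext_cong)
       (use assms in \<open>auto simp: two_unit_term_def leading_sign_update tensor_words_def\<close>)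
next
  case False
  then have "site_op m n r p i j \<circ> site_op m n r p k l = lin_ext m n r (\<lambda>w. 0)"
    unfolding site_op_comp[OF assms(1)]
    by (intro lin_ext_cong) (use assms in \<open>auto simp: two_unit_term_def tensor_words_def\<close>)
  with False show ?thesis by (simp only: lin_ext_zero if_False)
qed

text \<open>
  Both sides move the same letter, so this is an identity between signs. If \<open>E\<^sub>i\<^sub>j\<close> is even, neither sign
  changes. If it is odd, the letter at \<open>\<sigma> p\<close> changes its parity. This affects the inversions of \<open>\<sigma>\<close> that
  involve the position \<open>p\<close>, and they are counted by the odd letters that lie on different sides of the
  moved letter before and after permuting, which is what the two leading signs measure.
\<close>

lemma site_op_perm:
  assumes s: "\<sigma> permutes {..<r}" and p: "p < r" and i: "i \<in> {1..m + n}"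
  shows "site_op m n r p i j \<circ> signed_perm_op m n r \<sigma> = signed_perm_op m n r \<sigma> \<circ> site_op m n r (\<sigma> p) i j"
  unfolding site_op_def signed_perm_op_def lin_ext_comp
proof (rule lin_ext_cong)
  fix w assume w: "w \<in> tensor_words m n r"
  then have l: "length w = r" by (simp add: tensor_words_def)
  have s': "\<sigma> permutes {..<length w}" using s l by simp
  have sp: "\<sigma> p < r" using s p permutes_in_image[OF s, of p] by simp
  have sr: "\<sigma> k < r \<longleftrightarrow> k < r" for k using permutes_in_image[OF s, of k] by simp
  have sinj: "\<sigma> k = \<sigma> l \<longleftrightarrow> k = l" for k l
    using permutes_inj[OF s] by (auto dest: injD)
  let ?w' = "w[\<sigma> p := i]"
  let ?e = "parity m i + parity m j"
  have w': "?w' \<in> tensor_words m n r" using list_update_in_tensor_words[OF w i] .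
  have upd: "(permute_list \<sigma> w)[p := i] = permute_list \<sigma> ?w'"
  proof (rule nth_equalityI)
    fix k assume "k < length ((permute_list \<sigma> w)[p := i])"
    then have "k < length w" by simp
    then show "(permute_list \<sigma> w)[p := i] ! k = permute_list \<sigma> ?w' ! k"
      using l sinj[of p k] sinj[of k p] sr[of k] permute_list_nth[OF s'] permute_list_nth[of \<sigma> ?w'] s'
      by (cases "k = p") simp_all
  qed simp
  have sign: "odd_inversion_sign m \<sigma> w * leading_sign m ?e p (permute_list \<sigma> w)
     = leading_sign m ?e (\<sigma> p) w * odd_inversion_sign m \<sigma> ?w'" if j: "w ! \<sigma> p = j"
  proof (cases "parity m i = parity m j")
    case True
    have "leading_sign m ?e k u = 1" for k u
      using True by (simp add: leading_sign_def mult_2[symmetric] mult.assoc)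
    moreover have par: "parity m (?w' ! \<sigma> k) = parity m (w ! \<sigma> k)" for k
      using l j sp True by (cases "\<sigma> k = \<sigma> p") (simp_all add: sp)
    have "odd_inversion_sign m \<sigma> ?w' = odd_inversion_sign m \<sigma> w"
      unfolding odd_inversion_sign_prod length_list_update par ..
    ultimately show ?thesis by simp
  next
    case False
    define o' where "o' = (\<lambda>k. if parity m (w ! k) = 1 then - 1 else (1::complex))"
    have ls: "leading_sign m ?e q u = (\<Prod>k<q. (- 1) ^ parity m (u ! k))" for q u
    proof -
      have "?e = 1" using False by (auto simp: parity_def split: if_splits)
      then show ?thesis by (simp add: leading_sign_def power_sum)
    qed
    have pw: "(- 1) ^ parity m (w ! k) = o' k" for k by (simp add: o'_def parity_def)
    have A: "leading_sign m ?e (\<sigma> p) w = (\<Prod>k\<in>{..<r}. if \<sigma> k < \<sigma> p then o' (\<sigma> k) else 1)"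
    proof -
      have "leading_sign m ?e (\<sigma> p) w = (\<Prod>k\<in>{..<r}. if k < \<sigma> p then o' k else 1)"
        unfolding ls pw using sp by (subst prod.inter_filter[symmetric]) (auto intro!: prod.cong)
      also have "\<dots> = (\<Prod>k\<in>{..<r}. if \<sigma> k < \<sigma> p then o' (\<sigma> k) else 1)"
        by (rule prod.reindex_bij_betw[OF permutes_imp_bij[OF s], symmetric])
      finally show ?thesis .
    qed
    have B: "leading_sign m ?e p (permute_list \<sigma> w) = (\<Prod>k\<in>{..<r}. if k < p then o' (\<sigma> k) else 1)"
      unfolding ls using p l s' by (subst prod.inter_filter[symmetric]) (auto simp: permute_list_nth pw intro!: prod.cong)
    define t where "t = (\<lambda>u (k, l). if \<sigma> l < \<sigma> k \<and> parity m (u ! \<sigma> k) = 1 \<and> parity m (u ! \<sigma> l) = 1 then - 1 else (1::complex))"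
    let ?P = "index_pairs r"
    let ?Q = "{x \<in> ?P. fst x \<noteq> p \<and> snd x \<noteq> p}"
    have fin: "finite ?P" by (rule finite_index_pairs)
    have T: "odd_inversion_sign m \<sigma> u = (\<Prod>x\<in>?P. t u x)" if "length u = r" for u
      unfolding odd_inversion_sign_prod that t_def by (simp add: case_prod_unfold)
    \<comment> \<open>Separate the pairs that contain p, as only these see the changed letter.\<close>
    have split: "(\<Prod>x\<in>?P. t u x) = (\<Prod>x\<in>?Q. t u x) * (\<Prod>k\<in>{..<p}. t u (k, p)) * (\<Prod>k\<in>{p<..<r}. t u (p, k))" for u
    proof -
      have "?P = ?Q \<union> ((\<lambda>k. (k, p)) ` {..<p} \<union> (\<lambda>k. (p, k)) ` {p<..<r})"
        using p by (auto simp: index_pairs_def)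
      then have "(\<Prod>x\<in>?P. t u x) = (\<Prod>x\<in>?Q \<union> ((\<lambda>k. (k, p)) ` {..<p} \<union> (\<lambda>k. (p, k)) ` {p<..<r}). t u x)" by simp
      also have "\<dots> = (\<Prod>x\<in>?Q. t u x) * (\<Prod>x\<in>(\<lambda>k. (k, p)) ` {..<p} \<union> (\<lambda>k. (p, k)) ` {p<..<r}. t u x)"
        by (rule prod.union_disjoint) (use fin in auto)
      also have "(\<Prod>x\<in>(\<lambda>k. (k, p)) ` {..<p} \<union> (\<lambda>k. (p, k)) ` {p<..<r}. t u x)
         = (\<Prod>x\<in>(\<lambda>k. (k, p)) ` {..<p}. t u x) * (\<Prod>x\<in>(\<lambda>k. (p, k)) ` {p<..<r}. t u x)"
        by (rule prod.union_disjoint) auto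
      also have "(\<Prod>x\<in>(\<lambda>k. (k, p)) ` {..<p}. t u x) = (\<Prod>k\<in>{..<p}. t u (k, p))"
        by (subst prod.reindex) (auto simp: inj_on_def)
      also have "(\<Prod>x\<in>(\<lambda>k. (p, k)) ` {p<..<r}. t u x) = (\<Prod>k\<in>{p<..<r}. t u (p, k))"
        by (subst prod.reindex) (auto simp: inj_on_def)
      finally show ?thesis by (simp add: mult.assoc)
    qed
    have Q: "(\<Prod>x\<in>?Q. t ?w' x) = (\<Prod>x\<in>?Q. t w x)"
      by (rule prod.cong) (use l sr sinj in \<open>auto simp: t_def index_pairs_def\<close>)
    have two: "x * x = 1" if "x = 1 \<or> x = -1" for x :: complex using that by auto
    have two': "(\<Prod>k\<in>A. f k) * (\<Prod>k\<in>A. f k) = 1" if "\<And>k. f k = 1 \<or> f k = (-1::complex)" for A and f :: "nat \<times> nat \<Rightarrow> complex"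
      using that by (simp add: prod.distrib[symmetric] two)
    have "odd_inversion_sign m \<sigma> w * odd_inversion_sign m \<sigma> ?w'
      = (\<Prod>x\<in>?Q. t w x) * (\<Prod>x\<in>?Q. t w x) * ((\<Prod>k\<in>{..<p}. t w (k, p)) * (\<Prod>k\<in>{..<p}. t ?w' (k, p)))
        * ((\<Prod>k\<in>{p<..<r}. t w (p, k)) * (\<Prod>k\<in>{p<..<r}. t ?w' (p, k)))"
      using l by (simp add: T split Q)
    also have "\<dots> = (\<Prod>k\<in>{..<p}. t w (k, p) * t ?w' (k, p)) * (\<Prod>k\<in>{p<..<r}. t w (p, k) * t ?w' (p, k))"
      by (subst two') (auto simp: t_def prod.distrib)
    also have "(\<Prod>k\<in>{..<p}. t w (k, p) * t ?w' (k, p)) = (\<Prod>k\<in>{..<p}. if \<sigma> p < \<sigma> k then o' (\<sigma> k) else 1)"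
      by (rule prod.cong) (use False j l p sr sinj in \<open>auto simp: t_def o'_def parity_def split: if_splits\<close>)
    also have "(\<Prod>k\<in>{p<..<r}. t w (p, k) * t ?w' (p, k)) = (\<Prod>k\<in>{p<..<r}. if \<sigma> k < \<sigma> p then o' (\<sigma> k) else 1)"
      by (rule prod.cong) (use False j l p sr sinj in \<open>auto simp: t_def o'_def parity_def split: if_splits\<close>)
    also have "(\<Prod>k\<in>{..<p}. if \<sigma> p < \<sigma> k then o' (\<sigma> k) else 1) * (\<Prod>k\<in>{p<..<r}. if \<sigma> k < \<sigma> p then o' (\<sigma> k) else 1)
       = (\<Prod>k\<in>{..<r}. if \<sigma> k < \<sigma> p then o' (\<sigma> k) else 1) * (\<Prod>k\<in>{..<r}. if k < p then o' (\<sigma> k) else 1)"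
    proof -
      have dec: "(\<Prod>k\<in>{..<r}. f k) = (\<Prod>k\<in>{..<p}. f k) * (f p * (\<Prod>k\<in>{p<..<r}. f k))" for f :: "nat \<Rightarrow> complex"
      proof -
        have "{..<r} = {..<p} \<union> insert p {p<..<r}" using p by auto
        then have "(\<Prod>k\<in>{..<r}. f k) = (\<Prod>k\<in>{..<p} \<union> insert p {p<..<r}. f k)" by (rule arg_cong)
        also have "\<dots> = (\<Prod>k\<in>{..<p}. f k) * (\<Prod>k\<in>insert p {p<..<r}. f k)"
          by (rule prod.union_disjoint) auto
        also have "(\<Prod>k\<in>insert p {p<..<r}. f k) = f p * (\<Prod>k\<in>{p<..<r}. f k)"
          by (rule prod.insert) auto
        finally show ?thesis .
      qed
      have oo: "o' k * o' k = 1" for k by (simp add: o'_def)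
      have "(\<Prod>k\<in>{..<p}. if \<sigma> p < \<sigma> k then o' (\<sigma> k) else 1)
        = (\<Prod>k\<in>{..<p}. if \<sigma> k < \<sigma> p then o' (\<sigma> k) else 1) * (\<Prod>k\<in>{..<p}. if k < p then o' (\<sigma> k) else 1)"
        unfolding prod.distrib[symmetric]
      proof (rule prod.cong[OF refl])
        fix k assume "k \<in> {..<p}"
        then have "k < p" "\<sigma> k \<noteq> \<sigma> p" using sinj by auto
        then show "(if \<sigma> p < \<sigma> k then o' (\<sigma> k) else 1) =
          (if \<sigma> k < \<sigma> p then o' (\<sigma> k) else 1) * (if k < p then o' (\<sigma> k) else 1)"
          using oo[of "\<sigma> k"] by auto
      qed
      then show ?thesis unfolding dec by simp
    qed
    finally have *: "odd_inversion_sign m \<sigma> w * odd_inversion_sign m \<sigma> ?w' =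
       leading_sign m ?e (\<sigma> p) w * leading_sign m ?e p (permute_list \<sigma> w)"
      unfolding A B .
    have sq: "(- 1 :: complex) ^ N * (- 1) ^ N = 1" for N
      by (simp flip: power_mult_distrib)
    have "odd_inversion_sign m \<sigma> ?w' * odd_inversion_sign m \<sigma> ?w' = 1"
      "leading_sign m ?e p (permute_list \<sigma> w) * leading_sign m ?e p (permute_list \<sigma> w) = 1"
      by (simp_all only: odd_inversion_sign_def leading_sign_def sq)
    moreover have "x * B = A * y" if "x * y = A * B" "y * y = 1" "B * B = 1" for x y A B :: complex
      using that by (metis mult.assoc mult.commute mult.right_neutral)
    ultimately show ?thesis using * by blast
  qed
  show "lin_ext m n r (\<lambda>w. if w ! p = j then tscale (leading_sign m ?e p w) (basis_tensor (w[p := i])) else 0)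
          (tscale (odd_inversion_sign m \<sigma> w) (basis_tensor (permute_list \<sigma> w))) =
         lin_ext m n r (\<lambda>w. tscale (odd_inversion_sign m \<sigma> w) (basis_tensor (permute_list \<sigma> w)))
          (if w ! \<sigma> p = j then tscale (leading_sign m ?e (\<sigma> p) w) (basis_tensor (w[\<sigma> p := i])) else 0)"
    using permute_list_in_tensor_words[OF s w] w' permute_list_nth[OF s', of p] p l
    by (simp add: lin_ext_lin lin_ext_basis tscale_simps upd sign del: zero_fun_apply plus_fun_apply)
qed

lemma matrix_unit_op_perm_commute:
  assumes s: "\<sigma> permutes {..<r}" and i: "i \<in> {1..m + n}"
  shows "matrix_unit_op m n r i j \<circ> signed_perm_op m n r \<sigma> = signed_perm_op m n r \<sigma> \<circ> matrix_unit_op m n r i j"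
proof (rule ext)
  fix v
  have "(\<Sum>p<r. site_op m n r p i j (signed_perm_op m n r \<sigma> v)) = (\<Sum>p<r. signed_perm_op m n r \<sigma> (site_op m n r (\<sigma> p) i j v))"
    using site_op_perm[OF s _ i] by (intro sum.cong) (auto simp: fun_eq_iff)
  also have "\<dots> = (\<Sum>p<r. signed_perm_op m n r \<sigma> (site_op m n r p i j v))"
    by (rule sum.reindex_bij_betw[OF permutes_imp_bij[OF s]])
  finally show "(matrix_unit_op m n r i j \<circ> signed_perm_op m n r \<sigma>) v = (signed_perm_op m n r \<sigma> \<circ> matrix_unit_op m n r i j) v"
    by (simp add: matrix_unit_op_sum_sites sum_fun_apply signed_perm_op_def lin_ext_sum)
qed

text \<open>
  A product of matrix units at sites. The sites are listed apart from the units, as they are what is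
  summed over.
\<close>

fun site_word :: "nat \<Rightarrow> nat \<Rightarrow> nat \<Rightarrow> (nat \<times> nat) list \<Rightarrow> nat list \<Rightarrow> tensor_op" where
  "site_word m n r ((i, j) # ps) (p # fs) = site_op m n r p i j \<circ> site_word m n r ps fs"
| "site_word m n r ps fs = tensor_id m n r"

lemma site_word_simps [simp]:
  "site_word m n r (x # ps) (p # fs) = site_op m n r p (fst x) (snd x) \<circ> site_word m n r ps fs"
  by (cases x) simp

lemma site_op_lin:
  "site_op m n r p i j (tscale c v) = tscale c (site_op m n r p i j v)"
  "site_op m n r p i j 0 = 0"
  by (simp_all add: site_op_def lin_ext_lin del: zero_fun_apply)

lemma site_op_opscale: "site_op m n r p i j \<circ> opscale c T = opscale c (site_op m n r p i j \<circ> T)"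
  by (simp add: opscale_def comp_def site_op_lin)

lemma opscale_comp_left: "opscale c T \<circ> S = opscale c (T \<circ> S)"
  by (simp add: opscale_def comp_def)

text \<open>
  The unit at the site of the factor number \<open>s\<close> supercommutes with the factors before it and then
  merges with this factor. The constant is the sign of this passage, or \<open>0\<close> if the indices do not
  match. What matters is that it does not depend on the choice of the sites.
\<close>

lemma site_op_site_word:
  assumes i: "i \<in> {1..m + n}" and s: "s < length ps"
  shows "\<exists>c. \<forall>fs. length fs = length ps \<longrightarrow> distinct fs \<longrightarrow> set fs \<subseteq> {..<r} \<longrightarrow> ps \<in> gl_words m n \<longrightarrow>
    site_op m n r (fs ! s) i j \<circ> site_word m n r ps fs = opscale c (site_word m n r (ps[s := (i, snd (ps ! s))]) fs)"
  using s
proof (induction ps arbitrary: s)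
  case Nil
  then show ?case by simp
next
  case (Cons x ps)
  obtain k l where x: "x = (k, l)" by force
  show ?case
  proof (cases s)
    case 0
    show ?thesis
    proof (rule exI[of _ "if j = k then 1 else 0"], intro allI impI)
      fix fs :: "nat list"
      assume fs: "length fs = length (x # ps)" "distinct fs" "set fs \<subseteq> {..<r}" "x # ps \<in> gl_words m n"
      then obtain p gs where [simp]: "fs = p # gs" by (cases fs) auto
      have "k \<in> {1..m + n}" "p < r" using fs by (auto simp: gl_words_def x)
      from site_op_merge[OF this, of i j l] show "site_op m n r (fs ! s) i j \<circ> site_word m n r (x # ps) fs =
        opscale (if j = k then 1 else 0) (site_word m n r ((x # ps)[s := (i, snd ((x # ps) ! s))]) fs)"
        by (simp add: 0 x comp_assoc[symmetric]) (auto simp: fun_eq_iff opscale_def tscale_def)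
    qed
  next
    case (Suc s')
    then obtain c where c: "\<And>fs. length fs = length ps \<Longrightarrow> distinct fs \<Longrightarrow> set fs \<subseteq> {..<r} \<Longrightarrow> ps \<in> gl_words m n \<Longrightarrow>
      site_op m n r (fs ! s') i j \<circ> site_word m n r ps fs = opscale c (site_word m n r (ps[s' := (i, snd (ps ! s'))]) fs)"
    proof -
      have "s' < length ps" using Cons.prems Suc by simp
      from Cons.IH[OF this] show ?thesis using that by blast
    qed
    show ?thesis
    proof (rule exI[of _ "(-1) ^ ((parity m i + parity m j) * (parity m k + parity m l)) * c"], intro allI impI)
      fix fs :: "nat list"
      assume fs: "length fs = length (x # ps)" "distinct fs" "set fs \<subseteq> {..<r}" "x # ps \<in> gl_words m n"
      then obtain p gs where [simp]: "fs = p # gs" by (cases fs) auto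
      have 1: "k \<in> {1..m + n}" "p < r" "ps \<in> gl_words m n" "length gs = length ps" "distinct gs" "set gs \<subseteq> {..<r}"
        using fs by (auto simp: gl_words_def x)
      have "gs ! s' \<in> set gs" using Cons.prems Suc 1 by simp
      then have 2: "gs ! s' < r" "p \<noteq> gs ! s'" using fs by auto
      have "site_op m n r (fs ! s) i j \<circ> site_word m n r (x # ps) fs
        = (site_op m n r (gs ! s') i j \<circ> site_op m n r p k l) \<circ> site_word m n r ps gs"
        by (simp add: Suc x comp_assoc)
      also have "\<dots> = opscale ((-1) ^ ((parity m i + parity m j) * (parity m k + parity m l)))
         (site_op m n r p k l \<circ> (site_op m n r (gs ! s') i j \<circ> site_word m n r ps gs))"
        by (simp only: site_op_swap[OF i 1(1,2) 2] opscale_comp_left comp_assoc)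
      also have "\<dots> = opscale ((-1) ^ ((parity m i + parity m j) * (parity m k + parity m l)) * c)
         (site_word m n r ((x # ps)[s := (i, snd ((x # ps) ! s))]) fs)"
        by (simp add: c 1 site_op_opscale Suc x)
      finally show "site_op m n r (fs ! s) i j \<circ> site_word m n r (x # ps) fs =
        opscale ((-1) ^ ((parity m i + parity m j) * (parity m k + parity m l)) * c)
         (site_word m n r ((x # ps)[s := (i, snd ((x # ps) ! s))]) fs)" .
    qed
  qed
qed

definition position_lists :: "nat \<Rightarrow> nat \<Rightarrow> nat list set" where
  "position_lists r k = {fs. length fs = k \<and> distinct fs \<and> set fs \<subseteq> {..<r}}"

lemma finite_position_lists: "finite (position_lists r k)"
  by (rule finite_subset[OF _ finite_lists_length_eq[of "{..<r}" k]]) (auto simp: position_lists_def)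

definition symmetrized_units :: "nat \<Rightarrow> nat \<Rightarrow> nat \<Rightarrow> (nat \<times> nat) list \<Rightarrow> tensor_op" where
  "symmetrized_units m n r ps = (\<Sum>fs\<in>position_lists r (length ps). site_word m n r ps fs)"

text \<open>
  In the product of \<open>E\<^sub>i\<^sub>j\<close> with the symmetrized product over the remaining pairs, \<open>E\<^sub>i\<^sub>j\<close> acts either at a
  new site, which gives the symmetrized product in question, or at a site already in use, which gives
  symmetrized products of fewer factors. This expresses the former by elements of the algebra.
\<close>

lemma symmetrized_units_in_schur:
  "ps \<in> gl_words m n \<Longrightarrow> symmetrized_units m n r ps \<in> schur_superalgebra m n r"
proof (induction "length ps" arbitrary: ps)
  case 0
  then have "position_lists r (length ps) = {[]}" by (auto simp: position_lists_def)
  with 0 show ?case by (simp add: symmetrized_units_def schur_superalgebra_id)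
next
  case (Suc k)
  then obtain i j qs where ps: "ps = (i, j) # qs" by (cases ps) auto
  have ij: "i \<in> {1..m + n}" "j \<in> {1..m + n}" and qs: "qs \<in> gl_words m n" and k: "length qs = k"
    using Suc ps by (auto simp: gl_words_def)
  have "\<forall>s\<in>{..<k}. \<exists>c. \<forall>fs. length fs = length qs \<longrightarrow> distinct fs \<longrightarrow> set fs \<subseteq> {..<r} \<longrightarrow> qs \<in> gl_words m n \<longrightarrow>
    site_op m n r (fs ! s) i j \<circ> site_word m n r qs fs = opscale c (site_word m n r (qs[s := (i, snd (qs ! s))]) fs)"
    using site_op_site_word[OF ij(1)] k by auto
  then obtain c where "\<forall>s\<in>{..<k}. \<forall>fs. length fs = length qs \<longrightarrow> distinct fs \<longrightarrow> set fs \<subseteq> {..<r} \<longrightarrow> qs \<in> gl_words m n \<longrightarrow>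
    site_op m n r (fs ! s) i j \<circ> site_word m n r qs fs = opscale (c s) (site_word m n r (qs[s := (i, snd (qs ! s))]) fs)"
    unfolding bchoice_iff by blast
  then have c: "site_op m n r (fs ! s) i j \<circ> site_word m n r qs fs = opscale (c s) (site_word m n r (qs[s := (i, snd (qs ! s))]) fs)"
    if "s < k" "fs \<in> position_lists r k" for s fs
    using that qs k by (auto simp: position_lists_def)
  have cons: "position_lists r (Suc k) = (\<lambda>(fs, p). p # fs) ` (SIGMA fs:position_lists r k. {..<r} - set fs)"
  proof (intro equalityI subsetI)
    fix fs assume "fs \<in> position_lists r (Suc k)"
    then show "fs \<in> (\<lambda>(fs, p). p # fs) ` (SIGMA fs:position_lists r k. {..<r} - set fs)"
      by (cases fs) (auto simp: position_lists_def image_iff intro!: bexI[of _ "(tl fs, hd fs)"])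
  qed (auto simp: position_lists_def)
  have "matrix_unit_op m n r i j \<circ> symmetrized_units m n r qs
    = (\<Sum>fs\<in>position_lists r k. \<Sum>p<r. site_op m n r p i j \<circ> site_word m n r qs fs)"
    by (rule ext) (simp add: symmetrized_units_def k sum_fun_apply matrix_unit_op_sum_sites lin_ext_sum site_op_def
         sum.swap[of _ "{..<r}"])
  also have "\<dots> = (\<Sum>fs\<in>position_lists r k. (\<Sum>p\<in>{..<r} - set fs. site_word m n r ps (p # fs))
      + (\<Sum>s<k. opscale (c s) (site_word m n r (qs[s := (i, snd (qs ! s))]) fs)))"
  proof (rule sum.cong[OF refl])
    fix fs assume fs: "fs \<in> position_lists r k"
    then have fs': "distinct fs" "set fs \<subseteq> {..<r}" "length fs = k" by (auto simp: position_lists_def)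
    have "(\<Sum>p<r. site_op m n r p i j \<circ> site_word m n r qs fs)
      = (\<Sum>p\<in>{..<r} - set fs. site_op m n r p i j \<circ> site_word m n r qs fs) + (\<Sum>p\<in>set fs. site_op m n r p i j \<circ> site_word m n r qs fs)"
      using fs' by (simp add: sum.subset_diff[of "set fs" "{..<r}"] del: plus_fun_apply)
    also have "(\<Sum>p\<in>set fs. site_op m n r p i j \<circ> site_word m n r qs fs) = (\<Sum>s<k. site_op m n r (fs ! s) i j \<circ> site_word m n r qs fs)"
      using fs' by (intro sum.reindex_bij_betw[symmetric] bij_betw_nth) auto
    also have "\<dots> = (\<Sum>s<k. opscale (c s) (site_word m n r (qs[s := (i, snd (qs ! s))]) fs))"
      using c fs by (intro sum.cong) auto
    finally show "(\<Sum>p<r. site_op m n r p i j \<circ> site_word m n r qs fs) = (\<Sum>p\<in>{..<r} - set fs. site_word m n r ps (p # fs))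
      + (\<Sum>s<k. opscale (c s) (site_word m n r (qs[s := (i, snd (qs ! s))]) fs))"
      by (simp only: ps site_word_simps fst_conv snd_conv)
  qed
  also have "\<dots> = (\<Sum>fs\<in>position_lists r k. \<Sum>p\<in>{..<r} - set fs. site_word m n r ps (p # fs))
      + (\<Sum>s<k. opscale (c s) (symmetrized_units m n r (qs[s := (i, snd (qs ! s))])))"
    unfolding sum.distrib
    by (subst sum.swap) (simp add: symmetrized_units_def k tensor_op.scale_sum_right del: plus_fun_apply)
  also have "(\<Sum>fs\<in>position_lists r k. \<Sum>p\<in>{..<r} - set fs. site_word m n r ps (p # fs)) = symmetrized_units m n r ps"
  proof -
    have "length ps = Suc k" using Suc by simp
    then have "symmetrized_units m n r ps = (\<Sum>x\<in>(SIGMA fs:position_lists r k. {..<r} - set fs). case x of (fs, p) \<Rightarrow> site_word m n r ps (p # fs))"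
      unfolding symmetrized_units_def cons
      by (simp only: cons) (subst sum.reindex, auto simp: inj_on_def intro!: sum.cong)
    also have "\<dots> = (\<Sum>fs\<in>position_lists r k. \<Sum>p\<in>{..<r} - set fs. site_word m n r ps (p # fs))"
      by (rule sum.Sigma[symmetric]) (auto simp: finite_position_lists)
    finally show ?thesis by simp
  qed
  finally have "symmetrized_units m n r ps = (matrix_unit_op m n r i j \<circ> symmetrized_units m n r qs)
     + opscale (-1) (\<Sum>s<k. opscale (c s) (symmetrized_units m n r (qs[s := (i, snd (qs ! s))])))"
    by (simp only: tensor_op.scale_minus_left tensor_op.scale_one) (simp add: algebra_simps del: plus_fun_apply comp_apply o_apply)
  moreover have "qs[s := (i, snd (qs ! s))] \<in> gl_words m n" if "s < k" for s
  proof -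
    have "qs ! s \<in> set qs" using that k by simp
    then have "snd (qs ! s) \<in> {1..m + n}" using qs unfolding gl_words_def by force
    then show ?thesis using qs ij set_update_subset_insert[of qs s "(i, snd (qs ! s))"] unfolding gl_words_def by auto
  qed
  ultimately show ?case
    using Suc.hyps(1) qs k
    by (simp only:) (intro schur_superalgebra_add schur_superalgebra_scale schur_superalgebra_sum schur_superalgebra_comp
       matrix_unit_op_in_schur ij; simp)
qed

text \<open>
  The operator checks the letters of \<open>w'\<close> from position \<open>k\<close> on against \<open>w\<close> and replaces them by those of
  \<open>u\<close>. It acts from right to left, so the sign at a position only depends on letters not yet replaced.
\<close>

lemma site_word_suffix:
  assumes u: "u \<in> tensor_words m n r" and w: "w \<in> tensor_words m n r" and w': "w' \<in> tensor_words m n r"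
    and "k \<le> r"
  shows "\<exists>c. c \<noteq> 0 \<and> site_word m n r (zip (drop k u) (drop k w)) [k..<r] (basis_tensor w') =
    (if drop k w' = drop k w then tscale c (basis_tensor (take k w' @ drop k u)) else 0)"
  using \<open>k \<le> r\<close>
proof (induction rule: inc_induct)
  case base
  show ?case using u w w'
    by (intro exI[of _ 1]) (simp add: tensor_words_def tensor_id_def lin_ext_basis tscale_simps)
next
  case (step k)
  have l: "length u = r" "length w = r" "length w' = r" using u w w' by (auto simp: tensor_words_def)
  from step obtain c where c: "c \<noteq> 0" "site_word m n r (zip (drop (Suc k) u) (drop (Suc k) w)) [Suc k..<r] (basis_tensor w') =
    (if drop (Suc k) w' = drop (Suc k) w then tscale c (basis_tensor (take (Suc k) w' @ drop (Suc k) u)) else 0)"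
    by auto
  let ?v = "take (Suc k) w' @ drop (Suc k) u"
  have v: "?v \<in> tensor_words m n r"
    using u w' step(2) by (auto simp: tensor_words_def dest: in_set_takeD in_set_dropD)
  have vk: "?v ! k = w' ! k" using l step(2) by (simp add: nth_append)
  have vu: "?v[k := u ! k] = take k w' @ drop k u"
    using l step(2) by (simp add: take_Suc_conv_app_nth list_update_append Cons_nth_drop_Suc)
  have e: "drop k w' = drop k w \<longleftrightarrow> w' ! k = w ! k \<and> drop (Suc k) w' = drop (Suc k) w"
    using l step(2) by (simp add: Cons_nth_drop_Suc[symmetric])
  let ?s = "leading_sign m (parity m (u ! k) + parity m (w ! k)) k ?v"
  have z: "zip (drop k u) (drop k w) = (u ! k, w ! k) # zip (drop (Suc k) u) (drop (Suc k) w)"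
    using l step(2) by (simp add: Cons_nth_drop_Suc[symmetric])
  have "site_word m n r (zip (drop k u) (drop k w)) [k..<r] (basis_tensor w') =
     site_op m n r k (u ! k) (w ! k) (if drop (Suc k) w' = drop (Suc k) w then tscale c (basis_tensor ?v) else 0)"
    using step(2) by (simp add: z upt_conv_Cons c(2))
  also have "\<dots> = (if drop k w' = drop k w then tscale (?s * c) (basis_tensor (take k w' @ drop k u)) else 0)"
    using v vk vu
    by (auto simp: site_op_lin e site_op_def lin_ext_basis tscale_simps lin_ext_lin mult.commute simp del: zero_fun_apply)
  finally show ?case using c(1) by (intro exI[of _ "?s * c"]) (simp add: leading_sign_def)
qed

text \<open>
  With one factor at each site, the product is, up to a nonzero scalar, the matrix unit that maps the
  basis tensor of \<open>w\<close> to that of \<open>u\<close>.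
\<close>

lemma site_word_matrix_unit:
  assumes u: "u \<in> tensor_words m n r" and w: "w \<in> tensor_words m n r"
  shows "\<exists>c. \<forall>w'\<in>tensor_words m n r. opscale c (site_word m n r (zip u w) [0..<r]) (basis_tensor w') =
    (if w' = w then basis_tensor u else 0)"
proof -
  from site_word_suffix[OF u w w, of 0] obtain c where c: "c \<noteq> 0"
    "site_word m n r (zip u w) [0..<r] (basis_tensor w) = tscale c (basis_tensor u)" by auto
  show ?thesis
  proof (intro exI[of _ "1 / c"] ballI)
    fix w' assume "w' \<in> tensor_words m n r"
    from site_word_suffix[OF u w this, of 0] show "opscale (1 / c) (site_word m n r (zip u w) [0..<r]) (basis_tensor w') =
      (if w' = w then basis_tensor u else 0)"
      using c by (auto simp: opscale_def tscale_simps simp del: zero_fun_apply)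
  qed
qed

lemma site_word_linear:
  assumes "ps \<in> gl_words m n"
  shows "\<exists>f. site_word m n r ps fs = lin_ext m n r f" "tensor_id m n r \<circ> site_word m n r ps fs = site_word m n r ps fs"
proof -
  show "\<exists>f. site_word m n r ps fs = lin_ext m n r f"
  proof (induction m n r ps fs rule: site_word.induct)
    case (1 m n r i j ps p fs)
    then obtain f where "site_word m n r ps fs = lin_ext m n r f" by blast
    then show ?case by (simp only: site_word.simps site_op_def lin_ext_comp) blast
  qed (auto simp: tensor_id_def)
  have 1: "tensor_id m n r \<circ> site_op m n r p i j = site_op m n r p i j" if "i \<in> {1..m + n}" for p i j
    unfolding site_op_def
    by (rule tensor_id_comp_lin_ext)
       (use list_update_in_tensor_words[OF _ that] in \<open>auto simp: tscale_def basis_tensor_def\<close>)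
  show "tensor_id m n r \<circ> site_word m n r ps fs = site_word m n r ps fs"
    using assms
    by (cases "(m, n, r, ps, fs)" rule: site_word.cases)
       (auto simp: tensor_id_idem gl_words_def 1 simp flip: comp_assoc)
qed

lemma signed_perm_op_id_comp:
  assumes "\<sigma> permutes {..<r}"
  shows "tensor_id m n r \<circ> signed_perm_op m n r \<sigma> = signed_perm_op m n r \<sigma>"
    "signed_perm_op m n r \<sigma> \<circ> tensor_id m n r = signed_perm_op m n r \<sigma>"
proof -
  show "tensor_id m n r \<circ> signed_perm_op m n r \<sigma> = signed_perm_op m n r \<sigma>"
    unfolding signed_perm_op_def
    by (rule tensor_id_comp_lin_ext)
       (use permute_list_in_tensor_words[OF assms] in \<open>auto simp: tscale_def basis_tensor_def\<close>)
  show "signed_perm_op m n r \<sigma> \<circ> tensor_id m n r = signed_perm_op m n r \<sigma>"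
    unfolding signed_perm_op_def by (rule lin_ext_comp_tensor_id)
qed

lemma site_word_perm:
  assumes s: "\<sigma> permutes {..<r}" and "ps \<in> gl_words m n" "set fs \<subseteq> {..<r}" "length fs = length ps"
  shows "site_word m n r ps fs \<circ> signed_perm_op m n r \<sigma> = signed_perm_op m n r \<sigma> \<circ> site_word m n r ps (map \<sigma> fs)"
  using assms(4,2,3)
proof (induction fs ps rule: list_induct2)
  case Nil
  then show ?case by (simp add: signed_perm_op_id_comp[OF s] del: comp_apply)
next
  case (Cons p fs x ps)
  have p: "p < r" "fst x \<in> {1..m + n}" and "ps \<in> gl_words m n" "set fs \<subseteq> {..<r}"
    using Cons.prems by (auto simp: gl_words_def)
  then have IH: "site_word m n r ps fs \<circ> signed_perm_op m n r \<sigma> = signed_perm_op m n r \<sigma> \<circ> site_word m n r ps (map \<sigma> fs)"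
    by (intro Cons.IH)
  have "site_word m n r (x # ps) (p # fs) \<circ> signed_perm_op m n r \<sigma>
    = site_op m n r p (fst x) (snd x) \<circ> (signed_perm_op m n r \<sigma> \<circ> site_word m n r ps (map \<sigma> fs))"
    by (simp only: site_word_simps comp_assoc IH)
  also have "\<dots> = signed_perm_op m n r \<sigma> \<circ> site_word m n r (x # ps) (map \<sigma> (p # fs))"
    by (simp only: comp_assoc[symmetric] site_op_perm[OF s p] list.map site_word_simps)
  finally show ?case .
qed

lemma sum_permutations_position_lists:
  "(\<Sum>\<sigma> | \<sigma> permutes {..<r}. F (map \<sigma> [0..<r])) = (\<Sum>fs\<in>position_lists r r. F fs)"
proof (rule sum.reindex_bij_witness[of _ "\<lambda>fs k. if k < r then fs ! k else k" "\<lambda>\<sigma>. map \<sigma> [0..<r]"])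
  fix \<sigma> assume "\<sigma> \<in> {\<sigma>. \<sigma> permutes {..<r}}"
  then have s: "\<sigma> permutes {..<r}" by simp
  show "(\<lambda>k. if k < r then map \<sigma> [0..<r] ! k else k) = \<sigma>"
    using permutes_not_in[OF s] by auto
  show "map \<sigma> [0..<r] \<in> position_lists r r"
    using permutes_inj[OF s] permutes_in_image[OF s] by (auto simp: position_lists_def distinct_map inj_on_def)
next
  fix fs assume "fs \<in> position_lists r r"
  then have fs: "length fs = r" "distinct fs" "set fs \<subseteq> {..<r}" by (auto simp: position_lists_def)
  then show "map (\<lambda>k. if k < r then fs ! k else k) [0..<r] = fs"
    by (intro nth_equalityI) auto
  have "set fs = {..<r}"
    using fs by (intro card_subset_eq) (auto simp: distinct_card)
  then have "bij_betw ((!) fs) {..<r} {..<r}"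
    by (intro bij_betw_nth fs(2)) (simp_all only: fs(1))
  then have "bij_betw (\<lambda>k. if k < r then fs ! k else k) {..<r} {..<r}"
    by (subst bij_betw_cong[where g = "(!) fs"]) auto
  then show "(\<lambda>k. if k < r then fs ! k else k) \<in> {\<sigma>. \<sigma> permutes {..<r}}"
    using bij_imp_permutes[of "\<lambda>k. if k < r then fs ! k else k" "{..<r}"] by simp
qed auto

text \<open>
  Expand \<open>T\<close> in products of units with one unit at each site. Conjugation with \<open>\<sigma>\<close> moves the sites by
  \<open>\<sigma>\<close> and fixes \<open>T\<close>. Summing over all \<open>\<sigma>\<close> turns the products into symmetrized ones, which lie in the
  Schur superalgebra, and multiplies \<open>T\<close> by \<open>r!\<close>.
\<close>

lemma commutant_in_schur:
  assumes T: "T = lin_ext m n r g"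
    and supp: "\<And>w u. w \<in> tensor_words m n r \<Longrightarrow> u \<notin> tensor_words m n r \<Longrightarrow> g w u = 0"
    and comm: "\<And>\<sigma>. \<sigma> permutes {..<r} \<Longrightarrow> T \<circ> signed_perm_op m n r \<sigma> = signed_perm_op m n r \<sigma> \<circ> T"
  shows "T \<in> schur_superalgebra m n r"
proof -
  let ?W = "tensor_words m n r"
  define c where "c = (\<lambda>u w. SOME c. \<forall>w'\<in>?W. opscale c (site_word m n r (zip u w) [0..<r]) (basis_tensor w') =
    (if w' = w then basis_tensor u else 0))"
  have c: "opscale (c u w) (site_word m n r (zip u w) [0..<r]) (basis_tensor w') = (if w' = w then basis_tensor u else 0)"
    if "u \<in> ?W" "w \<in> ?W" "w' \<in> ?W" for u w w'
    using someI_ex[OF site_word_matrix_unit[OF that(1,2)]] that(3) unfolding c_def by blast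
  have z: "zip u w \<in> gl_words m n" "length (zip u w) = r" if "u \<in> ?W" "w \<in> ?W" for u w
  proof -
    have "set (zip u w) \<subseteq> set u \<times> set w" by (auto dest: set_zip_leftD set_zip_rightD)
    then show "zip u w \<in> gl_words m n" using that unfolding gl_words_def tensor_words_def by blast
    show "length (zip u w) = r" using that by (simp add: tensor_words_def)
  qed
  define d where "d = (\<lambda>u w. g w u * c u w)"
  have eqI: "S = S'" if S: "S = lin_ext m n r f" and S': "S' = lin_ext m n r f'"
    and e: "\<And>w. w \<in> ?W \<Longrightarrow> S (basis_tensor w) = S' (basis_tensor w)" for S S' f f'
    unfolding S S' by (rule lin_ext_cong) (use e in \<open>simp add: S S' lin_ext_basis\<close>)
  define h where "h = (\<lambda>u w. SOME f. site_word m n r (zip u w) [0..<r] = lin_ext m n r f)"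
  have h: "site_word m n r (zip u w) [0..<r] = lin_ext m n r (h u w)" if "u \<in> ?W" "w \<in> ?W" for u w
    unfolding h_def by (rule someI_ex[OF site_word_linear(1)[OF z(1)[OF that]]])
  have T1: "T = (\<Sum>w\<in>?W. \<Sum>u\<in>?W. opscale (d u w) (site_word m n r (zip u w) [0..<r]))"
  proof (rule eqI[OF T])
    show "(\<Sum>w\<in>?W. \<Sum>u\<in>?W. opscale (d u w) (site_word m n r (zip u w) [0..<r]))
      = lin_ext m n r (\<lambda>v. \<Sum>w\<in>?W. \<Sum>u\<in>?W. tscale (d u w) (h u w v))"
      by (simp add: h opscale_lin_ext sum_lin_ext cong: sum.cong)
    fix w' assume w': "w' \<in> ?W"
    have "(\<Sum>w\<in>?W. \<Sum>u\<in>?W. opscale (d u w) (site_word m n r (zip u w) [0..<r])) (basis_tensor w')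
      = (\<Sum>w\<in>?W. \<Sum>u\<in>?W. tscale (g w u) (opscale (c u w) (site_word m n r (zip u w) [0..<r]) (basis_tensor w')))"
      by (simp add: sum_fun_apply opscale_def d_def tscale_simps)
    also have "\<dots> = (\<Sum>w\<in>?W. if w = w' then \<Sum>u\<in>?W. tscale (g w u) (basis_tensor u) else 0)"
      by (intro sum.cong refl) (auto simp: c w' tscale_simps simp del: zero_fun_apply intro!: sum.neutral)
    also have "\<dots> = (\<Sum>u\<in>?W. tscale (g w' u) (basis_tensor u))"
      using w' by (simp add: finite_tensor_words)
    also have "\<dots> = g w'"
      by (rule ext) (use supp[OF w'] in \<open>auto simp: sum_fun_apply tscale_def basis_tensor_def finite_tensor_words if_distrib cong: if_cong\<close>)
    also have "\<dots> = T (basis_tensor w')" using w' by (simp add: T lin_ext_basis)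
    finally show "T (basis_tensor w') = (\<Sum>w\<in>?W. \<Sum>u\<in>?W. opscale (d u w) (site_word m n r (zip u w) [0..<r])) (basis_tensor w')" ..
  qed
  have Ts: "T = (\<Sum>w\<in>?W. \<Sum>u\<in>?W. opscale (d u w) (site_word m n r (zip u w) (map \<sigma> [0..<r])))" (is "T = ?R")
    if s: "\<sigma> permutes {..<r}" for \<sigma>
  proof -
    let ?p = "signed_perm_op m n r"
    have lin: "?p \<tau> (sum f A) = (\<Sum>x\<in>A. ?p \<tau> (f x))" "?p \<tau> (tscale a v) = tscale a (?p \<tau> v)" for \<tau> f A a v
      by (simp_all add: signed_perm_op_def lin_ext_sum lin_ext_lin)
    have "?p \<sigma> \<circ> T = T \<circ> ?p \<sigma>" using comm[OF s] ..
    also have "\<dots> = (\<Sum>w\<in>?W. \<Sum>u\<in>?W. opscale (d u w) (site_word m n r (zip u w) [0..<r] \<circ> ?p \<sigma>))"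
      by (subst T1) (simp add: fun_eq_iff sum_fun_apply opscale_def)
    also have "\<dots> = (\<Sum>w\<in>?W. \<Sum>u\<in>?W. opscale (d u w) (?p \<sigma> \<circ> site_word m n r (zip u w) (map \<sigma> [0..<r])))"
      by (intro sum.cong refl arg_cong[where f = "opscale _"] site_word_perm s z) (auto simp: z(2) simp del: length_zip)
    also have "\<dots> = ?p \<sigma> \<circ> ?R"
      by (simp add: fun_eq_iff sum_fun_apply opscale_def lin)
    finally have e: "?p (inv_into UNIV \<sigma>) \<circ> (?p \<sigma> \<circ> T) = ?p (inv_into UNIV \<sigma>) \<circ> (?p \<sigma> \<circ> ?R)" by simp
    have i: "?p (inv_into UNIV \<sigma>) \<circ> ?p \<sigma> = tensor_id m n r"
      using signed_perm_op_compose[OF s permutes_inv[OF s], of m n] permutes_inv_o(1)[OF s]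
      by (simp add: signed_perm_op_id del: comp_apply)
    have "tensor_id m n r \<circ> ?R = ?R"
    proof -
      have 1: "tensor_id m n r (site_word m n r (zip u w) fs v) = site_word m n r (zip u w) fs v"
        if "u \<in> ?W" "w \<in> ?W" for u w fs v
        using site_word_linear(2)[OF z(1)[OF that]] by (metis comp_apply)
      have "tensor_id m n r (?R v) = ?R v" for v
      proof -
        have Rv: "?R v = (\<Sum>w\<in>?W. \<Sum>u\<in>?W. tscale (d u w) (site_word m n r (zip u w) (map \<sigma> [0..<r]) v))"
          by (simp add: sum_fun_apply opscale_def)
        show ?thesis
          unfolding Rv tensor_id_def lin_ext_sum lin_ext_lin(2)
          unfolding tensor_id_def[symmetric] by (intro sum.cong refl) (simp add: 1)
      qed
      then show ?thesis by (simp add: comp_def)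
    qed
    moreover have "tensor_id m n r \<circ> T = T" unfolding T by (rule tensor_id_comp_lin_ext) (rule supp)
    ultimately show ?thesis using e by (simp only: comp_assoc[symmetric] i)
  qed
  have "opscale (of_nat (fact r)) T = (\<Sum>\<sigma> | \<sigma> permutes {..<r}. T)"
    by (rule ext, rule ext, simp add: sum_fun_apply opscale_def tscale_def del: sum_constant)
       (simp add: card_permutations[OF refl])
  also have "\<dots> = (\<Sum>\<sigma> | \<sigma> permutes {..<r}. \<Sum>w\<in>?W. \<Sum>u\<in>?W. opscale (d u w) (site_word m n r (zip u w) (map \<sigma> [0..<r])))"
    using Ts by (intro sum.cong) auto
  also have "\<dots> = (\<Sum>fs\<in>position_lists r r. \<Sum>w\<in>?W. \<Sum>u\<in>?W. opscale (d u w) (site_word m n r (zip u w) fs))"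
    by (rule sum_permutations_position_lists)
  also have "\<dots> = (\<Sum>w\<in>?W. \<Sum>u\<in>?W. \<Sum>fs\<in>position_lists r r. opscale (d u w) (site_word m n r (zip u w) fs))"
    by (subst sum.swap) (intro sum.cong refl sum.swap)
  also have "\<dots> = (\<Sum>w\<in>?W. \<Sum>u\<in>?W. opscale (d u w) (symmetrized_units m n r (zip u w)))"
    unfolding symmetrized_units_def tensor_op.scale_sum_right by (intro sum.cong refl) (simp_all only: z(2))
  also have "\<dots> \<in> schur_superalgebra m n r"
    by (intro schur_superalgebra_sum schur_superalgebra_scale symmetrized_units_in_schur z)
  finally have "opscale (1 / of_nat (fact r)) (opscale (of_nat (fact r)) T) \<in> schur_superalgebra m n r"
    by (rule schur_superalgebra_scale)
  then show ?thesis by simp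
qed

lemma orbit_conj:
  assumes "inj \<tau>" "bij \<tau>"
  shows "orbit (\<tau> \<circ> \<sigma> \<circ> inv_into UNIV \<tau>) (\<tau> x) = \<tau> ` orbit \<sigma> x"
proof -
  have "((\<tau> \<circ> \<sigma> \<circ> inv_into UNIV \<tau>) ^^ k) (\<tau> x) = \<tau> ((\<sigma> ^^ k) x)" for k
    by (induction k) (simp_all add: assms(1))
  then show ?thesis unfolding orbit_altdef by auto
qed

lemma cycle_type_conj:
  assumes t: "\<tau> permutes {..<r}"
  shows "cycle_type r (\<tau> \<circ> \<sigma> \<circ> inv_into UNIV \<tau>) = cycle_type r \<sigma>"
proof -
  have i: "inj \<tau>" "bij \<tau>" using permutes_inj[OF t] permutes_bij[OF t] by auto
  have "orbit (\<tau> \<circ> \<sigma> \<circ> inv_into UNIV \<tau>) ` {..<r} = orbit (\<tau> \<circ> \<sigma> \<circ> inv_into UNIV \<tau>) ` \<tau> ` {..<r}"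
    using permutes_image[OF t] by simp
  also have "\<dots> = (`) \<tau> ` orbit \<sigma> ` {..<r}"
    unfolding image_image orbit_conj[OF i] ..
  finally have e: "orbit (\<tau> \<circ> \<sigma> \<circ> inv_into UNIV \<tau>) ` {..<r} = (`) \<tau> ` orbit \<sigma> ` {..<r}" .
  have "inj_on ((`) \<tau>) A" for A by (rule inj_onI) (use i(1) in \<open>simp add: inj_image_eq_iff\<close>)
  then have "mset_set ((`) \<tau> ` orbit \<sigma> ` {..<r}) = image_mset ((`) \<tau>) (mset_set (orbit \<sigma> ` {..<r}))"
    by (rule image_mset_mset_set[symmetric])
  then show ?thesis
    unfolding cycle_type_def e by (simp add: image_mset.compositionality comp_def card_image inj_on_subset[OF i(1)])
qed

lemma eta_cl_apply: "eta_cl m n r c v = (\<Sum>\<sigma> | \<sigma> permutes {..<r}. tscale (c \<sigma>) (signed_perm_op m n r \<sigma> v))"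
  by (simp add: eta_cl_def sum_fun_apply opscale_def)

lemma eta_cl_class_commute:
  assumes c: "\<And>\<sigma> \<tau>. \<sigma> permutes {..<r} \<Longrightarrow> \<tau> permutes {..<r} \<Longrightarrow> c (\<tau> \<circ> \<sigma> \<circ> inv_into UNIV \<tau>) = c \<sigma>"
    and t: "\<tau> permutes {..<r}"
  shows "eta_cl m n r c \<circ> signed_perm_op m n r \<tau> = signed_perm_op m n r \<tau> \<circ> eta_cl m n r c"
proof -
  let ?p = "signed_perm_op m n r"
  let ?G = "{\<sigma>. \<sigma> permutes {..<r}}"
  let ?i = "inv_into UNIV \<tau>"
  have i: "?i (\<tau> x) = x" "\<tau> (?i x) = x" for x
    using permutes_inverses[OF t] by auto
  have lin: "?p \<tau> (sum f A) = (\<Sum>x\<in>A. ?p \<tau> (f x))" "?p \<tau> (tscale a v) = tscale a (?p \<tau> v)" for \<tau> f A a v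
    by (simp_all add: signed_perm_op_def lin_ext_sum lin_ext_lin)
  have "eta_cl m n r c \<circ> ?p \<tau> = (\<Sum>\<sigma>\<in>?G. opscale (c \<sigma>) (?p \<sigma> \<circ> ?p \<tau>))"
    by (simp add: eta_cl_def fun_eq_iff sum_fun_apply opscale_def)
  also have "\<dots> = (\<Sum>\<sigma>\<in>?G. opscale (c \<sigma>) (?p (\<tau> \<circ> \<sigma>)))"
    by (intro sum.cong refl) (simp add: signed_perm_op_compose[OF t])
  also have "\<dots> = (\<Sum>\<sigma>\<in>?G. opscale (c \<sigma>) (?p (\<sigma> \<circ> \<tau>)))"
  proof (rule sum.reindex_bij_witness[of _ "\<lambda>\<sigma>. ?i \<circ> \<sigma> \<circ> \<tau>" "\<lambda>\<sigma>. \<tau> \<circ> \<sigma> \<circ> ?i"])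
    fix \<sigma> assume "\<sigma> \<in> ?G"
    then have s: "\<sigma> permutes {..<r}" by simp
    show "?i \<circ> (\<tau> \<circ> \<sigma> \<circ> ?i) \<circ> \<tau> = \<sigma>" "\<tau> \<circ> (?i \<circ> \<sigma> \<circ> \<tau>) \<circ> ?i = \<sigma>"
      by (rule ext, simp add: i)+
    show "\<tau> \<circ> \<sigma> \<circ> ?i \<in> ?G" "?i \<circ> \<sigma> \<circ> \<tau> \<in> ?G"
      using s t by (simp_all add: permutes_compose permutes_inv)
    have "(\<tau> \<circ> \<sigma> \<circ> ?i) \<circ> \<tau> = \<tau> \<circ> \<sigma>" by (rule ext) (simp add: i)
    then show "opscale (c (\<tau> \<circ> \<sigma> \<circ> ?i)) (?p ((\<tau> \<circ> \<sigma> \<circ> ?i) \<circ> \<tau>)) = opscale (c \<sigma>) (?p (\<tau> \<circ> \<sigma>))"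
      by (simp only: c[OF s t])
  qed
  also have "\<dots> = (\<Sum>\<sigma>\<in>?G. opscale (c \<sigma>) (?p \<tau> \<circ> ?p \<sigma>))"
    by (intro sum.cong refl) (simp add: signed_perm_op_compose t)
  also have "\<dots> = ?p \<tau> \<circ> eta_cl m n r c"
    by (simp add: eta_cl_def fun_eq_iff sum_fun_apply opscale_def lin)
  finally show ?thesis .
qed

lemma eta_cl_linear:
  obtains f where "eta_cl m n r c = lin_ext m n r f"
    "\<And>w u. w \<in> tensor_words m n r \<Longrightarrow> u \<notin> tensor_words m n r \<Longrightarrow> f w u = 0"
proof -
  let ?f = "\<lambda>w. \<Sum>\<sigma> | \<sigma> permutes {..<r}. tscale (c \<sigma>) (tscale (odd_inversion_sign m \<sigma> w) (basis_tensor (permute_list \<sigma> w)))"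
  have "eta_cl m n r c = lin_ext m n r ?f"
    by (simp add: eta_cl_def signed_perm_op_def opscale_lin_ext sum_lin_ext)
  moreover have "?f w u = 0" if "w \<in> tensor_words m n r" "u \<notin> tensor_words m n r" for w u
    using that permute_list_in_tensor_words by (auto simp: sum_fun_apply tscale_def basis_tensor_def intro!: sum.neutral)
  ultimately show ?thesis by (rule that)
qed

lemma eta_cl_class_sum_center: "eta_cl m n r (class_sum r p) \<in> op_center (schur_superalgebra m n r)"
proof -
  have class_sum_conj: "class_sum r p (\<tau> \<circ> \<sigma> \<circ> inv_into UNIV \<tau>) = class_sum r p \<sigma>" if "\<sigma> permutes {..<r}" "\<tau> permutes {..<r}" for \<sigma> \<tau>
    using that by (simp add: class_sum_def cycle_type_conj permutes_compose permutes_inv)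
  obtain f where f: "eta_cl m n r (class_sum r p) = lin_ext m n r f"
    "\<And>w u. w \<in> tensor_words m n r \<Longrightarrow> u \<notin> tensor_words m n r \<Longrightarrow> f w u = 0"
    using eta_cl_linear[of m n r "class_sum r p"] by metis
  have "eta_cl m n r (class_sum r p) \<in> schur_superalgebra m n r"
    by (rule commutant_in_schur[OF f]) (auto intro!: eta_cl_class_commute class_sum_conj)
  moreover have "eta_cl m n r (class_sum r p) \<circ> T = T \<circ> eta_cl m n r (class_sum r p)"
    if "T \<in> schur_superalgebra m n r" for T
    using that
  proof (induction rule: schur_superalgebra_induct)
    case one
    then show ?case
      unfolding f(1) lin_ext_comp_tensor_id by (rule tensor_id_comp_lin_ext[OF f(2), symmetric])
  next
    case (unit i j T)
    have lin: "matrix_unit_op m n r i j (sum g A) = (\<Sum>x\<in>A. matrix_unit_op m n r i j (g x))" for g and A :: "(nat \<Rightarrow> nat) set"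
      by (simp add: matrix_unit_op_alt lin_ext_sum)
    have "matrix_unit_op m n r i j (signed_perm_op m n r \<sigma> v) = signed_perm_op m n r \<sigma> (matrix_unit_op m n r i j v)"
      if "\<sigma> permutes {..<r}" for \<sigma> v
      using matrix_unit_op_perm_commute[OF that unit(1)] by (metis comp_apply)
    then have "eta_cl m n r (class_sum r p) (matrix_unit_op m n r i j v) = matrix_unit_op m n r i j (eta_cl m n r (class_sum r p) v)" for v
      unfolding eta_cl_apply lin matrix_unit_op_lin
      by (intro sum.cong refl) simp
    then have "eta_cl m n r (class_sum r p) \<circ> matrix_unit_op m n r i j = matrix_unit_op m n r i j \<circ> eta_cl m n r (class_sum r p)"
      by (simp add: comp_def)
    with unit(3) show ?case by (metis comp_assoc)
  next
    case (add S T)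
    then show ?case unfolding f(1) fun_eq_iff comp_apply plus_fun_apply[of S T] lin_ext_lin by (metis plus_fun_apply)
  next
    case (scale c T)
    then have "lin_ext m n r f (T v) = T (lin_ext m n r f v)" for v by (metis comp_apply f(1))
    then show ?case by (simp add: f(1) opscale_def comp_def lin_ext_lin)
  qed
  ultimately show ?thesis by (simp add: op_center_def)
qed

section \<open>The trace of a permutation\<close>

text \<open>
  For an odd letter, the inversions of the transposition of \<open>i < j\<close> are the pair \<open>(i, j)\<close> itself and two
  for each odd letter in between, so their number is odd.
\<close>

lemma odd_inversion_sign_transpose:
  assumes ij: "i < length w" "j < length w" "i \<noteq> j" and e: "w ! i = w ! j"
  shows "odd_inversion_sign m (transpose i j) w = (if parity m (w ! i) = 1 then - 1 else 1)"
proof -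
  have lt: "odd_inversion_sign m (transpose i j) w = (if parity m (w ! i) = 1 then - 1 else 1)"
    if ij: "i < j" "j < length w" and e: "w ! i = w ! j" for i j
  proof (cases "parity m (w ! i) = 1")
    case True
    let ?A = "{l. i < l \<and> l < j \<and> parity m (w ! l) = 1}"
    have fin: "finite ?A" by (rule finite_subset[of _ "{..<j}"]) auto
    have "{(k, l). k < l \<and> l < length w \<and> transpose i j l < transpose i j k \<and>
       parity m (w ! transpose i j k) = 1 \<and> parity m (w ! transpose i j l) = 1}
      = insert (i, j) (Pair i ` ?A \<union> (\<lambda>l. (l, j)) ` ?A)" (is "?L = ?R")
    proof (intro equalityI subsetI)
      fix x assume "x \<in> ?L"
      then show "x \<in> ?R" using ij by (cases x) (auto simp: transpose_def image_iff split: if_splits)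
    next
      fix x assume "x \<in> ?R"
      then show "x \<in> ?L" using ij e True by (auto simp: transpose_def)
    qed
    moreover have "card (insert (i, j) (Pair i ` ?A \<union> (\<lambda>l. (l, j)) ` ?A)) = Suc (2 * card ?A)"
    proof -
      have "card (Pair i ` ?A \<union> (\<lambda>l. (l, j)) ` ?A) = card (Pair i ` ?A) + card ((\<lambda>l. (l, j)) ` ?A)"
        using fin by (intro card_Un_disjoint) auto
      also have "\<dots> = 2 * card ?A" by (simp add: card_image inj_on_def)
      finally show ?thesis using fin by (subst card_insert_disjoint) auto
    qed
    ultimately show ?thesis using True by (simp add: odd_inversion_sign_def)
  next
    case False
    have "{(k, l). k < l \<and> l < length w \<and> transpose i j l < transpose i j k \<and>
       parity m (w ! transpose i j k) = 1 \<and> parity m (w ! transpose i j l) = 1} = {}"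
      using False e by (auto simp: transpose_def split: if_splits)
    then show ?thesis using False by (simp only: odd_inversion_sign_def) simp
  qed
  show ?thesis
  proof (cases "i < j")
    case True
    then show ?thesis using lt ij e by blast
  next
    case False
    then show ?thesis using lt[of j i] ij e by (simp add: transpose_commute)
  qed
qed

lemma odd_inversion_sign_id: "odd_inversion_sign m id w = 1"
proof -
  have "{(k, l). k < l \<and> l < length w \<and> id l < id k \<and>
    parity m (w ! id k) = 1 \<and> parity m (w ! id l) = 1} = {}" by auto
  then show ?thesis unfolding odd_inversion_sign_def by (simp only: card.empty power_0)
qed

lemma permute_list_eq_iff:
  assumes "\<sigma> permutes {..<length w}"
  shows "permute_list \<sigma> w = w \<longleftrightarrow> (\<forall>k<length w. w ! \<sigma> k = w ! k)"
  using assms by (auto simp: list_eq_iff_nth_eq permute_list_nth)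

text \<open>
  A cycle of length \<open>l\<close> is a product of \<open>l - 1\<close> transpositions that all fix \<open>w\<close>, and on the permutations
  fixing \<open>w\<close> the sign is multiplicative.
\<close>

lemma odd_inversion_sign_cycle:
  assumes "distinct cs" "set cs \<subseteq> {..<length w}" "\<forall>k\<in>set cs. w ! k = c"
  shows "odd_inversion_sign m (cycle_of_list cs) w = (if parity m c = 1 then (-1) ^ (length cs - 1) else 1)"
  using assms
proof (induction cs rule: cycle_of_list.induct)
  case (1 i j cs)
  have t: "transpose i j permutes {..<length w}"
    using 1 by (intro permutes_swap_id) auto
  have c: "cycle_of_list (j # cs) permutes {..<length w}"
    using 1 by (intro permutes_subset[OF cycle_permutes]) auto
  have "permute_list (transpose i j) w = w"
    using 1 by (subst permute_list_eq_iff[OF t]) (auto simp: transpose_def)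
  then have "odd_inversion_sign m (transpose i j \<circ> cycle_of_list (j # cs)) w
    = odd_inversion_sign m (transpose i j) w * odd_inversion_sign m (cycle_of_list (j # cs)) w"
    using odd_inversion_sign_compose[OF t c, of m] by simp
  also have "transpose i j \<circ> cycle_of_list (j # cs) = cycle_of_list (i # j # cs)"
    by (rule ext) simp
  finally show ?case using 1 by (simp add: odd_inversion_sign_transpose del: cycle_of_list.simps)
qed (simp_all add: odd_inversion_sign_id)

lemma cyclic_on_cycle_of_list:
  assumes "distinct cs" "cs \<noteq> []"
  shows "cyclic_on (cycle_of_list cs) (set cs)"
proof -
  let ?f = "cycle_of_list cs"
  have n: "(?f ^^ k) (cs ! 0) = cs ! (k mod length cs)" for k
  proof -
    have "(?f ^^ k) (cs ! 0) = map (?f ^^ k) cs ! 0" using assms by simp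
    also have "\<dots> = rotate k cs ! 0" using cyclic_rotation[OF assms(1)] by simp
    also have "\<dots> = cs ! (k mod length cs)" using assms by (simp add: nth_rotate)
    finally show ?thesis .
  qed
  have "set cs = orbit ?f (cs ! 0)"
  proof (intro equalityI subsetI)
    fix x assume "x \<in> set cs"
    then obtain k where k: "k < length cs" "x = cs ! k" by (auto simp: in_set_conv_nth)
    have "x = (?f ^^ (k + length cs)) (cs ! 0)" using k by (simp add: n)
    moreover have "k + length cs > 0" using assms(2) by simp
    ultimately show "x \<in> orbit ?f (cs ! 0)" unfolding orbit_altdef by blast
  next
    fix x assume "x \<in> orbit ?f (cs ! 0)"
    then obtain k where "x = cs ! (k mod length cs)" unfolding orbit_altdef n by blast
    then show "x \<in> set cs" using assms by simp
  qed
  moreover have "cs ! 0 \<in> set cs" using assms by simp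
  ultimately show ?thesis unfolding cyclic_on_def by blast
qed

lemma orbits_cycle_comp:
  assumes p: "p permutes I" "finite I" and cs: "distinct cs" "cs \<noteq> []" "set cs \<inter> I = {}"
  shows "orbit (cycle_of_list cs \<circ> p) ` (set cs \<union> I) = insert (set cs) (orbit p ` I)"
    "set cs \<notin> orbit p ` I"
proof -
  have "orbit (cycle_of_list cs \<circ> p) x = set cs" if "x \<in> set cs" for x
    by (rule orbit_cyclic_eq3[OF permutes_comp_preserves_cyclic1[OF p(1) cyclic_on_cycle_of_list[OF cs(1,2)] cs(3)]])
       (use that in auto)
  moreover have "orbit (cycle_of_list cs \<circ> p) x = orbit p x" if x: "x \<in> I" for x
  proof (rule orbit_cyclic_eq3[OF permutes_comp_preserves_cyclic2[OF cycle_permutes cyclic_on_orbit[OF p] cs(3)]])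
    show "orbit p x \<subseteq> I" by (rule permutes_orbit_subset[OF p(1) x])
    show "x \<in> orbit p x" using p by (intro permutation_self_in_orbit) (auto simp: permutation_permutes)
  qed
  ultimately show "orbit (cycle_of_list cs \<circ> p) ` (set cs \<union> I) = insert (set cs) (orbit p ` I)"
    using cs(2) by (auto simp: image_Un image_iff)
  show "set cs \<notin> orbit p ` I"
  proof
    assume "set cs \<in> orbit p ` I"
    then have "set cs \<subseteq> I" using permutes_orbit_subset[OF p(1)] by auto
    moreover have "hd cs \<in> set cs" using cs(2) by simp
    ultimately show False using cs(3) by blast
  qed
qed

text \<open>
  A word fixed by \<open>p\<close> is constant on the orbits; the letter at the minimum of an orbit represents it.
\<close>

lemma odd_inversion_sign_fixed:
  assumes "cycle_decomp I p" "I \<subseteq> {..<length w}" "\<forall>k<length w. w ! p k = w ! k"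
  shows "odd_inversion_sign m p w = (\<Prod>C\<in>orbit p ` I. if parity m (w ! Min C) = 1 then (-1) ^ (card C - 1) else 1)"
  using assms
proof (induction rule: cycle_decomp.induct)
  case empty
  show ?case by (simp only: odd_inversion_sign_id image_empty prod.empty)
next
  case (comp I p cs)
  let ?c = "cycle_of_list cs"
  have I: "finite I" "I \<subseteq> {..<length w}" using comp.prems finite_subset by auto
  have p: "p permutes I"
    using comp.hyps(1)
  proof (induction rule: cycle_decomp.induct)
    case (comp I p cs)
    then show ?case by (intro permutes_compose) (auto intro: permutes_subset[OF cycle_permutes] permutes_subset)
  qed (rule permutes_id)
  have cp: "?c permutes set cs" by (rule cycle_permutes)
  have pk: "p k \<in> I \<longleftrightarrow> k \<in> I" for k using permutes_in_image[OF p] .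
  have fp: "w ! p k = w ! k" if "k < length w" for k
  proof (cases "k \<in> I")
    case True
    then have "?c (p k) = p k" using pk comp.hyps(3) permutes_not_in[OF cp] by blast
    then show ?thesis using comp.prems(2) that by (metis comp_apply)
  qed (simp add: permutes_not_in[OF p])
  have fc: "w ! ?c k = w ! k" if "k < length w" for k
  proof (cases "k \<in> set cs")
    case True
    then have "p k = k" using comp.hyps(3) permutes_not_in[OF p] by blast
    then show ?thesis using comp.prems(2) that by (metis comp_apply)
  qed (simp add: permutes_not_in[OF cp])
  show ?case
  proof (cases "cs = []")
    case True
    then show ?thesis using comp.IH[OF I(2)] fp by simp
  next
    case False
    have cl: "?c permutes {..<length w}" using permutes_subset[OF cp] comp.prems by auto
    have pl: "p permutes {..<length w}" using permutes_subset[OF p I(2)] .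
    have const: "\<forall>k\<in>set cs. w ! k = w ! Min (set cs)"
    proof -
      have "w ! y = w ! x" if "y \<in> orbit ?c x" "x \<in> set cs" for x y
        using that(1)
      proof induction
        case base
        show ?case using fc that comp.prems by auto
      next
        case (step y)
        have "y \<in> set cs" using permutes_orbit_subset[OF cp that(2)] step by auto
        then have "y < length w" using comp.prems by auto
        then show ?case using fc step by simp
      qed
      moreover have "Min (set cs) \<in> set cs" using False by simp
      ultimately show ?thesis
        using cyclic_on_cycle_of_list[OF comp.hyps(2) False] unfolding cyclic_on_alldef by blast
    qed
    have "odd_inversion_sign m (?c \<circ> p) w = odd_inversion_sign m ?c w * odd_inversion_sign m p w"
      using odd_inversion_sign_compose[OF cl pl] permute_list_eq_iff[OF cl] fc by simp
    also have "odd_inversion_sign m ?c w = (if parity m (w ! Min (set cs)) = 1 then (-1) ^ (card (set cs) - 1) else 1)"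
      using odd_inversion_sign_cycle[OF comp.hyps(2) _ const] comp.prems comp.hyps(2) by (simp add: distinct_card)
    also have "odd_inversion_sign m p w = (\<Prod>C\<in>orbit p ` I. if parity m (w ! Min C) = 1 then (-1) ^ (card C - 1) else 1)"
      using comp.IH[OF I(2)] fp by simp
    also have "(if parity m (w ! Min (set cs)) = 1 then (-1) ^ (card (set cs) - 1) else 1) *
        (\<Prod>C\<in>orbit p ` I. if parity m (w ! Min C) = 1 then (-1) ^ (card C - 1) else 1)
      = (\<Prod>C\<in>orbit (?c \<circ> p) ` (set cs \<union> I). if parity m (w ! Min C) = 1 then (-1) ^ (card C - 1) else 1)"
      unfolding orbits_cycle_comp(1)[OF p I(1) comp.hyps(2) False comp.hyps(3)]
      by (rule prod.insert[symmetric])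
         (use I(1) orbits_cycle_comp(2)[OF p I(1) comp.hyps(2) False comp.hyps(3)] in auto)
    finally show ?thesis .
  qed
qed

lemma exists_permutation_cycle_type:
  assumes "0 \<notin> set ks" "finite I" "card I = sum_list ks"
  shows "\<exists>p. p permutes I \<and> image_mset card (mset_set (orbit p ` I)) = mset ks"
  using assms
proof (induction ks arbitrary: I)
  case Nil
  then show ?case by (intro exI[of _ id] conjI permutes_id) simp
next
  case (Cons k ks)
  then obtain J where J: "J \<subseteq> I" "card J = k" using obtain_subset_with_card_n[of k I] by auto
  have fJ: "finite J" using J Cons finite_subset by blast
  then obtain cs where cs: "set cs = J" "distinct cs" using finite_distinct_list by blast
  have ne: "cs \<noteq> []" using Cons.prems J cs by auto
  have "card (I - J) = sum_list ks" using Cons.prems J fJ by (simp add: card_Diff_subset)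
  then obtain p where p: "p permutes (I - J)" "image_mset card (mset_set (orbit p ` (I - J))) = mset ks"
    using Cons.IH[of "I - J"] Cons.prems by auto
  have fin: "finite (I - J)" using Cons.prems by simp
  note o = orbits_cycle_comp[OF p(1) fin cs(2) ne]
  have u: "set cs \<union> (I - J) = I" using J cs by auto
  have "cycle_of_list cs \<circ> p permutes I"
    using permutes_subset[OF cycle_permutes, of cs I] permutes_subset[OF p(1), of I] J cs
    by (intro permutes_compose) auto
  moreover have "image_mset card (mset_set (orbit (cycle_of_list cs \<circ> p) ` I)) = mset (k # ks)"
    using o[unfolded u] p(2) cs(1) J(2) fin by simp
  ultimately show ?case by blast
qed

text \<open>
  The supersymmetric power sum, in which the odd variables carry the sign of a \<open>k\<close>-cycle.
\<close>

definition super_power_sum :: "nat \<Rightarrow> nat \<Rightarrow> (nat \<Rightarrow> complex) \<Rightarrow> nat \<Rightarrow> complex" where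
  "super_power_sum m n x k = (\<Sum>l\<in>{1..m + n}. (if parity m l = 1 then (-1) ^ (k - 1) else 1) * x l ^ k)"

text \<open>
  The trace of \<open>T\<close> composed with the \<open>r\<close>-th tensor power of the diagonal matrix with entries \<open>x\<close>.
\<close>

definition weighted_trace :: "nat \<Rightarrow> nat \<Rightarrow> nat \<Rightarrow> (nat \<Rightarrow> complex) \<Rightarrow> tensor_op \<Rightarrow> complex" where
  "weighted_trace m n r x T = (\<Sum>w\<in>tensor_words m n r. (\<Prod>i<r. x (w ! i)) * T (basis_tensor w) w)"

lemma weighted_trace_lin:
  "weighted_trace m n r x (S + T) = weighted_trace m n r x S + weighted_trace m n r x T"
  "weighted_trace m n r x (opscale c T) = c * weighted_trace m n r x T"
  "weighted_trace m n r x 0 = 0"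
  by (simp_all add: weighted_trace_def distrib_left sum.distrib opscale_def tscale_def sum_distrib_left mult_ac)

lemma weighted_trace_sum: "weighted_trace m n r x (sum f A) = (\<Sum>a\<in>A. weighted_trace m n r x (f a))"
  by (induction A rule: infinite_finite_induct) (simp_all add: weighted_trace_lin del: plus_fun_apply zero_fun_apply)

text \<open>
  Only the words fixed by \<open>\<sigma>\<close> contribute. They correspond to the choices of one letter for each orbit,
  and the contribution of a word is a product over the orbits.
\<close>

lemma weighted_trace_perm:
  assumes s: "\<sigma> permutes {..<r}"
  shows "weighted_trace m n r x (signed_perm_op m n r \<sigma>) = (\<Prod>k\<in>#cycle_type r \<sigma>. super_power_sum m n x k)"
proof -
  let ?O = "orbit \<sigma> ` {..<r}"
  let ?W = "tensor_words m n r"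
  let ?g = "\<lambda>k l. (if parity m l = 1 then (-1) ^ (k - 1) else 1) * x l ^ k"
  have perm: "permutation \<sigma>" using s by (auto simp: permutation_permutes)
  have self: "k \<in> orbit \<sigma> k" for k by (rule permutation_self_in_orbit[OF perm])
  have sub: "orbit \<sigma> k \<subseteq> {..<r}" if "k < r" for k using permutes_orbit_subset[OF s] that by simp
  have eq: "orbit \<sigma> y = orbit \<sigma> k" if "y \<in> orbit \<sigma> k" for y k
    by (rule orbit_cyclic_eq3[OF cyclic_on_orbit'[OF perm] that])
  have finC: "finite C" "C \<noteq> {}" "C \<subseteq> {..<r}" if "C \<in> ?O" for C
    using that sub self finite_subset[of C "{..<r}"] by auto
  have MinC: "Min C \<in> C" "Min C < r" "orbit \<sigma> (Min C) = C" if C: "C \<in> ?O" for C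
  proof -
    show 1: "Min C \<in> C" using finC[OF C] by simp
    then show "Min C < r" using finC(3)[OF C] by blast
    show "orbit \<sigma> (Min C) = C" using C 1 eq by auto
  qed
  let ?F = "{w \<in> ?W. permute_list \<sigma> w = w}"
  have const: "w ! y = w ! k" if w: "w \<in> ?F" and y: "y \<in> orbit \<sigma> k" and k: "k < r" for w y k
  proof -
    have l: "length w = r" using w by (simp add: tensor_words_def)
    have f: "w ! \<sigma> k = w ! k" if "k < r" for k
      using permute_list_eq_iff[of \<sigma> w] s w l that by simp
    from y show ?thesis
    proof induction
      case base
      show ?case using f k by simp
    next
      case (step y)
      then have "y < r" using sub[OF k] by auto
      then show ?case using f step by simp
    qed
  qed
  have "weighted_trace m n r x (signed_perm_op m n r \<sigma>)
    = (\<Sum>w\<in>?W. if permute_list \<sigma> w = w then (\<Prod>i<r. x (w ! i)) * odd_inversion_sign m \<sigma> w else 0)"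
  proof -
    have "signed_perm_op m n r \<sigma> (basis_tensor w) w = (if permute_list \<sigma> w = w then odd_inversion_sign m \<sigma> w else 0)"
      if "w \<in> ?W" for w
    proof -
      have "signed_perm_op m n r \<sigma> (basis_tensor w) = tscale (odd_inversion_sign m \<sigma> w) (basis_tensor (permute_list \<sigma> w))"
        using that by (simp add: signed_perm_op_def lin_ext_basis)
      then show ?thesis by (auto simp: tscale_def basis_tensor_def)
    qed
    then show ?thesis unfolding weighted_trace_def by (intro sum.cong refl) simp
  qed
  also have "\<dots> = (\<Sum>w\<in>?F. (\<Prod>i<r. x (w ! i)) * odd_inversion_sign m \<sigma> w)"
    by (rule sum.inter_filter[symmetric, OF finite_tensor_words])
  also have "\<dots> = (\<Sum>w\<in>?F. \<Prod>C\<in>?O. ?g (card C) (w ! Min C))"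
  proof (rule sum.cong[OF refl])
    fix w assume w: "w \<in> ?F"
    then have l: "length w = r" by (simp add: tensor_words_def)
    have U: "{..<r} = \<Union>?O" using sub self by auto
    from U have "(\<Prod>i<r. x (w ! i)) = (\<Prod>i\<in>\<Union>?O. x (w ! i))" by (rule arg_cong)
    also have "\<dots> = (\<Prod>C\<in>?O. \<Prod>i\<in>C. x (w ! i))"
    proof -
      have "\<forall>A\<in>?O. finite A" using finC(1) by blast
      moreover have "\<forall>A\<in>?O. \<forall>B\<in>?O. A \<noteq> B \<longrightarrow> A \<inter> B = {}" using eq by blast
      ultimately have "(\<Prod>i\<in>\<Union>?O. x (w ! i)) = (prod \<circ> prod) (\<lambda>i. x (w ! i)) ?O"
        by (rule prod.Union_disjoint)
      then show ?thesis by (simp only: comp_apply)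
    qed
    also have "\<dots> = (\<Prod>C\<in>?O. x (w ! Min C) ^ card C)"
    proof (rule prod.cong[OF refl])
      fix C assume C: "C \<in> ?O"
      have "(\<Prod>i\<in>C. x (w ! i)) = (\<Prod>i\<in>C. x (w ! Min C))"
        using const[OF w _ MinC(2)[OF C]] MinC(3)[OF C] by (intro prod.cong refl arg_cong[where f = x]) blast
      then show "(\<Prod>i\<in>C. x (w ! i)) = x (w ! Min C) ^ card C" by simp
    qed
    finally have 1: "(\<Prod>i<r. x (w ! i)) = (\<Prod>C\<in>?O. x (w ! Min C) ^ card C)" .
    have "\<forall>k<length w. w ! \<sigma> k = w ! k"
      using permute_list_eq_iff[of \<sigma> w] s w l by simp
    then have 2: "odd_inversion_sign m \<sigma> w = (\<Prod>C\<in>?O. if parity m (w ! Min C) = 1 then (-1) ^ (card C - 1) else 1)"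
      using l by (intro odd_inversion_sign_fixed cycle_decomposition[OF s]) auto
    show "(\<Prod>i<r. x (w ! i)) * odd_inversion_sign m \<sigma> w = (\<Prod>C\<in>?O. ?g (card C) (w ! Min C))"
      unfolding 1 2 prod.distrib[symmetric] by (simp add: mult.commute)
  qed
  also have "\<dots> = (\<Sum>\<phi>\<in>PiE ?O (\<lambda>_. {1..m + n}). \<Prod>C\<in>?O. ?g (card C) (\<phi> C))"
  proof (rule sum.reindex_bij_witness[of _ "\<lambda>\<phi>. map (\<lambda>i. \<phi> (orbit \<sigma> i)) [0..<r]" "\<lambda>w. \<lambda>C\<in>?O. w ! Min C"])
    fix w assume w: "w \<in> ?F"
    then have l: "length w = r" by (simp add: tensor_words_def)
    show "map (\<lambda>i. (\<lambda>C\<in>?O. w ! Min C) (orbit \<sigma> i)) [0..<r] = w"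
    proof (rule nth_equalityI)
      fix i assume "i < length (map (\<lambda>i. (\<lambda>C\<in>?O. w ! Min C) (orbit \<sigma> i)) [0..<r])"
      then have i: "i < r" by simp
      then have "w ! Min (orbit \<sigma> i) = w ! i" using const[OF w _ i] MinC(1)[of "orbit \<sigma> i"] by auto
      then show "map (\<lambda>i. (\<lambda>C\<in>?O. w ! Min C) (orbit \<sigma> i)) [0..<r] ! i = w ! i" using i by simp
    qed (simp add: l)
    show "(\<lambda>C\<in>?O. w ! Min C) \<in> PiE ?O (\<lambda>_. {1..m + n})"
    proof (rule restrict_PiE_iff[THEN iffD2], rule ballI)
      fix C assume "C \<in> ?O"
      then have "w ! Min C \<in> set w" using MinC(2) l by simp
      then show "w ! Min C \<in> {1..m + n}" using w by (auto simp: tensor_words_def)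
    qed
    show "(\<Prod>C\<in>?O. ?g (card C) ((\<lambda>C\<in>?O. w ! Min C) C)) = (\<Prod>C\<in>?O. ?g (card C) (w ! Min C))"
      by (rule prod.cong) auto
  next
    fix \<phi> assume p: "\<phi> \<in> PiE ?O (\<lambda>_. {1..m + n})"
    let ?w = "map (\<lambda>i. \<phi> (orbit \<sigma> i)) [0..<r]"
    show "(\<lambda>C\<in>?O. ?w ! Min C) = \<phi>"
    proof (rule ext)
      fix C
      show "(\<lambda>C\<in>?O. ?w ! Min C) C = \<phi> C"
        using MinC[of C] PiE_arb[OF p, of C] by (cases "C \<in> ?O") auto
    qed
    have "?w \<in> ?W" using p by (auto simp: tensor_words_def PiE_iff)
    moreover have "permute_list \<sigma> ?w = ?w"
    proof -
      have "orbit \<sigma> (\<sigma> k) = orbit \<sigma> k" for k by (rule eq) (rule orbit.base)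
      moreover have "\<sigma> k < r" if "k < r" for k using permutes_in_image[OF s, of k] that by simp
      ultimately show ?thesis using s by (subst permute_list_eq_iff) auto
    qed
    ultimately show "?w \<in> ?F" by simp
  qed
  also have "\<dots> = (\<Prod>C\<in>?O. \<Sum>l\<in>{1..m + n}. ?g (card C) l)"
    by (rule prod_sum_PiE[symmetric]) auto
  also have "\<dots> = (\<Prod>k\<in>#cycle_type r \<sigma>. super_power_sum m n x k)"
    by (simp add: cycle_type_def image_mset.compositionality comp_def super_power_sum_def prod_unfold_prod_mset)
  finally show ?thesis .
qed

lemma weighted_trace_class_sum:
  assumes "p \<in> hook_partitions a b r"
  obtains c where "c \<noteq> 0" "\<And>x. weighted_trace m n r x (eta_cl m n r (class_sum r p)) = c * (\<Prod>k\<leftarrow>p. super_power_sum m n x k)"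
proof -
  let ?K = "{\<sigma>. \<sigma> permutes {..<r} \<and> cycle_type r \<sigma> = mset p}"
  have fin: "finite ?K" by (rule finite_subset[OF _ finite_permutations[of "{..<r}"]]) auto
  have "0 \<notin> set p" "card {..<r} = sum_list p" using assms by (auto simp: hook_partitions_def)
  from exists_permutation_cycle_type[OF this(1) _ this(2)] have "?K \<noteq> {}" by (auto simp: cycle_type_def)
  then have "of_nat (card ?K) \<noteq> (0 :: complex)" using fin by simp
  moreover have "weighted_trace m n r x (eta_cl m n r (class_sum r p)) = of_nat (card ?K) * (\<Prod>k\<leftarrow>p. super_power_sum m n x k)" for x
  proof -
    have "weighted_trace m n r x (eta_cl m n r (class_sum r p))
      = (\<Sum>\<sigma> | \<sigma> permutes {..<r}. if cycle_type r \<sigma> = mset p then \<Prod>k\<leftarrow>p. super_power_sum m n x k else 0)"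
      unfolding eta_cl_def weighted_trace_sum weighted_trace_lin
      by (intro sum.cong refl) (auto simp: class_sum_def weighted_trace_perm prod_mset_prod_list[symmetric] simp del: prod_mset_prod_list)
    also have "\<dots> = (\<Sum>\<sigma>\<in>?K. \<Prod>k\<leftarrow>p. super_power_sum m n x k)"
      by (subst sum.inter_filter[symmetric]) (auto simp: finite_permutations intro!: sum.cong)
    finally show ?thesis by simp
  qed
  ultimately show ?thesis by (rule that)
qed

section \<open>Singular vectors\<close>

text \<open>
  The Hermitian form for which the basis tensors are orthonormal. It is used to show that certain
  vectors and operators vanish and that certain numbers are nonnegative.
\<close>

definition tensor_inner :: "nat \<Rightarrow> nat \<Rightarrow> nat \<Rightarrow> tensor \<Rightarrow> tensor \<Rightarrow> complex" where
  "tensor_inner m n r u v = (\<Sum>w\<in>tensor_words m n r. cnj (u w) * v w)"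

lemma tensor_inner_lin:
  "tensor_inner m n r u (v + v') = tensor_inner m n r u v + tensor_inner m n r u v'"
  "tensor_inner m n r u (v - v') = tensor_inner m n r u v - tensor_inner m n r u v'"
  "tensor_inner m n r u (tscale c v) = c * tensor_inner m n r u v"
  "tensor_inner m n r u 0 = 0"
  by (simp_all add: tensor_inner_def tscale_def distrib_left right_diff_distrib sum.distrib sum_subtractf sum_distrib_left mult_ac)

lemma tensor_inner_sum: "tensor_inner m n r y (sum g A) = (\<Sum>x\<in>A. tensor_inner m n r y (g x))"
  by (induction A rule: infinite_finite_induct) (simp_all add: tensor_inner_lin del: plus_fun_apply zero_fun_apply)

lemma tensor_inner_cnj: "cnj (tensor_inner m n r u v) = tensor_inner m n r v u"
  by (simp add: tensor_inner_def mult.commute)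

lemma tensor_inner_self: "tensor_inner m n r v v = complex_of_real (\<Sum>w\<in>tensor_words m n r. (cmod (v w))\<^sup>2)"
  unfolding of_real_sum complex_norm_square by (simp add: tensor_inner_def mult.commute)

lemma tensor_inner_self_nonneg: "tensor_inner m n r v v = complex_of_real (Re (tensor_inner m n r v v))"
    "Re (tensor_inner m n r v v) \<ge> 0"
  by (simp_all add: tensor_inner_self sum_nonneg)

definition tensor_space :: "nat \<Rightarrow> nat \<Rightarrow> nat \<Rightarrow> tensor set" where
  "tensor_space m n r = {v. \<forall>u. u \<notin> tensor_words m n r \<longrightarrow> v u = 0}"

lemma tensor_expand:
  assumes "v \<in> tensor_space m n r"
  shows "v = (\<Sum>u\<in>tensor_words m n r. tscale (v u) (basis_tensor u))"
  using assms by (auto simp: fun_eq_iff sum_fun_apply tscale_def basis_tensor_def tensor_space_def finite_tensor_words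
    if_distrib[of "\<lambda>x. _ * x"] cong: if_cong)

lemma tensor_inner_self_eq_0:
  assumes "v \<in> tensor_space m n r" "tensor_inner m n r v v = 0"
  shows "v = 0"
proof (rule ext)
  fix u
  have "(\<Sum>w\<in>tensor_words m n r. (cmod (v w))\<^sup>2) = 0"
    using assms(2) by (simp only: tensor_inner_self of_real_eq_0_iff)
  then have "\<forall>w\<in>tensor_words m n r. (cmod (v w))\<^sup>2 = 0"
    by (subst (asm) sum_nonneg_eq_0_iff) (auto simp: finite_tensor_words)
  then show "v u = 0 u" using assms(1) by (cases "u \<in> tensor_words m n r") (auto simp: tensor_space_def)
qed

lemma tensor_inner_separates:
  assumes "u \<in> tensor_space m n r" "u' \<in> tensor_space m n r"
    "\<And>v. v \<in> tensor_space m n r \<Longrightarrow> tensor_inner m n r u v = tensor_inner m n r u' v"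
  shows "u = u'"
proof -
  have d: "u - u' \<in> tensor_space m n r" using assms(1,2) by (simp add: tensor_space_def)
  have "tensor_inner m n r (u - u') (u - u') = tensor_inner m n r u (u - u') - tensor_inner m n r u' (u - u')"
    by (simp add: tensor_inner_def left_diff_distrib sum_subtractf del: minus_apply) (simp add: algebra_simps sum_subtractf sum.distrib)
  then have "u - u' = 0" using assms(3)[OF d] tensor_inner_self_eq_0[OF d] by simp
  then show ?thesis by simp
qed

text \<open>
  \<open>E\<^sub>i\<^sub>j\<close> replaces a letter \<open>j\<close> by \<open>i\<close> with the same real sign as \<open>E\<^sub>j\<^sub>i\<close> in the opposite direction.
\<close>

lemma matrix_unit_op_adjoint:
  assumes i: "i \<in> {1..m + n}" and j: "j \<in> {1..m + n}"
  shows "tensor_inner m n r (matrix_unit_op m n r i j u) v = tensor_inner m n r u (matrix_unit_op m n r j i v)"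
proof -
  let ?W = "tensor_words m n r"
  let ?s = "\<lambda>k w. leading_sign m (parity m i + parity m j) k w"
  have cs: "cnj (?s k w) = ?s k w" for k w by (simp add: leading_sign_def)
  have len: "length w = r" if "w \<in> ?W" for w using that by (simp add: tensor_words_def)
  have "tensor_inner m n r (matrix_unit_op m n r i j u) v
     = (\<Sum>k<r. \<Sum>w\<in>?W. if w ! k = i then ?s k w * cnj (u (w[k := j])) * v w else 0)"
    unfolding tensor_inner_def
    by (subst sum.swap, intro sum.cong refl)
       (simp add: matrix_unit_op_apply[OF i j] cs sum_distrib_right if_distrib[of cnj] if_distribR if_distrib[of "\<lambda>x. x * _"] cong: if_cong)
  also have "\<dots> = (\<Sum>k<r. \<Sum>w\<in>{w\<in>?W. w ! k = i}. ?s k w * cnj (u (w[k := j])) * v w)"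
    by (rule sum.cong[OF refl], rule sum.inter_filter[symmetric, OF finite_tensor_words])
  also have "\<dots> = (\<Sum>k<r. \<Sum>w\<in>{w\<in>?W. w ! k = j}. ?s k w * cnj (u w) * v (w[k := i]))"
  proof (rule sum.cong[OF refl])
    fix k assume k: "k \<in> {..<r}"
    show "(\<Sum>w\<in>{w\<in>?W. w ! k = i}. ?s k w * cnj (u (w[k := j])) * v w)
      = (\<Sum>w\<in>{w\<in>?W. w ! k = j}. ?s k w * cnj (u w) * v (w[k := i]))"
    proof (rule sum.reindex_bij_witness[of _ "\<lambda>w. w[k := i]" "\<lambda>w. w[k := j]"])
      fix w assume w: "w \<in> {w\<in>?W. w ! k = i}"
      then have l: "length w = r" using len by blast
      show "w[k := j, k := i] = w" using w by auto
      show "w[k := j] \<in> {w\<in>?W. w ! k = j}" using w list_update_in_tensor_words[OF _ j] k l by auto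
      show "?s k (w[k := j]) * cnj (u (w[k := j])) * v (w[k := j, k := i]) = ?s k w * cnj (u (w[k := j])) * v w"
        using w k l by (subst leading_sign_update) auto
    next
      fix w assume w: "w \<in> {w\<in>?W. w ! k = j}"
      then have l: "length w = r" using len by blast
      show "w[k := i, k := j] = w" using w by auto
      show "w[k := i] \<in> {w\<in>?W. w ! k = i}" using w list_update_in_tensor_words[OF _ i] k l by auto
    qed
  qed
  also have "\<dots> = (\<Sum>k<r. \<Sum>w\<in>?W. if w ! k = j then ?s k w * cnj (u w) * v (w[k := i]) else 0)"
    by (rule sum.cong[OF refl], rule sum.inter_filter[OF finite_tensor_words])
  also have "\<dots> = tensor_inner m n r u (matrix_unit_op m n r j i v)"
    unfolding tensor_inner_def
    by (subst sum.swap, intro sum.cong refl)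
       (simp add: matrix_unit_op_apply[OF j i] sum_distrib_left if_distrib[of "\<lambda>x. _ * x"] add.commute mult_ac cong: if_cong)
  finally show ?thesis .
qed

lemma matrix_unit_op_in_space:
  assumes "i \<in> {1..m + n}" "j \<in> {1..m + n}"
  shows "matrix_unit_op m n r i j v \<in> tensor_space m n r"
  using assms by (simp add: tensor_space_def matrix_unit_op_apply)

lemma matrix_unit_op_commutator:
  assumes "i \<in> {1..m + n}" "j \<in> {1..m + n}" "k \<in> {1..m + n}" "l \<in> {1..m + n}"
  shows "matrix_unit_op m n r i j (matrix_unit_op m n r k l v) =
    tscale ((-1) ^ ((parity m i + parity m j) * (parity m k + parity m l))) (matrix_unit_op m n r k l (matrix_unit_op m n r i j v))
    + ((if j = k then matrix_unit_op m n r i l v else 0)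
       - tscale ((-1) ^ ((parity m i + parity m j) * (parity m k + parity m l))) (if i = l then matrix_unit_op m n r k j v else 0))"
proof -
  have "{i, j, k, l} \<subseteq> {1..m + n}" using assms by simp
  from fun_cong[OF matrix_unit_op_supercommutator[OF this, of r], of v] show ?thesis
    by (auto simp: opscale_def algebra_simps split: if_splits)
qed

text \<open>
  Weights are recorded as multisets of letters: the multiplicity of \<open>i\<close> is the eigenvalue of \<open>E\<^sub>i\<^sub>i\<close>.
\<close>

definition weight_vector :: "nat \<Rightarrow> nat \<Rightarrow> nat \<Rightarrow> nat multiset \<Rightarrow> tensor \<Rightarrow> bool" where
  "weight_vector m n r M v \<longleftrightarrow> (\<forall>u. v u \<noteq> 0 \<longrightarrow> u \<in> tensor_words m n r \<and> mset u = M)"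

lemma weight_vector_in_space: "weight_vector m n r M v \<Longrightarrow> v \<in> tensor_space m n r"
  by (auto simp: weight_vector_def tensor_space_def)

lemma weight_vector_iff:
  assumes "v \<noteq> 0" and M: "weight_vector m n r M v"
  shows "set_mset M \<subseteq> {1..m + n}" "size M = r"
proof -
  obtain u where "v u \<noteq> 0" using assms(1) by (auto simp: fun_eq_iff)
  then have "u \<in> tensor_words m n r" "mset u = M" using M by (auto simp: weight_vector_def)
  then show "set_mset M \<subseteq> {1..m + n}" "size M = r" by (auto simp: tensor_words_def)
qed

lemma matrix_unit_op_weight_diag:
  assumes "i \<in> {1..m + n}" "weight_vector m n r M v"
  shows "matrix_unit_op m n r i i v = tscale (of_nat (count M i)) v"
  using assms(2) by (auto simp: fun_eq_iff matrix_unit_op_diag[OF assms(1)] tscale_def weight_vector_def)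

lemma weight_vector_of_diag:
  assumes v: "v \<in> tensor_space m n r" and M: "set_mset M \<subseteq> {1..m + n}"
    and d: "\<And>i. i \<in> {1..m + n} \<Longrightarrow> matrix_unit_op m n r i i v = tscale (of_nat (count M i)) v"
  shows "weight_vector m n r M v"
  unfolding weight_vector_def
proof (intro allI impI conjI)
  fix u assume u: "v u \<noteq> 0"
  then show uw: "u \<in> tensor_words m n r" using v by (auto simp: tensor_space_def)
  show "mset u = M"
  proof (rule multiset_eqI)
    fix i
    show "count (mset u) i = count M i"
    proof (cases "i \<in> {1..m + n}")
      case True
      from fun_cong[OF d[OF True], of u] show ?thesis
        using u uw by (simp add: matrix_unit_op_diag[OF True] tscale_def)
    next
      case False
      then have "i \<notin># M" "i \<notin># mset u" using M uw by (auto simp: tensor_words_def)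
      then show ?thesis by (simp add: not_in_iff)
    qed
  qed
qed

lemma matrix_unit_op_nonzeroE:
  assumes i: "i \<in> {1..m + n}" and j: "j \<in> {1..m + n}" and u: "matrix_unit_op m n r i j v u \<noteq> 0"
  obtains k where "u \<in> tensor_words m n r" "k < r" "u ! k = i" "v (u[k := j]) \<noteq> 0"
proof (rule ccontr)
  have uw: "u \<in> tensor_words m n r" using u by (simp add: matrix_unit_op_apply[OF i j] split: if_splits)
  assume "\<not> thesis"
  with that uw have "\<And>k. k < r \<Longrightarrow> u ! k = i \<Longrightarrow> v (u[k := j]) = 0" by blast
  then have "(\<Sum>k<r. if u ! k = i then leading_sign m (parity m i + parity m j) k u * v (u[k := j]) else 0) = 0"
    by (intro sum.neutral) auto
  with u show False by (simp add: matrix_unit_op_apply[OF i j] split: if_splits)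
qed

lemma matrix_unit_op_weight:
  assumes i: "i \<in> {1..m + n}" and j: "j \<in> {1..m + n}" and v: "weight_vector m n r M v"
  shows "weight_vector m n r (add_mset i (M - {#j#})) (matrix_unit_op m n r i j v)"
  unfolding weight_vector_def
proof (intro allI impI)
  fix u assume u: "matrix_unit_op m n r i j v u \<noteq> 0"
  obtain k where uw: "u \<in> tensor_words m n r" and k: "k < r" "u ! k = i" "v (u[k := j]) \<noteq> 0"
    by (rule matrix_unit_op_nonzeroE[OF i j u])
  have l: "length u = r" using uw by (simp add: tensor_words_def)
  have "mset (u[k := j]) = M" using v k by (auto simp: weight_vector_def)
  then have "M = add_mset j (mset u - {#i#})" using k l by (simp add: mset_update)
  moreover have "i \<in># mset u" using k l by auto
  ultimately show "u \<in> tensor_words m n r \<and> mset u = add_mset i (M - {#j#})" using uw by simp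
qed

definition singular_vector :: "nat \<Rightarrow> nat \<Rightarrow> nat \<Rightarrow> nat multiset \<Rightarrow> tensor \<Rightarrow> bool" where
  "singular_vector m n r M v \<longleftrightarrow> v \<noteq> 0 \<and> weight_vector m n r M v \<and>
     (\<forall>i j. i \<in> {1..m + n} \<longrightarrow> j \<in> {1..m + n} \<longrightarrow> i < j \<longrightarrow> matrix_unit_op m n r i j v = 0)"

text \<open>
  Move \<open>E\<^sub>j\<^sub>i\<close> to the other side as \<open>E\<^sub>i\<^sub>j\<close> and apply the supercommutator to reach \<open>E\<^sub>i\<^sub>j v = 0\<close>.
\<close>

lemma tensor_inner_lower:
  assumes "i \<in> {1..m + n}" "j \<in> {1..m + n}" "i < j"
    and "matrix_unit_op m n r i j v = 0"
    and "matrix_unit_op m n r i i v = tscale a v" "matrix_unit_op m n r j j v = tscale b v"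
  shows "tensor_inner m n r (matrix_unit_op m n r j i v) (matrix_unit_op m n r j i v)
    = (a - (-1) ^ (parity m i + parity m j) * b) * tensor_inner m n r v v"
proof -
  have s: "(-1::complex) ^ ((parity m i + parity m j) * (parity m j + parity m i)) = (-1) ^ (parity m i + parity m j)"
    by (auto simp: parity_def)
  have "tensor_inner m n r (matrix_unit_op m n r j i v) (matrix_unit_op m n r j i v)
    = tensor_inner m n r v (matrix_unit_op m n r i j (matrix_unit_op m n r j i v))"
    using assms by (simp add: matrix_unit_op_adjoint)
  also have "matrix_unit_op m n r i j (matrix_unit_op m n r j i v) = tscale a v - tscale ((-1) ^ (parity m i + parity m j) * b) v"
    by (subst matrix_unit_op_commutator) (use assms in \<open>simp_all add: matrix_unit_op_lin tscale_simps s del: plus_fun_apply zero_fun_apply\<close>)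
  finally show ?thesis by (simp only: tensor_inner_lin) (simp add: algebra_simps)
qed

lemma singular_weight_dominant:
  assumes v: "singular_vector m n r M v" and i: "i \<in> {1..m + n}" "Suc i \<in> {1..m + n}" and "i \<noteq> m"
  shows "count M (Suc i) \<le> count M i"
proof -
  have w: "weight_vector m n r M v" "v \<noteq> 0" "matrix_unit_op m n r i (Suc i) v = 0"
    using v i by (auto simp: singular_vector_def)
  have "(-1::complex) ^ (parity m i + parity m (Suc i)) = 1" using \<open>i \<noteq> m\<close> by (auto simp: parity_def)
  with tensor_inner_lower[OF i _ w(3) matrix_unit_op_weight_diag[OF i(1) w(1)] matrix_unit_op_weight_diag[OF i(2) w(1)]]
  have e: "tensor_inner m n r (matrix_unit_op m n r (Suc i) i v) (matrix_unit_op m n r (Suc i) i v)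
    = (of_nat (count M i) - of_nat (count M (Suc i))) * tensor_inner m n r v v" by simp
  have "tensor_inner m n r v v \<noteq> 0" using tensor_inner_self_eq_0 w weight_vector_in_space by blast
  then have pos: "Re (tensor_inner m n r v v) > 0" using tensor_inner_self_nonneg[of m n r v]
    by (metis less_eq_real_def of_real_0)
  have "Re (tensor_inner m n r (matrix_unit_op m n r (Suc i) i v) (matrix_unit_op m n r (Suc i) i v)) \<ge> 0"
    by (rule tensor_inner_self_nonneg)
  then have "(real (count M i) - real (count M (Suc i))) * Re (tensor_inner m n r v v) \<ge> 0"
    unfolding e by (subst (asm) tensor_inner_self_nonneg(1)) (simp del: of_real_Re)
  then show ?thesis using pos by (simp add: zero_le_mult_iff)
qed

text \<open>
  Put \<open>\<alpha> = \<alpha>\<^sub>m\<close> and let \<open>\<beta>\<^sub>j\<close> be the multiplicity of \<open>m + j\<close>. Lowering \<open>v\<close> successively by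
  \<open>E\<^bsub>m+1,m\<^esub>, E\<^bsub>m+2,m\<^esub>, \<dots>\<close> multiplies the square of the norm by \<open>\<alpha> - k + \<beta>\<^bsub>k+1\<^esub>\<close> in step \<open>k\<close>, counted from \<open>0\<close>.
  The first \<open>\<alpha>\<close> of these factors are positive, but \<open>\<alpha> + 1\<close> steps remove the letter \<open>m\<close> more often than it
  occurs and so give zero. Hence the factor \<open>\<beta>\<^bsub>\<alpha>+1\<^esub>\<close> of the last step vanishes.
\<close>

lemma singular_weight_hook:
  assumes v: "singular_vector m n r M v" and m: "m \<ge> 1" and n: "count M m < n"
  shows "count M (m + Suc (count M m)) = 0"
proof (rule ccontr)
  assume nz: "count M (m + Suc (count M m)) \<noteq> 0"
  let ?E = "matrix_unit_op m n r"
  let ?a = "count M m"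
  define w where "w = rec_nat v (\<lambda>k. ?E (m + Suc k) m)"
  have w0: "w 0 = v" and wS: "w (Suc k) = ?E (m + Suc k) m (w k)" for k by (simp_all add: w_def)
  have mm: "m \<in> {1..m + n}" using m by simp
  have mj: "m + j \<in> {1..m + n}" if "j \<le> n" for j using that m by simp
  have pm: "parity m m = 0" and pj: "0 < j \<Longrightarrow> parity m (m + j) = 1" for j by (simp_all add: parity_def)
  have wv: "weight_vector m n r M v" and v0: "v \<noteq> 0" using v by (auto simp: singular_vector_def)
  have main: "(\<forall>j. k < j \<longrightarrow> j \<le> n \<longrightarrow> (\<forall>i<j. ?E (m + i) (m + j) (w k) = 0)) \<and>
     ?E m m (w k) = tscale (of_nat ?a - of_nat k) (w k) \<and>
     (\<forall>j. k < j \<longrightarrow> j \<le> n \<longrightarrow> ?E (m + j) (m + j) (w k) = tscale (of_nat (count M (m + j))) (w k))" if "k \<le> n" for k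
    using that
  proof (induction k)
    case 0
    have "?E (m + i) (m + j) v = 0" if "j \<le> n" "i < j" for i j
      using v mj[of i] mj[of j] that unfolding singular_vector_def by simp
    moreover have "?E m m v = tscale (of_nat ?a) v" by (rule matrix_unit_op_weight_diag[OF mm wv])
    moreover have "?E (m + j) (m + j) v = tscale (of_nat (count M (m + j))) v" if "j \<le> n" for j
      by (rule matrix_unit_op_weight_diag[OF mj[OF that] wv])
    ultimately show ?case unfolding w0 by simp
  next
    case (Suc k)
    then have k: "m + Suc k \<in> {1..m + n}" using mj[of "Suc k"] by simp
    have IH1: "?E (m + i) (m + j) (w k) = 0" if "k < j" "j \<le> n" "i < j" for i j
      using Suc that by auto
    have IH2: "?E m m (w k) = tscale (of_nat ?a - of_nat k) (w k)" using Suc by auto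
    have IH3: "?E (m + j) (m + j) (w k) = tscale (of_nat (count M (m + j))) (w k)" if "k < j" "j \<le> n" for j
      using Suc that by auto
    have "?E (m + i) (m + j) (w (Suc k)) = 0" if j: "Suc k < j" "j \<le> n" and i: "i < j" for i j
    proof -
      have "?E (m + Suc k) (m + j) (w k) = 0" "?E (m + i) (m + j) (w k) = 0"
        using IH1[of j "Suc k"] IH1[of j i] j i by auto
      then show ?thesis unfolding wS using j i
        by (subst matrix_unit_op_commutator[OF mj mj k mm])
           (simp_all add: matrix_unit_op_lin tscale_simps del: plus_fun_apply zero_fun_apply)
    qed
    moreover have "?E m m (w (Suc k)) = tscale (of_nat ?a - of_nat (Suc k)) (w (Suc k))"
      unfolding wS
      by (subst matrix_unit_op_commutator[OF mm mm k mm])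
         (simp add: pm IH2 matrix_unit_op_lin tscale_simps del: plus_fun_apply zero_fun_apply,
          simp add: tscale_def fun_eq_iff algebra_simps)
    moreover have "?E (m + j) (m + j) (w (Suc k)) = tscale (of_nat (count M (m + j))) (w (Suc k))"
      if j: "Suc k < j" "j \<le> n" for j
      unfolding wS using j
      by (subst matrix_unit_op_commutator[OF mj mj k mm])
         (simp_all add: pj IH3 matrix_unit_op_lin tscale_simps del: plus_fun_apply zero_fun_apply)
    ultimately show ?case by blast
  qed
  have norm: "tensor_inner m n r (w (Suc k)) (w (Suc k))
      = (of_nat ?a - of_nat k + of_nat (count M (m + Suc k))) * tensor_inner m n r (w k) (w k)" if "Suc k \<le> n" for k
  proof -
    have "?E (m + 0) (m + Suc k) (w k) = 0"
      "?E m m (w k) = tscale (of_nat ?a - of_nat k) (w k)"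
      "?E (m + Suc k) (m + Suc k) (w k) = tscale (of_nat (count M (m + Suc k))) (w k)"
      using main[of k] that by (blast intro: Suc_leD lessI zero_less_Suc)+
    with tensor_inner_lower[OF mm mj[OF that]] show ?thesis
      unfolding wS by (simp add: parity_def)
  qed
  have "tensor_inner m n r (w k) (w k) \<noteq> 0" if "k \<le> Suc ?a" for k
    using that
  proof (induction k)
    case 0
    then show ?case using tensor_inner_self_eq_0 weight_vector_in_space[OF wv] v0 w0 by metis
  next
    case (Suc k)
    have "of_nat ?a - of_nat k + of_nat (count M (m + Suc k)) = (of_nat (?a - k + count M (m + Suc k)) :: complex)"
      using Suc.prems by (simp add: of_nat_diff)
    moreover have "?a - k + count M (m + Suc k) \<noteq> 0" using nz Suc.prems by (cases "k = ?a") auto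
    ultimately have "of_nat ?a - of_nat k + of_nat (count M (m + Suc k)) \<noteq> (0 :: complex)"
      by (simp only: of_nat_eq_0_iff) simp
    then show ?case using norm[of k] Suc n by simp
  qed
  then have ne: "tensor_inner m n r (w (Suc ?a)) (w (Suc ?a)) \<noteq> 0" by simp
  have "w (Suc ?a) u = 0" if "u \<in> tensor_words m n r" for u
  proof -
    have "?E m m (w (Suc ?a)) = tscale (-1) (w (Suc ?a))"
      using main[of "Suc ?a"] n by simp
    from fun_cong[OF this, of u] have "of_nat (count (mset u) m + 1) * w (Suc ?a) u = 0"
      using that by (simp add: matrix_unit_op_diag[OF mm] tscale_def algebra_simps)
    then show ?thesis by (simp only: mult_eq_0_iff of_nat_eq_0_iff) simp
  qed
  then have "tensor_inner m n r (w (Suc ?a)) (w (Suc ?a)) = 0" by (simp add: tensor_inner_def)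
  with ne show False ..
qed

text \<open>
  The vectors obtained from \<open>v\<close> by lowering operators. If \<open>v\<close> is singular, this is already stable under
  all matrix units, and its part of the weight of \<open>v\<close> consists of the multiples of \<open>v\<close>.
\<close>

inductive_set lowering_span :: "nat \<Rightarrow> nat \<Rightarrow> nat \<Rightarrow> tensor \<Rightarrow> tensor set" for m n r v where
  base: "v \<in> lowering_span m n r v"
| lower: "x \<in> lowering_span m n r v \<Longrightarrow> i \<in> {1..m + n} \<Longrightarrow> j \<in> {1..m + n} \<Longrightarrow> j < i \<Longrightarrow>
    matrix_unit_op m n r i j x \<in> lowering_span m n r v"
| add: "x \<in> lowering_span m n r v \<Longrightarrow> y \<in> lowering_span m n r v \<Longrightarrow> x + y \<in> lowering_span m n r v"
| scale: "x \<in> lowering_span m n r v \<Longrightarrow> tscale c x \<in> lowering_span m n r v"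

lemma lowering_span_closed:
  assumes v: "singular_vector m n r M v" and x: "x \<in> lowering_span m n r v"
    and k: "k \<in> {1..m + n}" and l: "l \<in> {1..m + n}"
  shows "matrix_unit_op m n r k l x \<in> lowering_span m n r v"
  using x k l
proof (induction arbitrary: k l rule: lowering_span.induct)
  case base
  have z: "0 \<in> lowering_span m n r v" using lowering_span.scale[OF lowering_span.base, of 0] by (simp add: tscale_simps del: zero_fun_apply)
  consider "k < l" | "k = l" | "l < k" by linarith
  then show ?case
  proof cases
    case 1
    then have "matrix_unit_op m n r k l v = 0" using v base by (simp add: singular_vector_def)
    then show ?thesis using z by (simp only:)
  next
    case 2
    have "matrix_unit_op m n r l l v = tscale (of_nat (count M l)) v"
      using v base by (intro matrix_unit_op_weight_diag) (auto simp: singular_vector_def)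
    then show ?thesis using 2 by (simp add: lowering_span.intros)
  next
    case 3
    then show ?thesis using base by (intro lowering_span.intros)
  qed
next
  case (lower x i j)
  let ?s = "(-1) ^ ((parity m k + parity m l) * (parity m i + parity m j)) :: complex"
  have z: "0 \<in> lowering_span m n r v" using lowering_span.scale[OF lowering_span.base, of 0] by (simp add: tscale_simps del: zero_fun_apply)
  have d: "x - tscale c y \<in> lowering_span m n r v" if "x \<in> lowering_span m n r v" "y \<in> lowering_span m n r v" for c x y
    using lowering_span.add[OF that(1) lowering_span.scale[OF that(2), of "- c"]] by (simp add: tscale_simps)
  have if_in: "(if b then x else 0) \<in> lowering_span m n r v" if "x \<in> lowering_span m n r v" for b x
    using that z by (cases b) simp_all
  show ?case
    by (subst matrix_unit_op_commutator[OF lower.prems lower.hyps(2,3)])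
       (intro lowering_span.add lowering_span.scale d if_in lowering_span.lower lower.IH lower.prems lower.hyps)
next
  case (add x y)
  then show ?case by (simp add: matrix_unit_op_lin lowering_span.intros del: plus_fun_apply)
next
  case (scale x c)
  then show ?case by (simp add: matrix_unit_op_lin lowering_span.intros)
qed

text \<open>
  Lowering increases the sum of the letters, so only the multiples of \<open>v\<close> itself contribute to words
  whose sum is at most that of the weight.
\<close>

lemma lowering_span_leading:
  assumes v: "weight_vector m n r M v" and x: "x \<in> lowering_span m n r v"
  shows "\<exists>c. \<forall>u. sum_list u \<le> sum_mset M \<longrightarrow> x u = c * v u"
  using x
proof (induction rule: lowering_span.induct)
  case base
  show ?case by (intro exI[of _ 1]) simp
next
  case (lower x i j)
  then obtain c where c: "\<And>u. sum_list u \<le> sum_mset M \<Longrightarrow> x u = c * v u" by blast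
  show ?case
  proof (intro exI[of _ 0] allI impI)
    fix u :: "nat list" assume u: "sum_list u \<le> sum_mset M"
    have "x (u[k := j]) = 0" if "k < length u" "u ! k = i" for k
    proof -
      have "u ! k \<le> sum_list u" using that elem_le_sum_list by blast
      then have "sum_list (u[k := j]) < sum_list u" using that lower.hyps by (simp add: sum_list_update)
      then have "sum_list (u[k := j]) < sum_mset M" "x (u[k := j]) = c * v (u[k := j])" using u c by auto
      moreover have "v (u[k := j]) = 0"
      proof (rule ccontr)
        assume "v (u[k := j]) \<noteq> 0"
        then have "sum_list (u[k := j]) = sum_mset M" using v by (simp add: weight_vector_def flip: sum_mset_sum_list)
        with \<open>sum_list (u[k := j]) < sum_mset M\<close> show False by simp
      qed
      ultimately show ?thesis by simp
    qed
    then show "matrix_unit_op m n r i j x u = 0 * v u"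
      by (auto simp: matrix_unit_op_apply[OF lower.hyps(2,3)] tensor_words_def intro!: sum.neutral)
  qed
next
  case (add x y)
  then obtain c d where "\<And>u. sum_list u \<le> sum_mset M \<Longrightarrow> x u = c * v u" "\<And>u. sum_list u \<le> sum_mset M \<Longrightarrow> y u = d * v u"
    by blast
  then show ?case by (intro exI[of _ "c + d"]) (simp add: distrib_right)
next
  case (scale x a)
  then obtain c where "\<And>u. sum_list u \<le> sum_mset M \<Longrightarrow> x u = c * v u" by blast
  then show ?case by (intro exI[of _ "a * c"]) (simp add: tscale_def)
qed

lemma schur_in_lowering_span:
  assumes v: "singular_vector m n r M v" and T: "T \<in> schur_superalgebra m n r"
  shows "T v \<in> lowering_span m n r v"
  using T
proof (induction rule: schur_superalgebra_induct)
  case one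
  have "tensor_id m n r v = v"
    using v by (auto simp: tensor_id_apply singular_vector_def weight_vector_def fun_eq_iff)
  then show ?case by (simp add: lowering_span.base)
next
  case (unit i j T)
  then show ?case by (simp add: lowering_span_closed[OF v])
next
  case (add S T)
  then show ?case using lowering_span.add by (metis plus_fun_def)
next
  case (scale c T)
  then show ?case by (simp add: opscale_def lowering_span.scale)
qed

context
  fixes m n r :: nat and z :: tensor_op
  assumes z: "z \<in> op_center (schur_superalgebra m n r)"
begin

lemma center_commute:
  assumes "i \<in> {1..m + n}" "j \<in> {1..m + n}"
  shows "z (matrix_unit_op m n r i j v) = matrix_unit_op m n r i j (z v)"
  using z matrix_unit_op_in_schur[OF assms, of r] by (auto simp: op_center_def fun_eq_iff)

lemma center_linear:
  "z (u + v) = z u + z v" "z (tscale c v) = tscale c (z v)" "z 0 = 0" "z v \<in> tensor_space m n r"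
  "z (sum g A) = (\<Sum>x\<in>A. z (g x))"
proof -
  have "z \<in> schur_superalgebra m n r" using z by (simp add: op_center_def)
  then obtain f where f: "z = lin_ext m n r f"
    "\<And>w u. w \<in> tensor_words m n r \<Longrightarrow> u \<notin> tensor_words m n r \<Longrightarrow> f w u = 0"
    using schur_superalgebra_linear by metis
  show "z (u + v) = z u + z v" "z (tscale c v) = tscale c (z v)" "z 0 = 0"
    "z (sum g A) = (\<Sum>x\<in>A. z (g x))"
    by (simp_all add: f(1) lin_ext_lin lin_ext_sum del: plus_fun_apply zero_fun_apply)
  show "z v \<in> tensor_space m n r"
    using f(2) by (simp add: f(1) tensor_space_def lin_ext_def sum_fun_apply tscale_def)
qed

lemma center_weight:
  assumes v: "weight_vector m n r M v" and M: "set_mset M \<subseteq> {1..m + n}"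
  shows "weight_vector m n r M (z v)"
  by (rule weight_vector_of_diag[OF center_linear(4) M])
     (simp add: center_commute[symmetric] matrix_unit_op_weight_diag[OF _ v] center_linear(2))

text \<open>
  The image lies in the span obtained by lowering \<open>v\<close> and has the weight of \<open>v\<close>, so it is a multiple of \<open>v\<close>.
\<close>

lemma center_scalar:
  assumes v: "singular_vector m n r M v"
  shows "\<exists>c. z v = tscale c v"
proof -
  have w: "weight_vector m n r M v" "v \<noteq> 0" using v by (auto simp: singular_vector_def)
  have "z v \<in> lowering_span m n r v" using z schur_in_lowering_span[OF v] by (simp add: op_center_def)
  from lowering_span_leading[OF w(1) this] obtain c where c: "\<And>u. sum_list u \<le> sum_mset M \<Longrightarrow> z v u = c * v u" by blast
  have wz: "weight_vector m n r M (z v)" by (rule center_weight[OF w(1)]) (rule weight_vector_iff(1)[OF w(2,1)])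
  have "z v u = c * v u" for u
  proof (cases "mset u = M")
    case True
    then have "sum_list u = sum_mset M" by (metis sum_mset_sum_list)
    then show ?thesis using c by simp
  next
    case False
    then have "z v u = 0" "v u = 0" using wz w(1) by (auto simp: weight_vector_def)
    then show ?thesis by simp
  qed
  then show ?thesis by (intro exI[of _ c]) (simp add: tscale_def fun_eq_iff)
qed

text \<open>
  The adjoint of \<open>z\<close>, given by its coefficients in the orthonormal basis.
\<close>

definition adjoint_op :: tensor_op where
  "adjoint_op y = (\<lambda>u. if u \<in> tensor_words m n r then tensor_inner m n r (z (basis_tensor u)) y else 0)"

lemma adjoint_op_inner:
  assumes v: "v \<in> tensor_space m n r"
  shows "tensor_inner m n r (adjoint_op y) v = tensor_inner m n r y (z v)"
proof -
  have "tensor_inner m n r y (z v) = tensor_inner m n r y (z (\<Sum>u\<in>tensor_words m n r. tscale (v u) (basis_tensor u)))"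
    using tensor_expand[OF v] by simp
  also have "\<dots> = (\<Sum>u\<in>tensor_words m n r. v u * tensor_inner m n r y (z (basis_tensor u)))"
    by (simp add: center_linear tensor_inner_sum tensor_inner_lin)
  also have "\<dots> = tensor_inner m n r (adjoint_op y) v"
    unfolding tensor_inner_def[of m n r "adjoint_op y" v]
    by (rule sum.cong) (simp_all add: adjoint_op_def tensor_inner_cnj mult.commute)
  finally show ?thesis ..
qed

lemma adjoint_op_space: "adjoint_op y \<in> tensor_space m n r"
  by (simp add: adjoint_op_def tensor_space_def)

lemma adjoint_op_commute:
  assumes i: "i \<in> {1..m + n}" and j: "j \<in> {1..m + n}"
  shows "adjoint_op (matrix_unit_op m n r i j y) = matrix_unit_op m n r i j (adjoint_op y)"
  by (rule tensor_inner_separates[OF adjoint_op_space matrix_unit_op_in_space[OF i j]])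
     (simp add: adjoint_op_inner matrix_unit_op_adjoint[OF i j] center_commute[OF j i] matrix_unit_op_in_space[OF j i])

lemma adjoint_op_scale: "adjoint_op (tscale c y) = tscale c (adjoint_op y)"
  unfolding tscale_def[of c "adjoint_op y"] by (simp add: adjoint_op_def fun_eq_iff tensor_inner_lin)

text \<open>
  The adjoint of \<open>z\<close> commutes with the matrix units as well. If it were nonzero, its value at a weight
  vector of least letter sum with nonzero image would be singular, because raising lowers the letter
  sum. This value \<open>z\<^sup>* y\<close> would be annihilated by \<open>z\<close>, hence would have norm zero.
\<close>

lemma center_eq_0:
  assumes kill: "\<And>M v. singular_vector m n r M v \<Longrightarrow> z v = 0"
  shows "z = 0"
proof -
  define Q where "Q = (\<lambda>M. \<exists>y. weight_vector m n r M y \<and> adjoint_op y \<noteq> 0)"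
  have noQ: "\<not> Q M" for M
  proof (induction "sum_mset M" arbitrary: M rule: less_induct)
    case less
    show ?case
    proof
      assume "Q M"
      then obtain y where y: "weight_vector m n r M y" "adjoint_op y \<noteq> 0" by (auto simp: Q_def)
      have y0: "y \<noteq> 0" using y(2) by (auto simp: adjoint_op_def tensor_inner_lin)
      note M = weight_vector_iff[OF y0 y(1)]
      have w: "weight_vector m n r M (adjoint_op y)"
        by (rule weight_vector_of_diag[OF adjoint_op_space M(1)])
           (simp add: adjoint_op_commute[symmetric] matrix_unit_op_weight_diag[OF _ y(1)] adjoint_op_scale)
      have "matrix_unit_op m n r i j (adjoint_op y) = 0" if ij: "i \<in> {1..m + n}" "j \<in> {1..m + n}" "i < j" for i j
      proof (cases "j \<in># M")
        case True
        then have "sum_mset M = j + sum_mset (M - {#j#})" by (metis insert_DiffM sum_mset.add_mset)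
        then have "sum_mset (add_mset i (M - {#j#})) < sum_mset M" using ij(3) by simp
        from less[OF this] matrix_unit_op_weight[OF ij(1,2) y(1)]
        have "adjoint_op (matrix_unit_op m n r i j y) = 0" by (auto simp: Q_def)
        then show ?thesis unfolding adjoint_op_commute[OF ij(1,2)] .
      next
        case False
        have "matrix_unit_op m n r i j (adjoint_op y) u = 0" for u
        proof (rule ccontr)
          assume nz: "matrix_unit_op m n r i j (adjoint_op y) u \<noteq> 0"
          obtain k where k: "u \<in> tensor_words m n r" "k < r" "u ! k = i" "adjoint_op y (u[k := j]) \<noteq> 0"
            by (rule matrix_unit_op_nonzeroE[OF ij(1,2) nz])
          then have "mset (u[k := j]) = M" using w unfolding weight_vector_def by blast
          moreover have "j \<in> set (u[k := j])" using k by (intro set_update_memI) (simp add: tensor_words_def)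
          ultimately show False using False by (metis set_mset_mset)
        qed
        then show ?thesis by (simp add: fun_eq_iff)
      qed
      then have "singular_vector m n r M (adjoint_op y)" using y(2) w by (simp add: singular_vector_def)
      from kill[OF this] have "tensor_inner m n r (adjoint_op y) (adjoint_op y) = 0"
        by (simp add: adjoint_op_inner adjoint_op_space tensor_inner_lin)
      then show False using tensor_inner_self_eq_0[OF adjoint_op_space] y(2) by blast
    qed
  qed
  have zb: "z (basis_tensor w) = 0" if w: "w \<in> tensor_words m n r" for w
  proof (rule tensor_inner_self_eq_0[OF center_linear(4)])
    have "tensor_inner m n r u (z (basis_tensor w)) = 0" if u: "u \<in> tensor_space m n r" for u
    proof -
      have "tensor_inner m n r (z (basis_tensor w)) u
         = (\<Sum>x\<in>tensor_words m n r. u x * tensor_inner m n r (z (basis_tensor w)) (basis_tensor x))"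
        by (subst (1) tensor_expand[OF u]) (simp only: tensor_inner_lin(3) tensor_inner_sum)
      also have "\<dots> = 0"
      proof (rule sum.neutral, rule ballI)
        fix x assume "x \<in> tensor_words m n r"
        then have "weight_vector m n r (mset x) (basis_tensor x)" by (simp add: weight_vector_def basis_tensor_def)
        with noQ[of "mset x"] have "adjoint_op (basis_tensor x) = 0" by (auto simp: Q_def)
        moreover have "basis_tensor w \<in> tensor_space m n r" using w by (auto simp: tensor_space_def basis_tensor_def)
        ultimately have "tensor_inner m n r (basis_tensor x) (z (basis_tensor w)) = 0"
          using adjoint_op_inner[of "basis_tensor w" "basis_tensor x"] by (simp add: tensor_inner_def)
        then have "tensor_inner m n r (z (basis_tensor w)) (basis_tensor x) = 0"
          by (metis tensor_inner_cnj complex_cnj_zero)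
        then show "u x * tensor_inner m n r (z (basis_tensor w)) (basis_tensor x) = 0" by simp
      qed
      finally show ?thesis by (metis tensor_inner_cnj complex_cnj_zero)
    qed
    then show "tensor_inner m n r (z (basis_tensor w)) (z (basis_tensor w)) = 0"
      using center_linear(4) by blast
  qed
  have "z \<in> schur_superalgebra m n r" using z by (simp add: op_center_def)
  then obtain f where f: "z = lin_ext m n r f" using schur_superalgebra_linear by metis
  have "z = lin_ext m n r (\<lambda>w. 0)"
    unfolding f by (rule lin_ext_cong) (use zb in \<open>simp add: f lin_ext_basis\<close>)
  then show ?thesis by (simp only: lin_ext_zero)
qed

text \<open>
  The scalar only depends on the weight: \<open>v\<close>, \<open>v'\<close> and \<open>v + v'\<close> are eigenvectors of \<open>z\<close>.
\<close>

lemma center_kill_weight: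
  assumes v: "singular_vector m n r M v" and zv: "z v = 0" and v': "singular_vector m n r M v'"
  shows "z v' = 0"
proof -
  obtain c' where c': "z v' = tscale c' v'" using center_scalar[OF v'] by blast
  have z0: "tscale 0 x = 0" "tscale c 0 = 0" for x c by (simp_all add: tscale_simps)
  show ?thesis
  proof (cases "v + v' = 0")
    case True
    then have "z v + z v' = 0" by (simp only: center_linear(1)[symmetric] center_linear(3))
    then show ?thesis by (simp add: zv)
  next
    case False
    have "weight_vector m n r M (v + v')"
      using v v' unfolding singular_vector_def weight_vector_def plus_fun_apply by (metis add.right_neutral)
    then have "singular_vector m n r M (v + v')"
      using v v' False by (simp add: singular_vector_def matrix_unit_op_lin del: plus_fun_apply zero_fun_apply)
    then obtain c where c: "z (v + v') = tscale c (v + v')" using center_scalar by blast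
    then have "tscale c' v' = tscale c (v + v')" by (simp only: center_linear(1) zv c') simp
    then have e: "(c' - c) * v' u = c * v u" for u by (auto simp: tscale_def fun_eq_iff algebra_simps dest: spec[of _ u])
    show ?thesis
    proof (cases "c' = c")
      case True
      obtain u where "v u \<noteq> 0" using v by (auto simp: singular_vector_def fun_eq_iff)
      then have "c = 0" using e[of u] True by simp
      then show ?thesis using c' True by (simp add: z0)
    next
      case False
      then have "v' = tscale (c / (c' - c)) v"
        using e by (auto simp: fun_eq_iff tscale_def field_simps)
      then show ?thesis by (simp add: center_linear(2) zv z0)
    qed
  qed
qed

end

section \<open>Singular weights and hook partitions\<close>

lemma down_set_nat:
  assumes "finite A" "\<And>x y. x \<in> A \<Longrightarrow> y \<le> x \<Longrightarrow> y \<in> (A :: nat set)"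
  shows "A = {..<card A}"
proof -
  have "\<exists>k. A = {..<k}"
  proof (cases "A = {}")
    case False
    have "x \<in> A \<longleftrightarrow> x \<le> Max A" for x
      using assms(2)[OF Max_in[OF assms(1) False]] Max_ge[OF assms(1)] by blast
    then have "A = {..<Suc (Max A)}" by (simp add: set_eq_iff less_Suc_eq_le)
    then show ?thesis by blast
  qed auto
  then show ?thesis by auto
qed

definition down_closed :: "(nat \<times> nat) set \<Rightarrow> bool" where
  "down_closed D \<longleftrightarrow> finite D \<and> (\<forall>i j i' j'. (i, j) \<in> D \<longrightarrow> i' \<le> i \<longrightarrow> j' \<le> j \<longrightarrow> (i', j') \<in> D)"

text \<open>
  The row lengths of a Young diagram, given as its set of boxes \<open>(row, column)\<close> counted from \<open>0\<close>.
\<close>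

definition diagram_partition :: "(nat \<times> nat) set \<Rightarrow> nat list" where
  "diagram_partition D = map (\<lambda>i. card {j. (i, j) \<in> D}) [0..<card {i. (i, 0) \<in> D}]"

lemma diagram_partition_iff:
  assumes "down_closed D"
  shows "(i, j) \<in> D \<longleftrightarrow> i < length (diagram_partition D) \<and> j < diagram_partition D ! i"
proof -
  have fin: "finite D" using assms by (simp add: down_closed_def)
  have f1: "finite {j. (i, j) \<in> D}" for i
    by (rule finite_subset[OF _ finite_imageI[OF fin, of snd]]) force
  have f2: "finite {i. (i, 0) \<in> D}"
    by (rule finite_subset[OF _ finite_imageI[OF fin, of fst]]) force
  have 1: "{j. (i, j) \<in> D} = {..<card {j. (i, j) \<in> D}}" for i
    by (rule down_set_nat[OF f1]) (use assms in \<open>auto simp: down_closed_def\<close>)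
  have 2: "{i. (i, 0) \<in> D} = {..<card {i. (i, 0) \<in> D}}"
    by (rule down_set_nat[OF f2]) (use assms in \<open>auto simp: down_closed_def\<close>)
  have 3: "(i, j) \<in> D \<longleftrightarrow> j < card {j. (i, j) \<in> D}" using 1[of i] by blast
  have 4: "(i, 0) \<in> D \<longleftrightarrow> i < card {i. (i, 0) \<in> D}" using 2 by blast
  have 5: "(i, j) \<in> D \<Longrightarrow> (i, 0) \<in> D" using assms by (auto simp: down_closed_def)
  show ?thesis using 3 4 5 by (auto simp: diagram_partition_def)
qed

text \<open>
  The condition on the part number \<open>a + 1\<close> says that the box \<open>(a, b)\<close> is missing.
\<close>

lemma diagram_partition_hook:
  assumes D: "down_closed D" and "(a, b) \<notin> D"
  shows "diagram_partition D \<in> hook_partitions a b (card D)"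
proof -
  let ?p = "diagram_partition D"
  note iff = diagram_partition_iff[OF D]
  have "D = Sigma {..<length ?p} (\<lambda>i. {..<?p ! i})" using iff by auto
  then have "card D = (\<Sum>i<length ?p. ?p ! i)" by (metis (no_types, lifting) card_SigmaI card_lessThan finite_lessThan sum.cong)
  then have "sum_list ?p = card D" by (simp add: sum_list_sum_nth atLeast0LessThan)
  moreover have "0 \<notin> set ?p"
  proof
    assume "0 \<in> set ?p"
    then obtain i where i: "i < length ?p" "?p ! i = 0" by (auto simp: in_set_conv_nth)
    then have "(i, 0) \<notin> D" using iff by simp
    moreover have "\<exists>k. (k, 0) \<in> D \<and> i \<le> k"
    proof -
      have f2: "finite {i. (i, 0) \<in> D}"
        using D by (intro finite_subset[OF _ finite_imageI[of D fst]]) (force simp: down_closed_def)+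
      have "{i. (i, 0) \<in> D} = {..<card {i. (i, 0) \<in> D}}"
        by (rule down_set_nat[OF f2]) (use D in \<open>auto simp: down_closed_def\<close>)
      moreover have "i < card {i. (i, 0) \<in> D}" using i by (simp add: diagram_partition_def)
      ultimately show ?thesis by blast
    qed
    ultimately show False using D by (auto simp: down_closed_def)
  qed
  moreover have "sorted_wrt (\<ge>) ?p"
    unfolding sorted_wrt_iff_nth_less
  proof (intro allI impI)
    fix i j assume ij: "i < j" "j < length ?p"
    show "?p ! j \<le> ?p ! i"
    proof (rule ccontr)
      assume "\<not> ?thesis"
      then have "(j, ?p ! i) \<in> D" "(i, ?p ! i) \<notin> D" using iff ij by auto
      then show False using D ij unfolding down_closed_def by (meson less_imp_le order_refl)
    qed
  qed
  moreover have "(if a < length ?p then ?p ! a else 0) \<le> b" using iff[of a b] assms(2) by auto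
  ultimately show ?thesis by (simp add: hook_partitions_def)
qed

lemma finite_hook_partitions: "finite (hook_partitions a b r)"
proof (rule finite_subset[OF _ finite_lists_length_le[of "{..r}" r]])
  show "hook_partitions a b r \<subseteq> {xs. set xs \<subseteq> {..r} \<and> length xs \<le> r}"
  proof (rule subsetI)
    fix p assume p: "p \<in> hook_partitions a b r"
    have "set p \<subseteq> {..r}" using p member_le_sum_list by (auto simp: hook_partitions_def)
    moreover have "0 \<notin> set p \<Longrightarrow> length p \<le> sum_list p" by (induction p) auto
    ultimately show "p \<in> {xs. set xs \<subseteq> {..r} \<and> length xs \<le> r}" using p by (auto simp: hook_partitions_def)
  qed
qed simp

text \<open>
  The first \<open>m\<close> rows have lengths \<open>\<alpha>\<^sub>1, \<dots>, \<alpha>\<^sub>m\<close>; the columns of lengths \<open>\<beta>\<^sub>1, \<dots>, \<beta>\<^sub>n\<close> hang below them.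
\<close>

definition weight_diagram :: "nat \<Rightarrow> nat \<Rightarrow> nat multiset \<Rightarrow> (nat \<times> nat) set" where
  "weight_diagram m n M = {(i, j). i < m \<and> j < count M (Suc i) \<or> m \<le> i \<and> j < n \<and> i - m < count M (m + Suc j)}"

lemma weight_diagram_card:
  assumes "set_mset M \<subseteq> {1..m + n}"
  shows "finite (weight_diagram m n M)" "card (weight_diagram m n M) = size M"
proof -
  let ?A = "Sigma {..<m} (\<lambda>i. {..<count M (Suc i)})"
  let ?B = "Sigma {..<n} (\<lambda>j. {..<count M (m + Suc j)})"
  let ?f = "\<lambda>(j, i). (m + i, j)"
  have e: "weight_diagram m n M = ?A \<union> ?f ` ?B"
  proof (intro equalityI subsetI)
    fix x assume "x \<in> weight_diagram m n M"
    then consider "x \<in> ?A" | "m \<le> fst x" "(snd x, fst x - m) \<in> ?B"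
      by (cases x) (auto simp: weight_diagram_def)
    then show "x \<in> ?A \<union> ?f ` ?B"
    proof cases
      case 2
      then have "x = ?f (snd x, fst x - m)" by simp
      then show ?thesis using 2(2) by blast
    qed simp
  qed (auto simp: weight_diagram_def)
  have inj: "inj_on ?f ?B" by (auto simp: inj_on_def)
  show "finite (weight_diagram m n M)" unfolding e by auto
  have "card (weight_diagram m n M) = card ?A + card (?f ` ?B)"
    unfolding e by (rule card_Un_disjoint) auto
  also have "\<dots> = (\<Sum>i<m. count M (Suc i)) + (\<Sum>j<n. count M (m + Suc j))"
    unfolding card_image[OF inj] by simp
  also have "\<dots> = (\<Sum>i<m + n. count M (Suc i))"
    by (induction n) (simp_all)
  also have "\<dots> = (\<Sum>i\<in>{1..m + n}. count M i)"
    by (rule sum.reindex_bij_witness[of _ "\<lambda>i. i - 1" Suc]) auto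
  also have "\<dots> = size M"
    unfolding size_multiset_overloaded_eq
    by (rule sum.mono_neutral_right) (use assms in \<open>auto simp: not_in_iff\<close>)
  finally show "card (weight_diagram m n M) = size M" .
qed

lemma weight_diagram_inj:
  assumes "set_mset M \<subseteq> {1..m + n}" "set_mset M' \<subseteq> {1..m + n}" "weight_diagram m n M = weight_diagram m n M'"
  shows "M = M'"
proof (rule multiset_eqI)
  fix x
  have lt: "a = b" if "\<And>k. k < a \<longleftrightarrow> k < b" for a b :: nat using that by (metis nat_neq_iff)
  consider "x = 0" | "1 \<le> x" "x \<le> m" | "m < x" "x \<le> m + n" | "x > m + n" by linarith
  then show "count M x = count M' x"
  proof cases
    case 2
    have "Suc (x - 1) = x" "x - 1 < m" using 2 by auto
    then have "k < count N x \<longleftrightarrow> (x - 1, k) \<in> weight_diagram m n N" for k N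
      by (simp add: weight_diagram_def del: One_nat_def)
    then show ?thesis using assms(3) by (intro lt) simp
  next
    case 3
    have "m + Suc (x - m - 1) = x" "x - m - 1 < n" using 3 by auto
    then have "k < count N x \<longleftrightarrow> (m + k, x - m - 1) \<in> weight_diagram m n N" for k N
      by (simp add: weight_diagram_def del: add_Suc_right)
    then show ?thesis using assms(3) by (intro lt) simp
  next
    case 1
    then have "x \<notin># M" "x \<notin># M'" using assms by auto
    then show ?thesis by (simp add: not_in_iff)
  next
    case 4
    then have "x \<notin># M" "x \<notin># M'" using assms by auto
    then show ?thesis by (simp add: not_in_iff)
  qed
qed

lemma antitone_chain:
  assumes "\<And>k. l \<le> k \<Longrightarrow> Suc k \<le> u \<Longrightarrow> f (Suc k) \<le> (f k :: nat)" and "l \<le> i" "i \<le> j" "j \<le> u"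
  shows "f j \<le> f i"
  using assms(3,4)
proof (induction rule: dec_induct)
  case (step k)
  then show ?case using assms(1)[of k] assms(2) by simp
qed simp

lemma singular_weight:
  assumes "singular_vector m n r M v"
  shows "set_mset M \<subseteq> {1..m + n}" "size M = r"
  using assms weight_vector_iff[of v m n r M] by (simp_all add: singular_vector_def)

text \<open>
  Dominance makes the rows and the columns decrease. A column \<open>j\<close> that is not empty needs row \<open>m - 1\<close> to
  reach over it, which is the bound on the number of nonzero \<open>\<beta>\<^sub>j\<close>.
\<close>

lemma weight_diagram_down_closed:
  assumes v: "singular_vector m n r M v" and m: "m \<ge> 1"
  shows "down_closed (weight_diagram m n M)" "(m, n) \<notin> weight_diagram m n M"
proof -
  have fin: "finite (weight_diagram m n M)" by (rule weight_diagram_card[OF singular_weight(1)[OF v]])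
  have dom: "count M j \<le> count M i" if "i \<le> j" "1 \<le> i" "j \<le> m + n" "j \<le> m \<or> m < i" for i j
  proof (rule antitone_chain[where f = "count M" and l = i and u = j])
    fix k assume "i \<le> k" "Suc k \<le> j"
    then show "count M (Suc k) \<le> count M k"
      using that by (intro singular_weight_dominant[OF v]) auto
  qed (use that in auto)
  show "(m, n) \<notin> weight_diagram m n M" by (simp add: weight_diagram_def)
  show "down_closed (weight_diagram m n M)"
    unfolding down_closed_def
  proof (intro conjI fin allI impI)
    fix i j i' j' assume D: "(i, j) \<in> weight_diagram m n M" and le: "i' \<le> i" "j' \<le> j"
    show "(i', j') \<in> weight_diagram m n M"
    proof (cases "i < m")
      case True
      then have "j < count M (Suc i)" using D by (simp add: weight_diagram_def)
      moreover have "count M (Suc i) \<le> count M (Suc i')" using True le by (intro dom) auto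
      ultimately show ?thesis using True le by (simp add: weight_diagram_def)
    next
      case False
      then have j: "j < n" "i - m < count M (m + Suc j)" using D by (auto simp: weight_diagram_def)
      have b: "count M (m + Suc j) \<le> count M (m + Suc j')" using j le by (intro dom) auto
      show ?thesis
      proof (cases "i' < m")
        case True
        have "j < count M m"
        proof (rule ccontr)
          assume "\<not> ?thesis"
          then have c: "count M m \<le> j" "count M m < n" using j by auto
          have "count M (m + Suc (count M m)) = 0" by (rule singular_weight_hook[OF v m c(2)])
          moreover have "count M (m + Suc j) \<le> count M (m + Suc (count M m))"
            using c j by (intro dom) auto
          ultimately show False using j by simp
        qed
        moreover have "count M m \<le> count M (Suc i')" using True by (intro dom) auto
        ultimately show ?thesis using True le by (simp add: weight_diagram_def)
      next
        case False
        then show ?thesis using j b le by (auto simp: weight_diagram_def)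
      qed
    qed
  qed
qed

definition singular_weights :: "nat \<Rightarrow> nat \<Rightarrow> nat \<Rightarrow> nat multiset set" where
  "singular_weights m n r = {M. \<exists>v. singular_vector m n r M v}"

text \<open>
  Sending a weight to the partition of its diagram is injective. For \<open>m > n\<close> the diagram is transposed,
  as hook partitions are defined with the smaller number bounding the rows.
\<close>

lemma singular_weights_card:
  assumes m: "m \<ge> 1"
  shows "finite (singular_weights m n r)" "card (singular_weights m n r) \<le> card (hook_partitions_vee m n r)"
proof -
  define F where "F = (\<lambda>M. diagram_partition (if m \<le> n then weight_diagram m n M else prod.swap ` weight_diagram m n M))"
  have D: "down_closed (weight_diagram m n M)" "(m, n) \<notin> weight_diagram m n M"
    "set_mset M \<subseteq> {1..m + n}" "card (weight_diagram m n M) = r" if M: "M \<in> singular_weights m n r" for M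
  proof -
    obtain v where v: "singular_vector m n r M v" using M by (auto simp: singular_weights_def)
    show "down_closed (weight_diagram m n M)" "(m, n) \<notin> weight_diagram m n M"
      by (rule weight_diagram_down_closed[OF v m])+
    show s: "set_mset M \<subseteq> {1..m + n}" by (rule singular_weight(1)[OF v])
    show "card (weight_diagram m n M) = r"
      using weight_diagram_card(2)[OF s] singular_weight(2)[OF v] by simp
  qed
  have swap: "down_closed (prod.swap ` A)" if "down_closed A" for A
    using that unfolding down_closed_def by auto
  have swap_iff: "(i, j) \<in> prod.swap ` A \<longleftrightarrow> (j, i) \<in> A" for i j and A :: "(nat \<times> nat) set" by force
  have into: "F M \<in> hook_partitions_vee m n r" if M: "M \<in> singular_weights m n r" for M
  proof (cases "m \<le> n")
    case True
    then show ?thesis using diagram_partition_hook[OF D(1,2)[OF M]] D(4)[OF M] by (simp add: F_def hook_partitions_vee_def)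
  next
    case False
    have "card (prod.swap ` weight_diagram m n M) = r" using D(4)[OF M] by (simp add: card_image)
    moreover have "(n, m) \<notin> prod.swap ` weight_diagram m n M" using D(2)[OF M] by (simp add: swap_iff)
    ultimately show ?thesis using diagram_partition_hook[OF swap[OF D(1)[OF M]], of n m] False
      by (simp add: F_def hook_partitions_vee_def min_def max_def)
  qed
  have rec: "A = B" if "down_closed A" "down_closed B" "diagram_partition A = diagram_partition B" for A B
    using diagram_partition_iff[OF that(1)] diagram_partition_iff[OF that(2)] that(3) by auto
  have inj: "inj_on F (singular_weights m n r)"
  proof (rule inj_onI)
    fix M M' assume M: "M \<in> singular_weights m n r" "M' \<in> singular_weights m n r" and e: "F M = F M'"
    have "weight_diagram m n M = weight_diagram m n M'"
    proof (cases "m \<le> n")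
      case True
      then show ?thesis using e D(1)[OF M(1)] D(1)[OF M(2)] by (intro rec) (simp_all add: F_def)
    next
      case False
      then have "prod.swap ` weight_diagram m n M = prod.swap ` weight_diagram m n M'"
        using e D(1)[OF M(1)] D(1)[OF M(2)] by (intro rec swap) (simp_all add: F_def)
      then show ?thesis by (simp add: inj_image_eq_iff)
    qed
    then show "M = M'" using D(3)[OF M(1)] D(3)[OF M(2)] by (intro weight_diagram_inj)
  qed
  have sub: "F ` singular_weights m n r \<subseteq> hook_partitions_vee m n r" using into by blast
  have fin: "finite (hook_partitions_vee m n r)" by (simp add: hook_partitions_vee_def finite_hook_partitions)
  show "finite (singular_weights m n r)" using inj_on_finite[OF inj sub fin] .
  show "card (singular_weights m n r) \<le> card (hook_partitions_vee m n r)" using card_inj_on_le[OF inj sub fin] .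
qed

section \<open>Products of complete symmetric functions\<close>

text \<open>
  Homogeneous linear equations with more unknowns \<open>y\<close> than equations, by elimination.
\<close>

lemma exists_dependency:
  fixes \<chi> :: "'k \<Rightarrow> 'w \<Rightarrow> 'f::field"
  assumes "finite W" "finite K" "card W < card K"
  shows "\<exists>y. (\<exists>k\<in>K. y k \<noteq> 0) \<and> (\<forall>M\<in>W. (\<Sum>k\<in>K. y k * \<chi> k M) = 0)"
  using assms
proof (induction W arbitrary: K \<chi> rule: finite_induct)
  case empty
  then obtain k where "k \<in> K" by (metis card.empty card_gt_0_iff ex_in_conv)
  then show ?case by (intro exI[of _ "\<lambda>_. 1"]) auto
next
  case (insert M W)
  show ?case
  proof (cases "\<forall>k\<in>K. \<chi> k M = 0")
    case True
    have "card W < card K" using insert by simp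
    from insert.IH[OF insert.prems(1) this, of \<chi>] obtain y where
      "\<exists>k\<in>K. y k \<noteq> 0" "\<forall>M\<in>W. (\<Sum>k\<in>K. y k * \<chi> k M) = 0" by blast
    then show ?thesis using True by (intro exI[of _ y]) simp
  next
    case False
    then obtain k0 where k0: "k0 \<in> K" "\<chi> k0 M \<noteq> 0" by blast
    have "card W < card (K - {k0})" using insert k0 by simp
    with insert.IH[of "K - {k0}" "\<lambda>k N. \<chi> k N - \<chi> k M / \<chi> k0 M * \<chi> k0 N"] insert.prems
    obtain y where y: "\<exists>k\<in>K - {k0}. y k \<noteq> 0"
      "\<And>N. N \<in> W \<Longrightarrow> (\<Sum>k\<in>K - {k0}. y k * (\<chi> k N - \<chi> k M / \<chi> k0 M * \<chi> k0 N)) = 0" by auto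
    \<comment> \<open>The value of y k0 that solves the equation M, after which k0 has been eliminated.\<close>
    define c where "c = - (\<Sum>k\<in>K - {k0}. y k * (\<chi> k M / \<chi> k0 M))"
    define z where "z = (\<lambda>k. if k = k0 then c else y k)"
    have "(\<Sum>k\<in>K. z k * \<chi> k N) = 0" if "N \<in> insert M W" for N
    proof -
      have "(\<Sum>k\<in>K. z k * \<chi> k N) = c * \<chi> k0 N + (\<Sum>k\<in>K - {k0}. y k * \<chi> k N)"
        using k0 insert.prems by (simp add: sum.remove[of K k0] z_def)
      also have "\<dots> = (\<Sum>k\<in>K - {k0}. y k * (\<chi> k N - \<chi> k M / \<chi> k0 M * \<chi> k0 N))"
        by (simp add: c_def sum_distrib_right right_diff_distrib sum_subtractf mult.assoc)
      also have "\<dots> = 0" using y(2) that k0 by auto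
      finally show ?thesis .
    qed
    moreover have "\<exists>k\<in>K. z k \<noteq> 0" using y(1) by (auto simp: z_def)
    ultimately show ?thesis by blast
  qed
qed

lemma monomial_sum_eq_0:
  fixes c :: "'x \<Rightarrow> complex"
  assumes "finite X" "\<And>s. (\<Sum>x\<in>X. c x * s ^ e x) = 0"
  shows "(\<Sum>x\<in>{x\<in>X. e x = k}. c x) = 0"
proof -
  define p where "p = (\<Sum>x\<in>X. monom (c x) (e x))"
  have "poly p s = 0" for s using assms(2)[of s] by (simp add: p_def poly_sum poly_monom)
  then have "p = 0" using poly_all_0_iff_0 by blast
  then have "coeff p k = 0" by simp
  then show ?thesis using assms(1) by (simp add: p_def coeff_sum sum.inter_filter)
qed

lemma digits_unique:
  fixes f g :: "nat \<Rightarrow> nat"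
  assumes "\<And>i. i < n \<Longrightarrow> f i < B" "\<And>i. i < n \<Longrightarrow> g i < B"
    and "(\<Sum>i<n. f i * B ^ i) = (\<Sum>i<n. g i * B ^ i)" and "i < n"
  shows "f i = g i"
  using assms
proof (induction n arbitrary: f g i)
  case (Suc n)
  have e: "(\<Sum>i<Suc n. h i * B ^ i) = h 0 + B * (\<Sum>i<n. h (Suc i) * B ^ i)" for h
    by (simp add: sum.lessThan_Suc_shift sum_distrib_left mult_ac del: sum.lessThan_Suc)
  have B: "f 0 < B" "g 0 < B" using Suc.prems by auto
  have eq: "f 0 + B * (\<Sum>i<n. f (Suc i) * B ^ i) = g 0 + B * (\<Sum>i<n. g (Suc i) * B ^ i)"
    using Suc.prems(3) unfolding e .
  then have "(f 0 + B * (\<Sum>i<n. f (Suc i) * B ^ i)) mod B = (g 0 + B * (\<Sum>i<n. g (Suc i) * B ^ i)) mod B" by simp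
  then have z: "f 0 = g 0" using B by simp
  then have "(\<Sum>i<n. f (Suc i) * B ^ i) = (\<Sum>i<n. g (Suc i) * B ^ i)" using eq B by simp
  from Suc.IH[of "\<lambda>i. f (Suc i)" "\<lambda>i. g (Suc i)", OF _ _ this] Suc.prems(1,2)
  have "f (Suc j) = g (Suc j)" if "j < n" for j using that by simp
  then show ?case using z Suc.prems(4) by (cases i) auto
qed simp

lemma strictly_increasing_permutation:
  assumes p: "\<sigma> permutes {..<a}" and mono: "\<And>i j. i < j \<Longrightarrow> j < a \<Longrightarrow> \<sigma> i < (\<sigma> j :: nat)"
  shows "\<sigma> = id"
proof -
  have "sorted (map \<sigma> [0..<a])" using mono by (simp add: sorted_iff_nth_mono_less less_imp_le)
  moreover have "distinct (map \<sigma> [0..<a])"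
    using permutes_inj_on[OF p] by (simp add: distinct_map)
  moreover have "set (map \<sigma> [0..<a]) = set [0..<a]"
    using permutes_image[OF p] by (simp add: atLeast0LessThan)
  ultimately have e: "map \<sigma> [0..<a] = [0..<a]"
    by (intro sorted_distinct_set_unique) auto
  have "\<sigma> i = i" for i
  proof (cases "i < a")
    case True
    then have "map \<sigma> [0..<a] ! i = [0..<a] ! i" using e by simp
    then show ?thesis using True by simp
  qed (use permutes_not_in[OF p] in simp)
  then show ?thesis by auto
qed

lemma permutes_upt_less: "\<sigma> permutes {0..<a} \<Longrightarrow> i < a \<Longrightarrow> \<sigma> i < (a :: nat)"
  using permutes_in_image[of \<sigma> "{0..<a}" i] by simp

definition alternant :: "nat \<Rightarrow> (nat \<Rightarrow> nat) \<Rightarrow> (nat \<Rightarrow> complex) \<Rightarrow> complex" where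
  "alternant a l \<xi> = det (mat a a (\<lambda>(i, j). \<xi> i ^ l j))"

text \<open>
  Substituting \<open>\<xi>\<^sub>i = s\<^bsup>B^i\<^esup>\<close> turns the terms of the determinants into powers of \<open>s\<close> whose exponents have the
  numbers \<open>l \<kappa> (\<sigma> i)\<close> as digits in base \<open>B\<close>. As \<open>l \<kappa>\<close> is decreasing, these digits determine \<open>\<kappa>\<close> and \<open>\<sigma>\<close>, so
  the diagonal term of each alternant is not cancelled.
\<close>

lemma alternants_independent:
  assumes "finite K" and dec: "\<And>\<kappa> i j. \<kappa> \<in> K \<Longrightarrow> i < j \<Longrightarrow> j < a \<Longrightarrow> l \<kappa> j < (l \<kappa> i :: nat)"
    and inj: "\<And>\<kappa> \<kappa>'. \<kappa> \<in> K \<Longrightarrow> \<kappa>' \<in> K \<Longrightarrow> (\<And>i. i < a \<Longrightarrow> l \<kappa> i = l \<kappa>' i) \<Longrightarrow> \<kappa> = \<kappa>'"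
    and zero: "\<And>\<xi>. (\<Sum>\<kappa>\<in>K. b \<kappa> * alternant a (l \<kappa>) \<xi>) = 0"
    and \<kappa>: "\<kappa> \<in> K"
  shows "b \<kappa> = 0"
proof -
  define B where "B = Suc (Max ((\<lambda>(\<kappa>, i). l \<kappa> i) ` (K \<times> {..<a})))"
  have B: "l \<kappa> i < B" if "\<kappa> \<in> K" "i < a" for \<kappa> i
  proof -
    have "l \<kappa> i \<in> (\<lambda>(\<kappa>, i). l \<kappa> i) ` (K \<times> {..<a})" using that by force
    then show ?thesis unfolding B_def less_Suc_eq_le using assms(1) by (intro Max_ge) auto
  qed
  let ?P = "{\<sigma>. \<sigma> permutes {0..<a}}"
  let ?c = "\<lambda>(\<kappa>, \<sigma>). b \<kappa> * signof \<sigma>"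
  define e where "e = (\<lambda>(\<kappa>, \<sigma>). \<Sum>i<a. l \<kappa> (\<sigma> i) * B ^ i)"
  have fin: "finite (K \<times> ?P)" using assms(1) by (simp add: finite_permutations)
  have "(\<Sum>x\<in>K \<times> ?P. ?c x * s ^ e x) = 0" for s
  proof -
    have "alternant a (l \<kappa>) (\<lambda>i. s ^ (B ^ i)) = (\<Sum>\<sigma>\<in>?P. signof \<sigma> * s ^ e (\<kappa>, \<sigma>))" for \<kappa>
    proof -
      have "alternant a (l \<kappa>) (\<lambda>i. s ^ (B ^ i)) = (\<Sum>\<sigma>\<in>?P. signof \<sigma> * (\<Prod>i=0..<a. (s ^ (B ^ i)) ^ l \<kappa> (\<sigma> i)))"
        unfolding alternant_def
        by (subst det_def'[of _ a]) (auto intro!: sum.cong prod.cong simp: permutes_upt_less)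
      also have "\<dots> = (\<Sum>\<sigma>\<in>?P. signof \<sigma> * s ^ e (\<kappa>, \<sigma>))"
        by (simp add: e_def power_sum power_mult[symmetric] mult.commute atLeast0LessThan)
      finally show ?thesis .
    qed
    then have "(\<Sum>x\<in>K \<times> ?P. ?c x * s ^ e x) = (\<Sum>\<kappa>\<in>K. b \<kappa> * alternant a (l \<kappa>) (\<lambda>i. s ^ (B ^ i)))"
      by (simp add: sum.cartesian_product' sum_distrib_left mult.assoc)
    then show ?thesis using zero by simp
  qed
  from monomial_sum_eq_0[OF fin this, of "e (\<kappa>, id)"]
  have s0: "(\<Sum>x\<in>{x \<in> K \<times> ?P. e x = e (\<kappa>, id)}. ?c x) = 0" .
  have "{x \<in> K \<times> ?P. e x = e (\<kappa>, id)} = {(\<kappa>, id)}"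
  proof (intro equalityI subsetI)
    fix x assume "x \<in> {x \<in> K \<times> ?P. e x = e (\<kappa>, id)}"
    then obtain \<kappa>' \<sigma> where x: "x = (\<kappa>', \<sigma>)" "\<kappa>' \<in> K" "\<sigma> permutes {..<a}" "e (\<kappa>', \<sigma>) = e (\<kappa>, id)"
      by (cases x) (auto simp: atLeast0LessThan)
    have sa: "\<sigma> i < a" if "i < a" for i using permutes_in_image[OF x(3), of i] that by simp
    have eq: "l \<kappa>' (\<sigma> i) = l \<kappa> i" if "i < a" for i
      by (rule digits_unique[where n = a and B = B]) (use that x sa B \<kappa> in \<open>auto simp: e_def\<close>)
    have "\<sigma> i < \<sigma> j" if ij: "i < j" "j < a" for i j
    proof (rule ccontr)
      assume "\<not> \<sigma> i < \<sigma> j"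
      moreover have "\<sigma> i \<noteq> \<sigma> j" using ij permutes_inj[OF x(3)] by (auto dest: injD)
      ultimately have "l \<kappa>' (\<sigma> i) < l \<kappa>' (\<sigma> j)" using dec[OF x(2), of "\<sigma> j" "\<sigma> i"] sa ij by simp
      then show False using eq dec[OF \<kappa> ij] ij by simp
    qed
    then have id: "\<sigma> = id" by (rule strictly_increasing_permutation[OF x(3)])
    then have "\<kappa>' = \<kappa>" using eq by (intro inj x \<kappa>) simp
    then show "x \<in> {(\<kappa>, id)}" using x id by simp
  qed (use \<kappa> in \<open>auto simp: permutes_id\<close>)
  with s0 show ?thesis by simp
qed

text \<open>
  The polynomial \<open>\<Prod>(1 - \<xi>\<^sub>i t)\<close>, whose reciprocal generates the complete symmetric functions.
\<close>

definition reciprocal_poly :: "nat \<Rightarrow> (nat \<Rightarrow> complex) \<Rightarrow> complex poly" where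
  "reciprocal_poly a \<xi> = (\<Prod>i<a. [:1, - \<xi> i:])"

definition complete_sym :: "nat \<Rightarrow> (nat \<Rightarrow> complex) \<Rightarrow> nat \<Rightarrow> complex" where
  "complete_sym a \<xi> k = inverse (fps_of_poly (reciprocal_poly a \<xi>)) $ k"

lemma coeff_0_reciprocal: "coeff (reciprocal_poly a \<xi>) 0 = 1"
  by (simp add: reciprocal_poly_def poly_prod flip: poly_0_coeff_0)

lemma degree_prod_linear: "degree (\<Prod>i\<in>I. [:1, - \<xi> i:] :: complex poly) \<le> card I"
proof (induction I rule: infinite_finite_induct)
  case (insert i I)
  have "degree ([:1, - \<xi> i:] * (\<Prod>i\<in>I. [:1, - \<xi> i:])) \<le> degree [:1, - \<xi> i:] + degree (\<Prod>i\<in>I. [:1, - \<xi> i:])"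
    by (rule degree_mult_le)
  also have "\<dots> \<le> 1 + card I" using insert by (intro add_mono) auto
  finally show ?case using insert by simp
qed simp_all

lemma degree_reciprocal: "degree (reciprocal_poly a \<xi>) \<le> a"
  using degree_prod_linear[of \<xi> "{..<a}"] by (simp add: reciprocal_poly_def)

lemma reciprocal_inverse: "fps_of_poly (reciprocal_poly a \<xi>) * inverse (fps_of_poly (reciprocal_poly a \<xi>)) = 1"
  by (rule inverse_mult_eq_1') (simp add: coeff_0_reciprocal)

lemma complete_sym_0: "complete_sym a \<xi> 0 = 1"
  by (simp add: complete_sym_def coeff_0_reciprocal)

definition geometric_fps :: "complex \<Rightarrow> complex fps" where
  "geometric_fps c = Abs_fps (\<lambda>k. c ^ k)"

lemma geometric_fps_inverse: "fps_of_poly [:1, - c:] * geometric_fps c = 1"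
proof (rule fps_ext)
  fix k
  show "(fps_of_poly [:1, - c:] * geometric_fps c) $ k = 1 $ k"
  proof (cases k)
    case 0
    then show ?thesis by (simp add: geometric_fps_def)
  next
    case (Suc j)
    have "(fps_of_poly [:1, - c:] * geometric_fps c) $ k = geometric_fps c $ k - c * geometric_fps c $ j"
      using Suc by (simp add: fps_of_poly_pCons algebra_simps)
    then show ?thesis using Suc by (simp add: geometric_fps_def)
  qed
qed

text \<open>
  \<open>1 / (1 - \<xi>\<^sub>i t)\<close> is the reciprocal of the whole product times the product of the other factors, whose
  degree is less than \<open>a\<close>.
\<close>

lemma power_as_complete_sym:
  assumes i: "i < a"
  shows "\<xi> i ^ k = (\<Sum>q<a. coeff (\<Prod>j\<in>{..<a} - {i}. [:1, - \<xi> j:]) q * (if q \<le> k then complete_sym a \<xi> (k - q) else 0))"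
proof -
  let ?E = "\<Prod>j\<in>{..<a} - {i}. [:1, - \<xi> j:]"
  let ?A = "fps_of_poly (reciprocal_poly a \<xi>)"
  have "reciprocal_poly a \<xi> = [:1, - \<xi> i:] * ?E"
    unfolding reciprocal_poly_def using i by (subst prod.remove[of _ i]) auto
  then have A: "?A = fps_of_poly [:1, - \<xi> i:] * fps_of_poly ?E" by (simp only: fps_of_poly_mult)
  have "geometric_fps (\<xi> i) = (?A * inverse ?A) * geometric_fps (\<xi> i)" by (simp add: reciprocal_inverse)
  also have "\<dots> = (fps_of_poly [:1, - \<xi> i:] * geometric_fps (\<xi> i)) * (fps_of_poly ?E * inverse ?A)"
    by (subst A) (simp only: mult_ac)
  also have "\<dots> = fps_of_poly ?E * inverse ?A" by (simp only: geometric_fps_inverse mult_1)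
  finally have "geometric_fps (\<xi> i) $ k = (fps_of_poly ?E * inverse ?A) $ k" by simp
  then have "\<xi> i ^ k = (\<Sum>q=0..k. coeff ?E q * complete_sym a \<xi> (k - q))"
    by (simp add: geometric_fps_def fps_mult_nth complete_sym_def)
  also have "\<dots> = (\<Sum>q\<in>{..<a} \<union> {..k}. coeff ?E q * (if q \<le> k then complete_sym a \<xi> (k - q) else 0))"
    by (rule sum.mono_neutral_cong_left) auto
  also have "\<dots> = (\<Sum>q<a. coeff ?E q * (if q \<le> k then complete_sym a \<xi> (k - q) else 0))"
  proof (rule sum.mono_neutral_right)
    have "degree ?E < a" using degree_prod_linear[of \<xi> "{..<a} - {i}"] i by simp
    then show "\<forall>q\<in>({..<a} \<union> {..k}) - {..<a}. coeff ?E q * (if q \<le> k then complete_sym a \<xi> (k - q) else 0) = 0"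
      by (auto simp: coeff_eq_0)
  qed auto
  finally show ?thesis .
qed

text \<open>
  The Jacobi--Trudi argument: the matrix of powers factors into a matrix that does not depend on \<open>l\<close> and
  a matrix of complete symmetric functions.
\<close>

lemma alternant_as_complete_sym:
  "alternant a l \<xi> = det (mat a a (\<lambda>(i, q). coeff (\<Prod>j\<in>{..<a} - {i}. [:1, - \<xi> j:]) q)) *
    (\<Sum>\<sigma> | \<sigma> permutes {0..<a}. signof \<sigma> * (\<Prod>q<a. if q \<le> l (\<sigma> q) then complete_sym a \<xi> (l (\<sigma> q) - q) else 0))"
proof -
  let ?E = "mat a a (\<lambda>(i, q). coeff (\<Prod>j\<in>{..<a} - {i}. [:1, - \<xi> j:]) q)"
  let ?H = "mat a a (\<lambda>(q, j). if q \<le> l j then complete_sym a \<xi> (l j - q) else 0)"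
  have "mat a a (\<lambda>(i, j). \<xi> i ^ l j) = ?E * ?H"
    by (rule eq_matI) (auto simp: scalar_prod_def power_as_complete_sym[of _ a \<xi>] atLeast0LessThan intro!: sum.cong)
  then have "alternant a l \<xi> = det ?E * det ?H"
    unfolding alternant_def by (simp add: det_mult[of _ a])
  also have "det ?H = (\<Sum>\<sigma> | \<sigma> permutes {0..<a}. signof \<sigma> * (\<Prod>q<a. if q \<le> l (\<sigma> q) then complete_sym a \<xi> (l (\<sigma> q) - q) else 0))"
    by (subst det_def'[of _ a]) (auto intro!: sum.cong prod.cong simp: permutes_upt_less atLeast0LessThan)
  finally show ?thesis .
qed

text \<open>
  The partitions of \<open>N\<close> into at most \<open>a\<close> parts.
\<close>

definition bounded_partitions :: "nat \<Rightarrow> nat \<Rightarrow> nat multiset set" where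
  "bounded_partitions a N = {\<kappa>. 0 \<notin># \<kappa> \<and> size \<kappa> \<le> a \<and> sum_mset \<kappa> = N}"

lemma finite_bounded_partitions: "finite (bounded_partitions a N)"
proof (rule finite_subset)
  show "bounded_partitions a N \<subseteq> mset ` {xs. set xs \<subseteq> {..N} \<and> length xs \<le> a}"
  proof
    fix \<kappa> assume k: "\<kappa> \<in> bounded_partitions a N"
    obtain xs where xs: "mset xs = \<kappa>" using ex_mset by blast
    have "x \<le> N" if "x \<in> set xs" for x
      using k that xs member_le_sum_list[of x xs] by (auto simp: bounded_partitions_def simp flip: sum_mset_sum_list)
    then show "\<kappa> \<in> mset ` {xs. set xs \<subseteq> {..N} \<and> length xs \<le> a}"
      using k xs by (auto simp: bounded_partitions_def intro!: image_eqI[of _ _ xs])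
  qed
qed (simp add: finite_lists_length_le)

definition padded_parts :: "nat \<Rightarrow> nat multiset \<Rightarrow> nat list" where
  "padded_parts a \<kappa> = rev (sorted_list_of_multiset \<kappa>) @ replicate (a - size \<kappa>) 0"

lemma padded_parts:
  assumes "\<kappa> \<in> bounded_partitions a N"
  shows "length (padded_parts a \<kappa>) = a" "sum_list (padded_parts a \<kappa>) = N"
    "i \<le> j \<Longrightarrow> j < a \<Longrightarrow> padded_parts a \<kappa> ! j \<le> padded_parts a \<kappa> ! i"
    "filter_mset (\<lambda>k. k \<noteq> 0) (mset (padded_parts a \<kappa>)) = \<kappa>"
proof -
  have sz: "length (sorted_list_of_multiset \<kappa>) = size \<kappa>"
    by (metis mset_sorted_list_of_multiset size_mset)
  have ms: "mset (padded_parts a \<kappa>) = \<kappa> + replicate_mset (a - size \<kappa>) 0"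
    by (simp add: padded_parts_def)
  show len: "length (padded_parts a \<kappa>) = a" using assms by (simp add: padded_parts_def sz bounded_partitions_def)
  have "sum_mset (mset (padded_parts a \<kappa>)) = N" unfolding ms using assms by (simp add: bounded_partitions_def)
  then show "sum_list (padded_parts a \<kappa>) = N" by (simp only: sum_mset_sum_list)
  have "sorted_wrt (\<ge>) (replicate k (0 :: nat))" for k by (induction k) auto
  then have "sorted_wrt (\<ge>) (padded_parts a \<kappa>)"
    by (auto simp: padded_parts_def sorted_wrt_append sorted_wrt_rev)
  then show "padded_parts a \<kappa> ! j \<le> padded_parts a \<kappa> ! i" if "i \<le> j" "j < a"
    using that len by (cases "i = j") (auto simp: sorted_wrt_iff_nth_less)
  have "count \<kappa> 0 = 0" using assms by (simp add: bounded_partitions_def not_in_iff)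
  then have "filter_mset (\<lambda>k. k \<noteq> 0) \<kappa> = \<kappa>" by (intro multiset_eqI) simp
  moreover have "filter_mset (\<lambda>k. k \<noteq> 0) (replicate_mset k (0 :: nat)) = {#}" for k
    by (intro multiset_eqI) simp
  ultimately show "filter_mset (\<lambda>k. k \<noteq> 0) (mset (padded_parts a \<kappa>)) = \<kappa>"
    by (metis ms filter_union_mset add_0_right)
qed

text \<open>
  Up to a common factor, the alternants indexed by these partitions are combinations of the products
  of complete symmetric functions indexed by the same partitions. A relation between the products
  would make the alternants combinations of a smaller number of functions, so there would be a
  relation between the alternants.
\<close>

lemma complete_sym_products_independent:
  assumes zero: "\<And>\<xi>. (\<Sum>\<kappa>\<in>bounded_partitions a N. y \<kappa> * (\<Prod>k\<in>#\<kappa>. complete_sym a \<xi> k)) = 0"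
    and \<kappa>: "\<kappa> \<in> bounded_partitions a N"
  shows "y \<kappa> = 0"
proof (rule ccontr)
  assume y: "y \<kappa> \<noteq> 0"
  let ?K = "bounded_partitions a N"
  let ?P = "{\<sigma>. \<sigma> permutes {0..<a}}"
  let ?h = "\<lambda>\<xi> \<kappa>. \<Prod>k\<in>#\<kappa>. complete_sym a \<xi> k"
  note fin = finite_bounded_partitions[of a N]
  \<comment> \<open>Adding the staircase a - 1, ..., 1, 0 makes the exponents strictly decreasing.\<close>
  define l where "l = (\<lambda>\<kappa> j. padded_parts a \<kappa> ! j + (a - 1 - j))"
  \<comment> \<open>The term of \<sigma> is zero if one of the indices is negative.\<close>
  define valid where "valid = (\<lambda>\<kappa> \<sigma>. \<forall>q<a. q \<le> l \<kappa> (\<sigma> q))"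
  define \<mu> where "\<mu> = (\<lambda>\<kappa> \<sigma>. filter_mset (\<lambda>k. k \<noteq> 0) {#l \<kappa> (\<sigma> q) - q. q \<in># mset_set {..<a}#})"
  define C where "C = (\<lambda>\<kappa> \<nu>. \<Sum>\<sigma>\<in>{\<sigma>\<in>?P. valid \<kappa> \<sigma> \<and> \<mu> \<kappa> \<sigma> = \<nu>}. signof \<sigma> :: complex)"
  have finP: "finite ?P" by (simp add: finite_permutations)
  have \<mu>K: "\<mu> \<kappa> \<sigma> \<in> ?K" if \<kappa>: "\<kappa> \<in> ?K" and s: "\<sigma> \<in> ?P" and v: "valid \<kappa> \<sigma>" for \<kappa> \<sigma>
  proof -
    have s: "\<sigma> permutes {..<a}" using s by (simp add: atLeast0LessThan)
    have "sum_mset (filter_mset (\<lambda>k. k \<noteq> 0) X) = sum_mset X" for X :: "nat multiset"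
      by (induction X) auto
    then have "sum_mset (\<mu> \<kappa> \<sigma>) = (\<Sum>q<a. l \<kappa> (\<sigma> q) - q)"
      by (simp add: \<mu>_def sum_unfold_sum_mset)
    moreover have "(\<Sum>q<a. l \<kappa> (\<sigma> q) - q) + (\<Sum>q<a. q) = (\<Sum>q<a. l \<kappa> (\<sigma> q))"
      using v by (simp add: sum.distrib[symmetric] valid_def)
    moreover have "(\<Sum>q<a. l \<kappa> (\<sigma> q)) = (\<Sum>q<a. l \<kappa> q)"
      by (rule sum.reindex_bij_betw[OF permutes_imp_bij[OF s]])
    moreover have "(\<Sum>q<a. l \<kappa> q) = N + (\<Sum>q<a. q)"
    proof -
      have "(\<Sum>q<a. padded_parts a \<kappa> ! q) = N"
        using padded_parts(1,2)[OF \<kappa>] by (simp add: sum_list_sum_nth atLeast0LessThan)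
      moreover have "(\<Sum>q<a. a - 1 - q) = (\<Sum>q<a. q)"
        by (rule sum.reindex_bij_witness[of _ "\<lambda>q. a - 1 - q" "\<lambda>q. a - 1 - q"]) auto
      moreover have "(\<Sum>q<a. l \<kappa> q) = (\<Sum>q<a. padded_parts a \<kappa> ! q) + (\<Sum>q<a. a - 1 - q)"
        unfolding l_def by (rule sum.distrib)
      ultimately show ?thesis by simp
    qed
    moreover have "size (\<mu> \<kappa> \<sigma>) \<le> a"
      unfolding \<mu>_def by (rule order.trans[OF size_mset_mono[OF multiset_filter_subset]]) simp
    ultimately show ?thesis by (simp add: bounded_partitions_def \<mu>_def)
  qed
  define D where "D = (\<lambda>\<xi> :: nat \<Rightarrow> complex. det (mat a a (\<lambda>(i, q). coeff (\<Prod>j\<in>{..<a} - {i}. [:1, - \<xi> j:]) q)))"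
  have prod: "(\<Prod>q<a. if q \<le> l \<kappa> (\<sigma> q) then complete_sym a \<xi> (l \<kappa> (\<sigma> q) - q) else 0) = (if valid \<kappa> \<sigma> then ?h \<xi> (\<mu> \<kappa> \<sigma>) else 0)" for \<kappa> \<sigma> \<xi>
  proof (cases "valid \<kappa> \<sigma>")
    case True
    have f: "prod_mset (image_mset (complete_sym a \<xi>) (filter_mset (\<lambda>k. k \<noteq> 0) X)) = prod_mset (image_mset (complete_sym a \<xi>) X)" for X
      by (induction X) (auto simp: complete_sym_0)
    have "(\<Prod>q<a. if q \<le> l \<kappa> (\<sigma> q) then complete_sym a \<xi> (l \<kappa> (\<sigma> q) - q) else 0) = (\<Prod>q<a. complete_sym a \<xi> (l \<kappa> (\<sigma> q) - q))"
      using True by (intro prod.cong) (auto simp: valid_def)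
    also have "\<dots> = ?h \<xi> (\<mu> \<kappa> \<sigma>)"
      unfolding \<mu>_def f by (simp add: prod_unfold_prod_mset image_mset.compositionality comp_def)
    finally show ?thesis using True by simp
  next
    case False
    then obtain q where "q < a" "\<not> q \<le> l \<kappa> (\<sigma> q)" by (auto simp: valid_def)
    then show ?thesis using False by (intro trans[OF prod_zero]) auto
  qed
  have alt: "alternant a (l \<kappa>) \<xi> = D \<xi> * (\<Sum>\<nu>\<in>?K. C \<kappa> \<nu> * ?h \<xi> \<nu>)" if \<kappa>: "\<kappa> \<in> ?K" for \<kappa> \<xi>
  proof -
    have "(\<Sum>\<sigma>\<in>?P. signof \<sigma> * (if valid \<kappa> \<sigma> then ?h \<xi> (\<mu> \<kappa> \<sigma>) else 0)) = (\<Sum>\<sigma>\<in>{\<sigma>\<in>?P. valid \<kappa> \<sigma>}. signof \<sigma> * ?h \<xi> (\<mu> \<kappa> \<sigma>))"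
      using finP by (subst sum.inter_filter) (auto intro!: sum.cong)
    also have "\<dots> = (\<Sum>\<nu>\<in>?K. \<Sum>\<sigma>\<in>{\<sigma>\<in>{\<sigma>\<in>?P. valid \<kappa> \<sigma>}. \<mu> \<kappa> \<sigma> = \<nu>}. signof \<sigma> * ?h \<xi> (\<mu> \<kappa> \<sigma>))"
      by (rule sum.group[symmetric]) (use finP fin \<mu>K[OF \<kappa>] in auto)
    also have "\<dots> = (\<Sum>\<nu>\<in>?K. C \<kappa> \<nu> * ?h \<xi> \<nu>)"
      unfolding C_def sum_distrib_right by (intro sum.cong) auto
    finally show ?thesis unfolding alternant_as_complete_sym prod D_def by simp
  qed
  have "card (?K - {\<kappa>}) < card ?K" using fin \<kappa> by (intro psubset_card_mono) auto
  from exists_dependency[OF _ fin this, of "\<lambda>\<kappa>' \<nu>. C \<kappa>' \<nu> - C \<kappa>' \<kappa> * (y \<nu> / y \<kappa>)"] fin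
  obtain b where b: "\<exists>\<kappa>'\<in>?K. b \<kappa>' \<noteq> 0"
    "\<And>\<nu>. \<nu> \<in> ?K - {\<kappa>} \<Longrightarrow> (\<Sum>\<kappa>'\<in>?K. b \<kappa>' * (C \<kappa>' \<nu> - C \<kappa>' \<kappa> * (y \<nu> / y \<kappa>))) = 0" by auto
  have "(\<Sum>\<kappa>'\<in>?K. b \<kappa>' * alternant a (l \<kappa>') \<xi>) = 0" for \<xi>
  proof -
    have "y \<kappa> * ?h \<xi> \<kappa> + (\<Sum>\<nu>\<in>?K - {\<kappa>}. y \<nu> * ?h \<xi> \<nu>) = 0"
      using zero[of \<xi>] fin \<kappa> by (simp add: sum.remove)
    then have hk: "?h \<xi> \<kappa> = - (\<Sum>\<nu>\<in>?K - {\<kappa>}. y \<nu> * ?h \<xi> \<nu>) / y \<kappa>"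
      using y by (simp add: field_simps eq_neg_iff_add_eq_0)
    have e: "(\<Sum>\<nu>\<in>?K. C \<kappa>' \<nu> * ?h \<xi> \<nu>) = (\<Sum>\<nu>\<in>?K - {\<kappa>}. (C \<kappa>' \<nu> - C \<kappa>' \<kappa> * (y \<nu> / y \<kappa>)) * ?h \<xi> \<nu>)" for \<kappa>'
    proof -
      have "(\<Sum>\<nu>\<in>?K. C \<kappa>' \<nu> * ?h \<xi> \<nu>) = C \<kappa>' \<kappa> * ?h \<xi> \<kappa> + (\<Sum>\<nu>\<in>?K - {\<kappa>}. C \<kappa>' \<nu> * ?h \<xi> \<nu>)"
        using fin \<kappa> by (simp add: sum.remove)
      also have "C \<kappa>' \<kappa> * ?h \<xi> \<kappa> = - (\<Sum>\<nu>\<in>?K - {\<kappa>}. C \<kappa>' \<kappa> * (y \<nu> / y \<kappa>) * ?h \<xi> \<nu>)"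
        unfolding hk by (simp add: sum_distrib_left sum_divide_distrib mult_ac)
      finally show ?thesis by (simp add: left_diff_distrib sum_subtractf)
    qed
    have "(\<Sum>\<kappa>'\<in>?K. b \<kappa>' * alternant a (l \<kappa>') \<xi>) = D \<xi> * (\<Sum>\<kappa>'\<in>?K. \<Sum>\<nu>\<in>?K - {\<kappa>}. b \<kappa>' * (C \<kappa>' \<nu> - C \<kappa>' \<kappa> * (y \<nu> / y \<kappa>)) * ?h \<xi> \<nu>)"
      by (simp add: alt e sum_distrib_left mult_ac cong: sum.cong)
    also have "(\<Sum>\<kappa>'\<in>?K. \<Sum>\<nu>\<in>?K - {\<kappa>}. b \<kappa>' * (C \<kappa>' \<nu> - C \<kappa>' \<kappa> * (y \<nu> / y \<kappa>)) * ?h \<xi> \<nu>) = 0"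
    proof (subst sum.swap, rule sum.neutral, rule ballI)
      fix \<nu> assume "\<nu> \<in> ?K - {\<kappa>}"
      from b(2)[OF this] show "(\<Sum>\<kappa>'\<in>?K. b \<kappa>' * (C \<kappa>' \<nu> - C \<kappa>' \<kappa> * (y \<nu> / y \<kappa>)) * ?h \<xi> \<nu>) = 0"
        by (simp only: sum_distrib_right[symmetric]) simp
    qed
    finally show ?thesis by simp
  qed
  then have "b \<kappa>' = 0" if "\<kappa>' \<in> ?K" for \<kappa>'
  proof (rule alternants_independent[OF fin _ _ _ that, rotated 2])
    show "l \<kappa> j < l \<kappa> i" if "\<kappa> \<in> ?K" "i < j" "j < a" for \<kappa> i j
      using padded_parts(3)[OF that(1), of i j] that unfolding l_def by simp
    show "\<kappa> = \<kappa>'" if k: "\<kappa> \<in> ?K" "\<kappa>' \<in> ?K" "\<And>i. i < a \<Longrightarrow> l \<kappa> i = l \<kappa>' i" for \<kappa> \<kappa>'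
    proof -
      have "padded_parts a \<kappa> = padded_parts a \<kappa>'"
      proof (rule nth_equalityI)
        fix i assume "i < length (padded_parts a \<kappa>)"
        then have "i < a" using padded_parts(1)[OF k(1)] by simp
        from k(3)[OF this] show "padded_parts a \<kappa> ! i = padded_parts a \<kappa>' ! i" unfolding l_def by (rule add_right_imp_eq)
      qed (simp add: padded_parts(1)[OF k(1)] padded_parts(1)[OF k(2)])
      then show ?thesis using padded_parts(4)[OF k(1)] padded_parts(4)[OF k(2)] by simp
    qed
  qed
  with b(1) show False by blast
qed

section \<open>Products of super power sums\<close>

lemma factor_reciprocal:
  assumes "degree p \<le> b" "coeff p 0 = 1"
  shows "\<exists>\<zeta>. p = reciprocal_poly b \<zeta>"
  using assms
proof (induction b arbitrary: p)
  case 0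
  then obtain c where "p = [:c:]" using degree_eq_zeroE by auto
  with 0 show ?case by (simp add: reciprocal_poly_def)
next
  case (Suc b)
  have ext: "\<exists>\<zeta>'. [:1, - c:] * reciprocal_poly b \<zeta> = reciprocal_poly (Suc b) \<zeta>'" for c \<zeta>
    by (intro exI[of _ "\<lambda>i. if i = b then c else \<zeta> i"]) (simp add: reciprocal_poly_def mult.commute)
  show ?case
  proof (cases "degree p = 0")
    case True
    then obtain \<zeta> where "p = reciprocal_poly b \<zeta>" using Suc.IH[of p] Suc.prems by auto
    then show ?thesis using ext[of 0 \<zeta>] by simp
  next
    case False
    then obtain z where z: "poly p z = 0"
      using fundamental_theorem_of_algebra[of p] by (auto simp: constant_degree)
    then have z0: "z \<noteq> 0" using Suc.prems(2) by (auto simp: poly_0_coeff_0)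
    obtain q where q: "p = [:- z, 1:] * q" using z by (auto simp: poly_eq_0_iff_dvd dvd_def)
    have "[:- z, 1:] = Polynomial.smult (- z) [:1, - (1 / z):]" using z0 by simp
    then have p: "p = [:1, - (1 / z):] * Polynomial.smult (- z) q"
      by (simp only: q mult_smult_left mult_smult_right)
    have q0: "Polynomial.smult (- z) q \<noteq> 0" using False q by (auto simp: z0)
    have "degree p = 1 + degree (Polynomial.smult (- z) q)"
      using q0 z0 by (subst p, subst degree_mult_eq) auto
    then have "degree (Polynomial.smult (- z) q) \<le> b" using Suc.prems by simp
    moreover have "coeff (Polynomial.smult (- z) q) 0 = 1"
      using Suc.prems(2) unfolding p by (simp add: coeff_mult)
    ultimately obtain \<zeta> where "Polynomial.smult (- z) q = reciprocal_poly b \<zeta>" using Suc.IH by blast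
    then show ?thesis using ext[of "1 / z" \<zeta>] p by simp
  qed
qed

text \<open>
  The power sums as a generating function, so that the logarithmic derivative of \<open>\<Prod>(1 - \<xi>\<^sub>i t)\<close> is its
  negative.
\<close>

definition power_fps :: "nat \<Rightarrow> (nat \<Rightarrow> complex) \<Rightarrow> complex fps" where
  "power_fps a \<xi> = Abs_fps (\<lambda>k. \<Sum>i<a. \<xi> i ^ Suc k)"

lemma deriv_reciprocal: "fps_deriv (fps_of_poly (reciprocal_poly a \<xi>)) = - fps_of_poly (reciprocal_poly a \<xi>) * power_fps a \<xi>"
proof (induction a)
  case 0
  have "power_fps 0 \<xi> = 0" by (simp add: power_fps_def fps_eq_iff)
  then show ?case by (simp add: reciprocal_poly_def)
next
  case (Suc a)
  let ?A = "fps_of_poly (reciprocal_poly a \<xi>)" and ?L = "fps_of_poly [:1, - \<xi> a:]"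
  let ?c = "fps_const (\<xi> a)"
  have A: "fps_of_poly (reciprocal_poly (Suc a) \<xi>) = ?A * ?L"
    by (simp only: reciprocal_poly_def prod.lessThan_Suc fps_of_poly_mult)
  have P: "power_fps (Suc a) \<xi> = power_fps a \<xi> + ?c * geometric_fps (\<xi> a)"
    by (simp add: fps_eq_iff power_fps_def geometric_fps_def)
  have L: "fps_deriv ?L = - ?c"
    by (simp add: fps_eq_iff fps_of_poly_pCons) 
  have "?A * - ?c = - (?A * ?c * (?L * geometric_fps (\<xi> a)))" by (simp only: geometric_fps_inverse) simp
  then show ?case unfolding A P by (simp add: Suc.IH L algebra_simps)
qed

text \<open>
  With \<open>\<alpha> = \<Prod>(1 - \<xi>\<^sub>i t)\<close> and \<open>U = \<gamma> / \<alpha>\<close>, the polynomial \<open>\<Prod>(1 - \<zeta>\<^sub>j t)\<close> equals \<open>\<alpha> (1 + c U)\<close>. Comparing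
  logarithmic derivatives shows that the generating function \<open>G\<close> of the differences of power sums
  satisfies \<open>(1 + c U) G = c U'\<close>. The recursion compares coefficients.
\<close>

lemma newton_perturbation:
  assumes eq: "reciprocal_poly b \<zeta> = reciprocal_poly a \<xi> + Polynomial.smult c \<gamma>" and g0: "coeff \<gamma> 0 = 0" and k: "k \<ge> 1"
  defines "U \<equiv> fps_of_poly \<gamma> * inverse (fps_of_poly (reciprocal_poly a \<xi>))"
  defines "Q \<equiv> (\<lambda>k. (\<Sum>i<a. \<xi> i ^ k) - (\<Sum>j<b. \<zeta> j ^ k))"
  shows "Q k = c * (of_nat k * fps_nth U k) - c * (\<Sum>i=1..<k. fps_nth U i * Q (k - i))"
proof -
  let ?A = "fps_of_poly (reciprocal_poly a \<xi>)" and ?B = "fps_of_poly (reciprocal_poly b \<zeta>)"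
  let ?C = "fps_const c"
  let ?G = "power_fps a \<xi> - power_fps b \<zeta>"
  have A0: "?A \<noteq> 0" using reciprocal_inverse[of a \<xi>] by auto
  have AU: "fps_of_poly \<gamma> = ?A * U"
    unfolding U_def using reciprocal_inverse[of a \<xi>] by (simp add: mult.left_commute)
  have B: "?B = ?A * (1 + ?C * U)"
    unfolding eq by (simp add: fps_of_poly_add fps_of_poly_smult AU algebra_simps)
  have "fps_deriv ?B = fps_deriv ?A * (1 + ?C * U) + ?A * (?C * fps_deriv U)"
    unfolding B by (simp add: algebra_simps)
  then have "- (?A * (1 + ?C * U)) * power_fps b \<zeta> = - ?A * power_fps a \<xi> * (1 + ?C * U) + ?A * (?C * fps_deriv U)"
    unfolding deriv_reciprocal unfolding B .
  then have "?A * ((1 + ?C * U) * ?G) = ?A * (?C * fps_deriv U)" by (simp add: algebra_simps)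
  then have main: "(1 + ?C * U) * ?G = ?C * fps_deriv U" using A0 by simp
  have G: "fps_nth ?G i = Q (Suc i)" for i by (simp add: power_fps_def Q_def)
  obtain k' where k': "k = Suc k'" using k by (cases k) auto
  have U0: "fps_nth U 0 = 0" by (simp add: U_def g0)
  have "fps_nth ((1 + ?C * U) * ?G) k' = Q k + c * (\<Sum>i=0..k'. fps_nth U i * Q (k - i))"
  proof -
    have "fps_nth ((1 + ?C * U) * ?G) k' = fps_nth ?G k' + c * fps_nth (U * ?G) k'"
      by (simp only: distrib_right mult_1 mult.assoc fps_add_nth fps_mult_left_const_nth)
    also have "fps_nth (U * ?G) k' = (\<Sum>i=0..k'. fps_nth U i * Q (k - i))"
      unfolding fps_mult_nth G k' by (intro sum.cong) (auto simp: Suc_diff_le)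
    finally show ?thesis using G k' by simp
  qed
  also have "(\<Sum>i=0..k'. fps_nth U i * Q (k - i)) = (\<Sum>i=1..<k. fps_nth U i * Q (k - i))"
    by (rule sum.mono_neutral_right) (auto simp: k' U0 not_less_eq_eq)
  finally have "Q k + c * (\<Sum>i=1..<k. fps_nth U i * Q (k - i)) = c * (of_nat k * fps_nth U k)"
    unfolding main by (simp add: k')
  then show ?thesis by (simp add: algebra_simps)
qed

text \<open>
  If \<open>f s k\<close> is of order \<open>w k\<close> as \<open>s\<close> tends to \<open>0\<close>, a product of these functions has as order the sum of the
  \<open>w k\<close>. Divide the relation by \<open>s ^ W\<close>, where \<open>W\<close> is at most the order of each term that occurs, and let
  \<open>s\<close> tend to \<open>0\<close>.
\<close>

lemma leading_terms_vanish:
  fixes f :: "complex \<Rightarrow> nat \<Rightarrow> complex"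
  assumes fin: "finite \<Lambda>"
    and zero: "\<And>s. s \<noteq> 0 \<Longrightarrow> (\<Sum>p\<in>\<Lambda>. A p * (\<Prod>k\<leftarrow>p. f s k)) = 0"
    and lim: "\<And>p k. p \<in> \<Lambda> \<Longrightarrow> k \<in> set p \<Longrightarrow> ((\<lambda>s. f s k / s ^ w k) \<longlongrightarrow> g k) (at 0)"
    and min: "\<And>p. p \<in> \<Lambda> \<Longrightarrow> A p \<noteq> 0 \<Longrightarrow> W \<le> (\<Sum>k\<leftarrow>p. w k)"
  shows "(\<Sum>p\<in>{p\<in>\<Lambda>. (\<Sum>k\<leftarrow>p. w k) = W}. A p * (\<Prod>k\<leftarrow>p. g k)) = 0"
proof -
  let ?w = "\<lambda>p. \<Sum>k\<leftarrow>p. w k"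
  define t where "t = (\<lambda>p s. A p * (s ^ (?w p - W) * (\<Prod>k\<leftarrow>p. f s k / s ^ w k)))"
  have pl: "((\<lambda>s. \<Prod>k\<leftarrow>p. f s k / s ^ w k) \<longlongrightarrow> (\<Prod>k\<leftarrow>p. g k)) (at 0)" if "\<And>k. k \<in> set p \<Longrightarrow> ((\<lambda>s. f s k / s ^ w k) \<longlongrightarrow> g k) (at 0)" for p
    using that
  proof (induction p)
    case (Cons k p)
    then show ?case unfolding list.map prod_list.Cons by (intro tendsto_mult) auto
  qed simp
  have "((\<lambda>s. t p s) \<longlongrightarrow> (if ?w p = W then A p * (\<Prod>k\<leftarrow>p. g k) else 0)) (at 0)" if p: "p \<in> \<Lambda>" for p
  proof (cases "A p = 0")
    case True
    then show ?thesis by (simp add: t_def)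
  next
    case False
    then have le: "W \<le> ?w p" using min p by blast
    have "((\<lambda>s. t p s) \<longlongrightarrow> A p * (0 ^ (?w p - W) * (\<Prod>k\<leftarrow>p. g k))) (at 0)"
      unfolding t_def by (intro tendsto_intros pl lim[OF p])
    then show ?thesis using le by (auto simp: power_0_left)
  qed
  then have "((\<lambda>s. \<Sum>p\<in>\<Lambda>. t p s) \<longlongrightarrow> (\<Sum>p\<in>\<Lambda>. if ?w p = W then A p * (\<Prod>k\<leftarrow>p. g k) else 0)) (at 0)"
    by (intro tendsto_sum)
  moreover have "((\<lambda>s. \<Sum>p\<in>\<Lambda>. t p s) \<longlongrightarrow> 0) (at 0)"
  proof (rule tendsto_eventually)
    have "(\<Sum>p\<in>\<Lambda>. t p s) = 0" if s: "s \<noteq> 0" for s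
    proof -
      have pw: "(\<Prod>k\<leftarrow>p. f s k) = s ^ ?w p * (\<Prod>k\<leftarrow>p. f s k / s ^ w k)" for p
        using s by (induction p) (auto simp: power_add)
      have "s ^ W * t p s = A p * (\<Prod>k\<leftarrow>p. f s k)" if "p \<in> \<Lambda>" for p
      proof (cases "A p = 0")
        case False
        then have "s ^ ?w p = s ^ W * s ^ (?w p - W)" using min[OF that] by (simp flip: power_add)
        then show ?thesis unfolding pw t_def by (simp only: mult_ac)
      qed (simp add: t_def)
      then have "s ^ W * (\<Sum>p\<in>\<Lambda>. t p s) = 0" using zero[OF s] by (simp add: sum_distrib_left)
      then show ?thesis using s by simp
    qed
    then show "\<forall>\<^sub>F s in at 0. (\<Sum>p\<in>\<Lambda>. t p s) = 0" by (auto simp: eventually_at_filter)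
  qed
  ultimately have "(\<Sum>p\<in>\<Lambda>. if ?w p = W then A p * (\<Prod>k\<leftarrow>p. g k) else 0) = 0"
    by (rule tendsto_unique[rotated]) simp
  then show ?thesis using fin by (simp add: sum.inter_filter)
qed

text \<open>
  For small \<open>s\<close> the coefficients decrease rapidly as \<open>j\<close> decreases from \<open>b\<close> to \<open>1\<close>, so in each coefficient of a product
  with a fixed power series the contribution of the largest possible \<open>j\<close> dominates.
\<close>

definition perturbation :: "nat \<Rightarrow> nat \<Rightarrow> complex \<Rightarrow> complex poly" where
  "perturbation B b s = (\<Sum>j=1..b. monom (s ^ (B ^ (b - j))) j)"

text \<open>
  Let \<open>U\<close> be the quotient of the perturbation by \<open>\<Prod>(1 - \<xi>\<^sub>i t)\<close>. Its coefficient \<open>U\<^sub>k\<close> is dominated by the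
  term with \<open>j = min k b\<close>, which gives the order \<open>B ^ (b - min k b)\<close> and the complete symmetric function.
  In the recursion for the difference of power sums divided by \<open>s ^ (B ^ b)\<close>, the summand \<open>k U\<^sub>k\<close> is the
  leading one: the sum is multiplied by \<open>s ^ (B ^ b)\<close>, and its terms tend to \<open>0\<close>.
\<close>

lemma perturbation_limit:
  fixes \<xi> :: "nat \<Rightarrow> complex" and \<zeta> :: "complex \<Rightarrow> nat \<Rightarrow> complex"
  assumes B: "B \<ge> 2" and b: "b \<ge> 1"
    and eq: "\<And>s. reciprocal_poly b (\<zeta> s) = reciprocal_poly a \<xi> + Polynomial.smult (s ^ (B ^ b)) (perturbation B b s)"
    and k: "k \<ge> 1"
  shows "((\<lambda>s. ((\<Sum>i<a. \<xi> i ^ k) - (\<Sum>j<b. \<zeta> s j ^ k)) / s ^ (B ^ b + B ^ (b - min k b))) \<longlongrightarrow> of_nat k * complete_sym a \<xi> (k - min k b)) (at 0)"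
proof -
  define U where "U = (\<lambda>s. fps_of_poly (perturbation B b s) * inverse (fps_of_poly (reciprocal_poly a \<xi>)))"
  define Q where "Q = (\<lambda>s k. (\<Sum>i<a. \<xi> i ^ k) - (\<Sum>j<b. \<zeta> s j ^ k))"
  define q where "q = (\<lambda>s k. Q s k / s ^ (B ^ b))"
  have coeff: "coeff (perturbation B b s) i = (if i \<in> {1..b} then s ^ (B ^ (b - i)) else 0)" for s i
    by (simp add: perturbation_def coeff_sum)
  have rec: "q s k = of_nat k * fps_nth (U s) k - s ^ (B ^ b) * (\<Sum>i=1..<k. fps_nth (U s) i * q s (k - i))"
    if "k \<ge> 1" "s \<noteq> 0" for s k
  proof -
    have "Q s k = s ^ (B ^ b) * (of_nat k * fps_nth (U s) k) - s ^ (B ^ b) * (\<Sum>i=1..<k. fps_nth (U s) i * Q s (k - i))"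
      unfolding Q_def U_def by (rule newton_perturbation[OF eq _ that(1)]) (simp add: coeff)
    then show ?thesis using that(2) by (simp add: q_def diff_divide_distrib sum_divide_distrib[symmetric] field_simps)
  qed
  have Uk: "fps_nth (U s) k = (\<Sum>j=1..min k b. s ^ (B ^ (b - j)) * complete_sym a \<xi> (k - j))" for s k
  proof -
    have "fps_nth (U s) k = (\<Sum>j=0..k. coeff (perturbation B b s) j * complete_sym a \<xi> (k - j))"
      by (simp add: U_def fps_mult_nth complete_sym_def)
    also have "\<dots> = (\<Sum>j=1..min k b. s ^ (B ^ (b - j)) * complete_sym a \<xi> (k - j))"
      by (rule sum.mono_neutral_cong_right) (auto simp: coeff)
    finally show ?thesis .
  qed
  have U_lim: "((\<lambda>s. fps_nth (U s) k / s ^ (B ^ (b - min k b))) \<longlongrightarrow> complete_sym a \<xi> (k - min k b)) (at 0)" if k: "k \<ge> 1" for k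
  proof -
    let ?m = "min k b"
    have "((\<lambda>s. \<Sum>j=1..?m. s ^ (B ^ (b - j) - B ^ (b - ?m)) * complete_sym a \<xi> (k - j))
        \<longlongrightarrow> (\<Sum>j=1..?m. 0 ^ (B ^ (b - j) - B ^ (b - ?m)) * complete_sym a \<xi> (k - j))) (at 0)"
      by (intro tendsto_intros)
    also have "(\<Sum>j=1..?m. 0 ^ (B ^ (b - j) - B ^ (b - ?m)) * complete_sym a \<xi> (k - j))
      = (\<Sum>j\<in>{?m}. complete_sym a \<xi> (k - j))"
    proof (rule sum.mono_neutral_cong_right)
      show "\<forall>j\<in>{1..?m} - {?m}. 0 ^ (B ^ (b - j) - B ^ (b - ?m)) * complete_sym a \<xi> (k - j) = 0"
      proof
        fix j assume "j \<in> {1..?m} - {?m}"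
        then have "b - ?m < b - j" by auto
        then have "B ^ (b - ?m) < B ^ (b - j)" using B by (intro power_strict_increasing) auto
        then show "0 ^ (B ^ (b - j) - B ^ (b - ?m)) * complete_sym a \<xi> (k - j) = 0" by (simp add: power_0_left)
      qed
    qed (use k b in auto)
    finally have 1: "((\<lambda>s. \<Sum>j=1..?m. s ^ (B ^ (b - j) - B ^ (b - ?m)) * complete_sym a \<xi> (k - j)) \<longlongrightarrow> complete_sym a \<xi> (k - ?m)) (at 0)"
      by simp
    have "(\<Sum>j=1..?m. s ^ (B ^ (b - j) - B ^ (b - ?m)) * complete_sym a \<xi> (k - j)) = fps_nth (U s) k / s ^ (B ^ (b - ?m))" if s: "s \<noteq> 0" for s
      unfolding Uk sum_divide_distrib
    proof (rule sum.cong[OF refl])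
      fix j assume "j \<in> {1..?m}"
      then have "B ^ (b - ?m) \<le> B ^ (b - j)" using B by (intro power_increasing) auto
      then show "s ^ (B ^ (b - j) - B ^ (b - ?m)) * complete_sym a \<xi> (k - j) = s ^ B ^ (b - j) * complete_sym a \<xi> (k - j) / s ^ B ^ (b - ?m)"
        using s by (simp add: power_diff)
    qed
    then have "\<forall>\<^sub>F s in at 0. (\<Sum>j=1..?m. s ^ (B ^ (b - j) - B ^ (b - ?m)) * complete_sym a \<xi> (k - j)) = fps_nth (U s) k / s ^ (B ^ (b - ?m))"
      by (auto simp: eventually_at_filter)
    with 1 show ?thesis by (rule Lim_transform_eventually)
  qed
  have U0: "((\<lambda>s. fps_nth (U s) k) \<longlongrightarrow> 0) (at 0)" for k
  proof -
    have "((\<lambda>s. fps_nth (U s) k) \<longlongrightarrow> (\<Sum>j=1..min k b. 0 ^ (B ^ (b - j)) * complete_sym a \<xi> (k - j))) (at 0)"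
      unfolding Uk by (intro tendsto_intros)
    then show ?thesis using B by (simp add: power_0_left)
  qed
  have s0: "((\<lambda>s :: complex. s ^ (B ^ b)) \<longlongrightarrow> 0) (at 0)"
  proof -
    have "((\<lambda>s :: complex. s ^ (B ^ b)) \<longlongrightarrow> 0 ^ (B ^ b)) (at 0)" by (intro tendsto_intros)
    then show ?thesis using B by (simp add: power_0_left)
  qed
  have q0: "((\<lambda>s. q s k) \<longlongrightarrow> 0) (at 0)" if "k \<ge> 1" for k
    using that
  proof (induction k rule: less_induct)
    case (less k)
    have "((\<lambda>s. of_nat k * fps_nth (U s) k - s ^ (B ^ b) * (\<Sum>i=1..<k. fps_nth (U s) i * q s (k - i)))
        \<longlongrightarrow> of_nat k * 0 - 0 * (\<Sum>i=1..<k. 0 * 0)) (at 0)"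
      by (intro tendsto_intros U0 s0 less.IH) auto
    then have "((\<lambda>s. of_nat k * fps_nth (U s) k - s ^ (B ^ b) * (\<Sum>i=1..<k. fps_nth (U s) i * q s (k - i))) \<longlongrightarrow> 0) (at 0)"
      by simp
    moreover have "\<forall>\<^sub>F s in at 0. of_nat k * fps_nth (U s) k - s ^ (B ^ b) * (\<Sum>i=1..<k. fps_nth (U s) i * q s (k - i)) = q s k"
      using rec[OF less.prems] by (auto simp: eventually_at_filter)
    ultimately show ?case by (rule Lim_transform_eventually)
  qed
  let ?e = "B ^ (b - min k b)"
  have le: "?e \<le> B ^ b" using B by (intro power_increasing) auto
  have "((\<lambda>s. of_nat k * (fps_nth (U s) k / s ^ ?e) - s ^ (B ^ b - ?e) * (\<Sum>i=1..<k. fps_nth (U s) i * q s (k - i)))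
      \<longlongrightarrow> of_nat k * complete_sym a \<xi> (k - min k b) - 0 ^ (B ^ b - ?e) * (\<Sum>i=1..<k. 0 * 0)) (at 0)"
    by (intro tendsto_intros U0 U_lim k q0) auto
  moreover have "\<forall>\<^sub>F s in at 0. of_nat k * (fps_nth (U s) k / s ^ ?e) - s ^ (B ^ b - ?e) * (\<Sum>i=1..<k. fps_nth (U s) i * q s (k - i))
     = Q s k / s ^ (B ^ b + ?e)"
  proof -
    have "of_nat k * (fps_nth (U s) k / s ^ ?e) - s ^ (B ^ b - ?e) * (\<Sum>i=1..<k. fps_nth (U s) i * q s (k - i))
       = Q s k / s ^ (B ^ b + ?e)" if s: "s \<noteq> 0" for s
    proof -
      have "Q s k / s ^ (B ^ b + ?e) = q s k / s ^ ?e" by (simp add: q_def power_add)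
      also have "\<dots> = of_nat k * (fps_nth (U s) k / s ^ ?e) - (s ^ (B ^ b) / s ^ ?e) * (\<Sum>i=1..<k. fps_nth (U s) i * q s (k - i))"
        by (subst rec[OF k s]) (simp add: diff_divide_distrib)
      also have "s ^ (B ^ b) / s ^ ?e = s ^ (B ^ b - ?e)" using s le by (simp add: power_diff)
      finally show ?thesis by simp
    qed
    then show ?thesis by (auto simp: eventually_at_filter)
  qed
  ultimately have "((\<lambda>s. Q s k / s ^ (B ^ b + ?e)) \<longlongrightarrow> of_nat k * complete_sym a \<xi> (k - min k b) - 0 ^ (B ^ b - ?e) * (\<Sum>i=1..<k. 0 * 0)) (at 0)"
    by (rule Lim_transform_eventually)
  then show ?thesis by (simp add: Q_def)
qed

text \<open>
  The digits of the order at which a product of power sums vanishes, except for the leading one, which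
  is the number of parts. The digit \<open>0\<close> counts the parts that are at least \<open>b\<close>.
\<close>

definition digit_count :: "nat \<Rightarrow> nat list \<Rightarrow> nat \<Rightarrow> nat" where
  "digit_count b p d = length (filter (\<lambda>k. b - min k b = d) p)"

lemma sum_digit_count:
  assumes "b \<ge> 1" "0 \<notin> set p"
  shows "(\<Sum>k\<leftarrow>p. F (b - min k b)) = (\<Sum>d<b. digit_count b p d * (F d :: nat))"
  using assms(2)
proof (induction p)
  case (Cons k p)
  have "digit_count b (k # p) d = (if d = b - min k b then 1 else 0) + digit_count b p d" for d
    by (auto simp: digit_count_def)
  then have "(\<Sum>d<b. digit_count b (k # p) d * F d) = (\<Sum>d<b. if d = b - min k b then F d else 0) + (\<Sum>d<b. digit_count b p d * F d)"
    by (simp add: distrib_right sum.distrib if_distrib[of "\<lambda>x. x * _"] cong: if_cong)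
  also have "(\<Sum>d<b. if d = b - min k b then F d else 0) = F (b - min k b)"
    using Cons.prems assms(1) by (simp add: min_def)
  finally show ?case using Cons by simp
qed (simp add: digit_count_def)

lemma hook_partition_length:
  assumes "p \<in> hook_partitions a b r"
  shows "length p \<le> r"
proof -
  have "0 \<notin> set p \<Longrightarrow> length p \<le> sum_list p" by (induction p) auto
  then show ?thesis using assms by (auto simp: hook_partitions_def)
qed

lemma hook_partition_big_parts:
  assumes "p \<in> hook_partitions a b r"
  shows "size (filter_mset (\<lambda>k. b < k) (mset p)) \<le> a"
proof -
  have p: "sorted_wrt (\<ge>) p" "(if a < length p then p ! a else 0) \<le> b" using assms by (auto simp: hook_partitions_def)
  have "{i. i < length p \<and> b < p ! i} \<subseteq> {..<a}"
  proof
    fix i assume "i \<in> {i. i < length p \<and> b < p ! i}"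
    then have i: "i < length p" "b < p ! i" by auto
    show "i \<in> {..<a}"
    proof (rule ccontr)
      assume "i \<notin> {..<a}"
      then have "a \<le> i" by simp
      then have "p ! i \<le> p ! a" using p(1) i by (cases "a = i") (auto simp: sorted_wrt_iff_nth_less)
      then show False using p(2) i \<open>a \<le> i\<close> by auto
    qed
  qed
  then have "card {i. i < length p \<and> b < p ! i} \<le> a" using card_mono[of "{..<a}"] by fastforce
  moreover have "size (filter_mset (\<lambda>k. b < k) (mset p)) = card {i. i < length p \<and> b < p ! i}"
    by (metis length_filter_conv_card mset_filter size_mset)
  ultimately show ?thesis by simp
qed

lemma decreasing_list_eq:
  assumes "sorted_wrt (\<ge>) p" "sorted_wrt (\<ge>) q" "mset p = mset (q :: nat list)"
  shows "p = q"
proof -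
  have "sorted (rev p)" "sorted (rev q)" using assms(1,2) by (simp_all add: sorted_wrt_rev)
  moreover have "mset (rev p) = mset (rev q)" using assms(3) by simp
  ultimately have "rev p = rev q" by (metis properties_for_sort)
  then show ?thesis by simp
qed

text \<open>
  What the leading coefficient of a product of power sums still knows about the parts larger than \<open>b\<close>.
\<close>

definition excess :: "nat \<Rightarrow> nat list \<Rightarrow> nat multiset" where
  "excess b p = image_mset (\<lambda>k. k - b) (filter_mset (\<lambda>k. b < k) (mset p))"

lemma prod_complete_sym_excess:
  "(\<Prod>k\<leftarrow>p. of_nat k * complete_sym a \<xi> (k - min k b))
    = (\<Prod>k\<leftarrow>p. of_nat k) * (\<Prod>k\<in>#excess b p. complete_sym a \<xi> k)"
proof (induction p)
  case (Cons k p)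
  then show ?case by (cases "b < k") (simp_all add: excess_def complete_sym_0 min_def mult_ac)
qed (simp add: excess_def)

lemma sum_excess: "sum_mset (excess b p) + (\<Sum>k\<leftarrow>p. min k b) = sum_list p"
proof (induction p)
  case (Cons k p)
  then show ?case by (cases "b < k") (simp_all add: excess_def min_def)
qed (simp add: excess_def)

lemma excess_determines:
  assumes "0 \<notin> set p" "0 \<notin> set q" and d: "\<And>d. d < b \<Longrightarrow> digit_count b p d = digit_count b q d"
    and b: "b \<ge> 1" and e: "excess b p = excess b q"
  shows "mset p = mset q"
proof (rule multiset_eqI)
  fix x
  have small: "count (mset p) x = digit_count b p (b - x)" if "1 \<le> x" "x < b" for p
  proof -
    have "(b - min k b = b - x) = (x = k)" for k using that by (auto simp: min_def)
    then show ?thesis by (simp add: digit_count_def count_mset count_list_eq_length_filter)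
  qed
  have big: "count (mset p) x = count (excess b p) (x - b)" if "b < x" for p
  proof (induction p)
    case (Cons k p)
    then show ?case using that by (auto simp: excess_def)
  qed (simp add: excess_def)
  have mid: "count (mset p) b + size (excess b p) = digit_count b p 0" for p
  proof (induction p)
    case (Cons k p)
    then show ?case using b by (auto simp: excess_def digit_count_def min_def)
  qed (simp add: excess_def digit_count_def)
  consider "x = 0" | "1 \<le> x" "x < b" | "x = b" | "b < x" by linarith
  then show "count (mset p) x = count (mset q) x"
  proof cases
    case 1
    then show ?thesis using assms(1,2) by (metis count_eq_zero_iff set_mset_mset)
  next
    case 2
    then show ?thesis using d b by (simp add: small)
  next
    case 3
    then show ?thesis using mid[of p] mid[of q] d[of 0] b e by simp
  next
    case 4
    then show ?thesis using e by (simp add: big)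
  qed
qed

text \<open>
  Consider the terms of least order in \<open>s\<close> in a relation, for the values \<open>\<zeta>\<close> obtained from \<open>\<xi>\<close> by the
  perturbation. The order has base \<open>B\<close> digits which determine the number of parts and the multiplicities
  of the parts below \<open>b\<close>. So the partitions that remain differ only in their parts larger than \<open>b\<close>, whose
  excesses over \<open>b\<close> form partitions of one number into at most \<open>a\<close> parts. The leading coefficients are
  multiples of the corresponding products of complete symmetric functions, which are independent.
\<close>

lemma signed_power_sums_independent:
  assumes ab: "a \<le> b" "b \<ge> 1"
    and zero: "\<And>\<xi> \<zeta>. (\<Sum>p\<in>hook_partitions a b r. A p * (\<Prod>k\<leftarrow>p. (\<Sum>i<a. \<xi> i ^ k) - (\<Sum>j<b. \<zeta> j ^ k))) = (0 :: complex)"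
    and q: "q \<in> hook_partitions a b r"
  shows "A q = 0"
proof (rule ccontr)
  assume "A q \<noteq> 0"
  let ?H = "hook_partitions a b r"
  \<comment> \<open>A base larger than every number of parts and at least 2.\<close>
  define B where "B = r + 2"
  have B: "B \<ge> 2" "r < B" by (simp_all add: B_def)
  define w where "w = (\<lambda>k. B ^ b + B ^ (b - min k b))"
  define W where "W = Min ((\<lambda>p. \<Sum>k\<leftarrow>p. w k) ` {p \<in> ?H. A p \<noteq> 0})"
  let ?G = "{p \<in> ?H. (\<Sum>k\<leftarrow>p. w k) = W}"
  have fin: "finite ?H" by (rule finite_hook_partitions)
  have W: "W \<le> (\<Sum>k\<leftarrow>p. w k)" if "p \<in> ?H" "A p \<noteq> 0" for p
    unfolding W_def using fin that by (intro Min_le) auto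
  have "W \<in> (\<lambda>p. \<Sum>k\<leftarrow>p. w k) ` {p \<in> ?H. A p \<noteq> 0}"
    unfolding W_def using fin q \<open>A q \<noteq> 0\<close> by (intro Min_in) auto
  then obtain p0 where p0: "p0 \<in> ?G" "A p0 \<noteq> 0" by auto
  have parts: "0 \<notin> set p" "sum_list p = r" "sorted_wrt (\<ge>) p" if "p \<in> ?H" for p
    using that by (auto simp: hook_partitions_def)
  have group: "(\<Sum>p\<in>?G. A p * (\<Prod>k\<leftarrow>p. of_nat k * complete_sym a \<xi> (k - min k b))) = 0" for \<xi>
  proof -
    have "\<exists>\<zeta>. reciprocal_poly a \<xi> + Polynomial.smult (s ^ (B ^ b)) (perturbation B b s) = reciprocal_poly b \<zeta>" for s
    proof (rule factor_reciprocal)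
      have c: "coeff (perturbation B b s) i = (if i \<in> {1..b} then s ^ (B ^ (b - i)) else 0)" for i
        by (simp add: perturbation_def coeff_sum)
      then have "degree (perturbation B b s) \<le> b" by (intro degree_le) simp
      then show "degree (reciprocal_poly a \<xi> + Polynomial.smult (s ^ (B ^ b)) (perturbation B b s)) \<le> b"
        using degree_reciprocal[of a \<xi>] ab degree_smult_le[of "s ^ (B ^ b)" "perturbation B b s"]
        by (intro degree_add_le) linarith+
      show "coeff (reciprocal_poly a \<xi> + Polynomial.smult (s ^ (B ^ b)) (perturbation B b s)) 0 = 1"
        by (simp add: coeff_0_reciprocal c)
    qed
    then obtain \<zeta> where \<zeta>: "\<And>s. reciprocal_poly b (\<zeta> s) = reciprocal_poly a \<xi> + Polynomial.smult (s ^ (B ^ b)) (perturbation B b s)"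
      by metis
    show ?thesis
    proof (rule leading_terms_vanish[OF fin])
      show "(\<Sum>p\<in>?H. A p * (\<Prod>k\<leftarrow>p. (\<Sum>i<a. \<xi> i ^ k) - (\<Sum>j<b. \<zeta> s j ^ k))) = 0" for s by (rule zero)
      show "((\<lambda>s. ((\<Sum>i<a. \<xi> i ^ k) - (\<Sum>j<b. \<zeta> s j ^ k)) / s ^ w k) \<longlongrightarrow> of_nat k * complete_sym a \<xi> (k - min k b)) (at 0)"
        if "p \<in> ?H" "k \<in> set p" for p k
      proof -
        have "k \<noteq> 0" using parts(1)[OF that(1)] that(2) by metis
        then show ?thesis unfolding w_def using ab B by (intro perturbation_limit \<zeta>) auto
      qed
      show "W \<le> (\<Sum>k\<leftarrow>p. w k)" if "p \<in> ?H" "A p \<noteq> 0" for p using W that .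
    qed
  qed
  have digits: "digit_count b p d = digit_count b p0 d" if p: "p \<in> ?G" and d: "d < b" for p d
  proof -
    let ?c = "\<lambda>p d. if d = b then length p else digit_count b p d"
    have wt: "(\<Sum>k\<leftarrow>p. w k) = (\<Sum>d<Suc b. ?c p d * B ^ d)" if "p \<in> ?H" for p
    proof -
      have "(\<Sum>k\<leftarrow>p. w k) = length p * B ^ b + (\<Sum>k\<leftarrow>p. B ^ (b - min k b))"
        by (simp add: w_def sum_list_addf sum_list_triv)
      also have "(\<Sum>k\<leftarrow>p. B ^ (b - min k b)) = (\<Sum>d<b. digit_count b p d * B ^ d)"
        by (rule sum_digit_count[OF ab(2) parts(1)[OF that]])
      finally show ?thesis by simp
    qed
    have "?c p d < B" if "p \<in> ?H" for p d
    proof -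
      have "digit_count b p d \<le> length p" by (simp add: digit_count_def)
      then show ?thesis using hook_partition_length[OF that] B by simp
    qed
    then have lt: "?c p i < B" "?c p0 i < B" for i using p p0 by blast+
    have "(\<Sum>d<Suc b. ?c p d * B ^ d) = (\<Sum>d<Suc b. ?c p0 d * B ^ d)"
      using wt[of p] wt[of p0] p p0 by (simp only: mem_Collect_eq)
    from digits_unique[of "Suc b" "?c p" B "?c p0", OF lt this less_SucI[OF d]] have "?c p d = ?c p0 d" .
    then show ?thesis using d by simp
  qed
  define N where "N = sum_mset (excess b p0)"
  have exc: "excess b p \<in> bounded_partitions a N" if p: "p \<in> ?G" for p
  proof -
    have H: "p \<in> ?H" "p0 \<in> ?H" using p p0 by auto
    have m: "(\<Sum>k\<leftarrow>p. min k b) = (\<Sum>d<b. digit_count b p d * (b - d))" if "p \<in> ?H" for p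
      using sum_digit_count[OF ab(2) parts(1)[OF that], of "\<lambda>d. b - d"] by simp
    have "(\<Sum>k\<leftarrow>p. min k b) = (\<Sum>k\<leftarrow>p0. min k b)"
      unfolding m[OF H(1)] m[OF H(2)] by (intro sum.cong refl) (simp add: digits[OF p])
    then have "sum_mset (excess b p) = N"
      using sum_excess[of b p] sum_excess[of b p0] parts(2)[OF H(1)] parts(2)[OF H(2)] by (simp add: N_def)
    moreover have "size (excess b p) \<le> a" using hook_partition_big_parts[OF H(1)] by (simp add: excess_def)
    moreover have "0 \<notin># excess b p" by (auto simp: excess_def)
    ultimately show ?thesis by (simp add: bounded_partitions_def)
  qed
  have inj: "p = p0" if p: "p \<in> ?G" and e: "excess b p = excess b p0" for p
  proof (rule decreasing_list_eq)
    show "sorted_wrt (\<ge>) p" "sorted_wrt (\<ge>) p0" using parts(3) p p0 by auto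
    show "mset p = mset p0"
      by (rule excess_determines[OF _ _ digits[OF p] ab(2) e]) (use parts(1) p p0 in auto)
  qed
  define y where "y = (\<lambda>\<kappa>. \<Sum>p\<in>{p\<in>?G. excess b p = \<kappa>}. A p * (\<Prod>k\<leftarrow>p. of_nat k))"
  have finG: "finite ?G" using fin by simp
  have "(\<Sum>\<kappa>\<in>bounded_partitions a N. y \<kappa> * (\<Prod>k\<in>#\<kappa>. complete_sym a \<xi> k)) = 0" for \<xi>
  proof -
    have "(\<Sum>\<kappa>\<in>bounded_partitions a N. y \<kappa> * (\<Prod>k\<in>#\<kappa>. complete_sym a \<xi> k))
      = (\<Sum>\<kappa>\<in>bounded_partitions a N. \<Sum>p\<in>{p\<in>?G. excess b p = \<kappa>}. A p * (\<Prod>k\<leftarrow>p. of_nat k * complete_sym a \<xi> (k - min k b)))"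
      unfolding y_def sum_distrib_right
      by (intro sum.cong refl) (auto simp: prod_complete_sym_excess mult.assoc)
    also have "\<dots> = (\<Sum>p\<in>?G. A p * (\<Prod>k\<leftarrow>p. of_nat k * complete_sym a \<xi> (k - min k b)))"
      by (rule sum.group[OF finG finite_bounded_partitions]) (use exc in blast)
    finally show ?thesis using group by simp
  qed
  then have "y (excess b p0) = 0" by (rule complete_sym_products_independent) (rule exc[OF p0(1)])
  moreover have "{p\<in>?G. excess b p = excess b p0} = {p0}" using inj p0(1) by blast
  ultimately have "A p0 * (\<Prod>k\<leftarrow>p0. of_nat k) = 0" unfolding y_def by (simp only: sum.insert[of "{}"] finite.emptyI empty_iff sum.empty) simp
  moreover have "(\<Prod>k\<leftarrow>p0. of_nat k) \<noteq> (0 :: complex)"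
  proof -
    have "0 \<notin> set p0" using parts(1) p0 by blast
    then show ?thesis by (auto simp: prod_list_zero_iff)
  qed
  ultimately show False using p0(2) by simp
qed

text \<open>
  The smaller group of variables plays the role of \<open>\<xi>\<close>. If this is the group of odd variables, every
  power sum changes its sign, and a product over \<open>p\<close> is multiplied by \<open>(-1) ^ length p\<close>.
\<close>

lemma super_power_sums_independent:
  assumes mn: "m \<ge> 1" "n \<ge> 1"
    and zero: "\<And>x. (\<Sum>p\<in>hook_partitions_vee m n r. A p * (\<Prod>k\<leftarrow>p. super_power_sum m n x k)) = 0"
    and q: "q \<in> hook_partitions_vee m n r"
  shows "A q = 0"
proof -
  have split: "super_power_sum m n (\<lambda>l. if l \<le> m then u (l - 1) else - v (l - m - 1)) k = (\<Sum>i<m. u i ^ k) - (\<Sum>j<n. v j ^ k)"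
    if k: "k \<ge> 1" for u v k
  proof -
    have "super_power_sum m n x k = (\<Sum>i<m. x (Suc i) ^ k) + (\<Sum>j<n. (-1) ^ (k - 1) * x (m + Suc j) ^ k)" for x
    proof -
      have "super_power_sum m n x k = (\<Sum>l<m + n. (if parity m (Suc l) = 1 then (-1) ^ (k - 1) else 1) * x (Suc l) ^ k)"
        unfolding super_power_sum_def by (rule sum.reindex_bij_witness[of _ Suc "\<lambda>i. i - 1"]) auto
      also have "\<dots> = (\<Sum>i<m. x (Suc i) ^ k) + (\<Sum>j<n. (-1) ^ (k - 1) * x (m + Suc j) ^ k)"
        by (induction n) (simp_all add: parity_def)
      finally show ?thesis .
    qed
    moreover have "(-1) ^ (k - 1) * (- c) ^ k = - (c ^ k)" for c :: complex
    proof -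
      obtain k' where k': "k = Suc k'" using k by (cases k) auto
      have "(-1) ^ k' * (- c) ^ Suc k' = - c * ((- 1) ^ k' * (- c) ^ k')" by (simp only: power_Suc mult.left_commute)
      also have "(- 1) ^ k' * (- c) ^ k' = c ^ k'" by (simp flip: power_mult_distrib)
      finally show ?thesis by (simp add: k')
    qed
    ultimately show ?thesis by (simp add: sum_negf)
  qed
  have pos: "k \<ge> 1" if "p \<in> hook_partitions_vee m n r" "k \<in> set p" for p k
    using that by (cases k) (auto simp: hook_partitions_vee_def hook_partitions_def)
  show ?thesis
  proof (cases "m \<le> n")
    case True
    then have H: "hook_partitions_vee m n r = hook_partitions m n r" by (simp add: hook_partitions_vee_def)
    show ?thesis
    proof (rule signed_power_sums_independent[OF True mn(2) _ q[unfolded H]])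
      fix \<xi> \<zeta> :: "nat \<Rightarrow> complex"
      have "(\<Prod>k\<leftarrow>p. super_power_sum m n (\<lambda>l. if l \<le> m then \<xi> (l - 1) else - \<zeta> (l - m - 1)) k) = (\<Prod>k\<leftarrow>p. (\<Sum>i<m. \<xi> i ^ k) - (\<Sum>j<n. \<zeta> j ^ k))"
        if "p \<in> hook_partitions m n r" for p
        using pos that split by (intro arg_cong[where f = prod_list] map_cong refl) (auto simp: H)
      then show "(\<Sum>p\<in>hook_partitions m n r. A p * (\<Prod>k\<leftarrow>p. (\<Sum>i<m. \<xi> i ^ k) - (\<Sum>j<n. \<zeta> j ^ k))) = 0"
        using zero[of "\<lambda>l. if l \<le> m then \<xi> (l - 1) else - \<zeta> (l - m - 1)"] by (simp add: H cong: sum.cong)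
    qed
  next
    case False
    then have H: "hook_partitions_vee m n r = hook_partitions n m r" by (simp add: hook_partitions_vee_def min_def max_def)
    have "A q * (-1) ^ length q = 0"
    proof (rule signed_power_sums_independent[where a = n and b = m and A = "\<lambda>p. A p * (-1) ^ length p", OF _ mn(1) _ q[unfolded H]])
      fix \<xi> \<zeta> :: "nat \<Rightarrow> complex"
      have neg: "(\<Prod>k\<leftarrow>p. - f k) = (-1) ^ length p * (\<Prod>k\<leftarrow>p. f k)" for p and f :: "nat \<Rightarrow> complex"
        by (induction p) auto
      have "(\<Prod>k\<leftarrow>p. super_power_sum m n (\<lambda>l. if l \<le> m then \<zeta> (l - 1) else - \<xi> (l - m - 1)) k)
        = (-1) ^ length p * (\<Prod>k\<leftarrow>p. (\<Sum>i<n. \<xi> i ^ k) - (\<Sum>j<m. \<zeta> j ^ k))" if "p \<in> hook_partitions n m r" for p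
        unfolding neg[symmetric]
        using pos that split by (intro arg_cong[where f = prod_list] map_cong refl) (auto simp: H)
      then have "(\<Sum>p\<in>hook_partitions n m r. A p * ((-1) ^ length p * (\<Prod>k\<leftarrow>p. (\<Sum>i<n. \<xi> i ^ k) - (\<Sum>j<m. \<zeta> j ^ k)))) = 0"
        using zero[of "\<lambda>l. if l \<le> m then \<zeta> (l - 1) else - \<xi> (l - m - 1)"] by (simp add: H cong: sum.cong)
      then show "(\<Sum>p\<in>hook_partitions n m r. A p * (-1) ^ length p * (\<Prod>k\<leftarrow>p. (\<Sum>i<n. \<xi> i ^ k) - (\<Sum>j<m. \<zeta> j ^ k))) = 0"
        by (simp only: mult.assoc)
    qed (use False in simp)
    then show ?thesis by simp
  qed
qed

section \<open>The center\<close>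

lemma op_center_subspace: "tensor_op.subspace (op_center (schur_superalgebra m n r))"
proof (rule tensor_op.subspaceI)
  let ?S = "schur_superalgebra m n r"
  have lin: "x (u + v) = x u + x v" "x (tscale c v) = tscale c (x v)" "x 0 = 0" if x: "x \<in> ?S" for x u v c
  proof -
    obtain f where "x = lin_ext m n r f" using schur_superalgebra_linear[OF x] by metis
    then show "x (u + v) = x u + x v" "x (tscale c v) = tscale c (x v)" "x 0 = 0"
      by (simp_all only: lin_ext_lin)
  qed
  have c: "z (x v) = x (z v)" if "z \<in> op_center ?S" "x \<in> ?S" for z x v
    using that by (auto simp: op_center_def fun_eq_iff)
  show "0 \<in> op_center ?S"
    using schur_superalgebra_zero by (simp add: op_center_def fun_eq_iff lin(3)[unfolded zero_fun_def] zero_fun_def)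
  fix z assume z: "z \<in> op_center ?S"
  have zS: "z \<in> ?S" using z by (simp add: op_center_def)
  show "opscale a z \<in> op_center ?S" for a
    using schur_superalgebra_scale[OF zS, of a]
    by (auto simp: op_center_def opscale_def comp_def lin(2) c[OF z])
  fix z' assume z': "z' \<in> op_center ?S"
  have z'S: "z' \<in> ?S" using z' by (simp add: op_center_def)
  have "(z + z') \<circ> x = x \<circ> (z + z')" if "x \<in> ?S" for x
  proof
    fix v
    have "(z + z') (x v) = z (x v) + z' (x v)" by (rule plus_fun_apply)
    also have "\<dots> = x (z v + z' v)" by (simp only: lin(1)[OF that] c[OF z that] c[OF z' that])
    also have "z v + z' v = (z + z') v" by (rule plus_fun_apply[symmetric])
    finally show "((z + z') \<circ> x) v = (x \<circ> (z + z')) v" by (simp only: comp_apply)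
  qed
  then show "z + z' \<in> op_center ?S"
    using schur_superalgebra_add[OF zS z'S] by (simp add: op_center_def del: plus_fun_apply)
qed

text \<open>
  Elements of the center are determined by their scalars on one singular vector for each singular
  weight, so the number of these weights bounds the dimension of the center.
\<close>

lemma center_dependency:
  assumes m: "m \<ge> 1" and K: "finite K" "card (hook_partitions_vee m n r) < card K"
    and F: "\<And>k. k \<in> K \<Longrightarrow> F k \<in> op_center (schur_superalgebra m n r)"
  shows "\<exists>y. (\<exists>k\<in>K. y k \<noteq> 0) \<and> (\<Sum>k\<in>K. opscale (y k) (F k)) = 0"
proof -
  define v where "v = (\<lambda>M. SOME v. singular_vector m n r M v)"
  have v: "singular_vector m n r M (v M)" if "M \<in> singular_weights m n r" for M
  proof -
    have "\<exists>v. singular_vector m n r M v" using that by (simp only: singular_weights_def mem_Collect_eq)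
    then show ?thesis unfolding v_def by (rule someI_ex)
  qed
  define \<chi> where "\<chi> = (\<lambda>k M. SOME c. F k (v M) = tscale c (v M))"
  have \<chi>: "F k (v M) = tscale (\<chi> k M) (v M)" if "k \<in> K" "M \<in> singular_weights m n r" for k M
    unfolding \<chi>_def by (rule someI_ex) (rule center_scalar[OF F[OF that(1)] v[OF that(2)]])
  have "card (singular_weights m n r) < card K" using singular_weights_card(2)[OF m, of n r] K(2) by simp
  from exists_dependency[OF singular_weights_card(1)[OF m] K(1) this, of \<chi>]
  obtain y where y: "\<exists>k\<in>K. y k \<noteq> 0" "\<And>M. M \<in> singular_weights m n r \<Longrightarrow> (\<Sum>k\<in>K. y k * \<chi> k M) = 0" by blast
  let ?T = "\<Sum>k\<in>K. opscale (y k) (F k)"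
  have T: "?T \<in> op_center (schur_superalgebra m n r)"
    by (intro tensor_op.subspace_sum[OF op_center_subspace] tensor_op.subspace_scale[OF op_center_subspace] F)
  have Tv: "?T (v M) = 0" if M: "M \<in> singular_weights m n r" for M
  proof -
    have "?T (v M) = (\<Sum>k\<in>K. tscale (y k) (F k (v M)))"
      by (simp add: sum_fun_apply opscale_def)
    also have "\<dots> = (\<Sum>k\<in>K. tscale (y k * \<chi> k M) (v M))"
      by (intro sum.cong refl) (simp only: \<chi>[OF _ M] tscale_simps)
    also have "\<dots> = tscale (\<Sum>k\<in>K. y k * \<chi> k M) (v M)"
      by (simp add: tscale_def fun_eq_iff sum_fun_apply sum_distrib_right)
    also have "\<dots> = 0" by (simp only: y(2)[OF M] tscale_simps)
    finally show ?thesis .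
  qed
  have "?T = 0"
  proof (rule center_eq_0[OF T])
    fix M u assume u: "singular_vector m n r M u"
    then have M: "M \<in> singular_weights m n r" by (auto simp: singular_weights_def)
    show "?T u = 0" by (rule center_kill_weight[OF T v[OF M] Tv[OF M] u])
  qed
  with y(1) show ?thesis by blast
qed

theorem theorem4p15:
  fixes m n r :: nat
  assumes "m \<ge> 1" and "n \<ge> 1" and "r \<ge> 1"
  shows "inj_on (\<lambda>p. eta_cl m n r (class_sum r p)) (hook_partitions_vee m n r) \<and>
    tensor_op.independent ((\<lambda>p. eta_cl m n r (class_sum r p)) ` hook_partitions_vee m n r) \<and>
    tensor_op.span ((\<lambda>p. eta_cl m n r (class_sum r p)) ` hook_partitions_vee m n r)
      = op_center (schur_superalgebra m n r)"
proof -
  let ?H = "hook_partitions_vee m n r"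
  let ?e = "\<lambda>p. eta_cl m n r (class_sum r p)"
  let ?Z = "op_center (schur_superalgebra m n r)"
  have fin: "finite ?H" by (simp add: hook_partitions_vee_def finite_hook_partitions)
  have family: "y q = 0" if y: "(\<Sum>p\<in>?H. opscale (y p) (?e p)) = 0" and q: "q \<in> ?H" for y q
  proof -
    have "\<forall>p\<in>?H. \<exists>c. c \<noteq> 0 \<and> (\<forall>x. weighted_trace m n r x (?e p) = c * (\<Prod>k\<leftarrow>p. super_power_sum m n x k))"
      unfolding hook_partitions_vee_def using weighted_trace_class_sum by metis
    then obtain c where c: "\<And>p. p \<in> ?H \<Longrightarrow> c p \<noteq> 0"
      "\<And>p x. p \<in> ?H \<Longrightarrow> weighted_trace m n r x (?e p) = c p * (\<Prod>k\<leftarrow>p. super_power_sum m n x k)"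
      by metis
    have "(\<Sum>p\<in>?H. (y p * c p) * (\<Prod>k\<leftarrow>p. super_power_sum m n x k)) = 0" for x
    proof -
      have "(\<Sum>p\<in>?H. (y p * c p) * (\<Prod>k\<leftarrow>p. super_power_sum m n x k)) = weighted_trace m n r x (\<Sum>p\<in>?H. opscale (y p) (?e p))"
        unfolding weighted_trace_sum weighted_trace_lin by (intro sum.cong refl) (simp add: c(2))
      then show ?thesis by (simp only: y weighted_trace_lin)
    qed
    from super_power_sums_independent[OF assms(1,2) this q] show ?thesis using c(1)[OF q] by simp
  qed
  have inj: "inj_on ?e ?H"
  proof (rule inj_onI, rule ccontr)
    fix p q assume p: "p \<in> ?H" "q \<in> ?H" "?e p = ?e q" "p \<noteq> q"
    let ?y = "\<lambda>x. if x = p then 1 else if x = q then - 1 else (0 :: complex)"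
    have "(\<Sum>x\<in>?H. opscale (?y x) (?e x)) = (\<Sum>x\<in>{p, q}. opscale (?y x) (?e x))"
      by (rule sum.mono_neutral_right) (use p fin in \<open>auto simp: tensor_op.scale_zero_left simp del: zero_fun_apply\<close>)
    also have "\<dots> = 0" using p by (simp add: tensor_op.scale_minus_left del: plus_fun_apply zero_fun_apply)
    finally have "?y p = 0" using family[of ?y p] p by blast
    then show False by simp
  qed
  have indep: "tensor_op.independent (?e ` ?H)"
  proof
    assume "tensor_op.dependent (?e ` ?H)"
    then have "\<exists>u. (\<exists>v\<in>?e ` ?H. u v \<noteq> 0) \<and> (\<Sum>v\<in>?e ` ?H. opscale (u v) v) = 0"
      by (simp only: tensor_op.dependent_finite[OF finite_imageI[OF fin]])
    then obtain u where u: "\<exists>v\<in>?e ` ?H. u v \<noteq> 0" "(\<Sum>v\<in>?e ` ?H. opscale (u v) v) = 0"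
      by (elim exE conjE)
    have "(\<Sum>p\<in>?H. opscale (u (?e p)) (?e p)) = 0" using u(2) by (simp only: sum.reindex[OF inj] comp_def)
    then have "u (?e p) = 0" if "p \<in> ?H" for p by (rule family[where y = "\<lambda>p. u (?e p)"]) (rule that)
    then show False using u(1) by blast
  qed
  have sub: "?e ` ?H \<subseteq> ?Z" using eta_cl_class_sum_center by blast
  have "tensor_op.span (?e ` ?H) = ?Z"
  proof
    show "tensor_op.span (?e ` ?H) \<subseteq> ?Z" by (rule tensor_op.span_minimal[OF sub op_center_subspace])
    show "?Z \<subseteq> tensor_op.span (?e ` ?H)"
    proof
      fix z assume z: "z \<in> ?Z"
      let ?K = "insert None (Some ` ?H)"
      define F where "F = (\<lambda>k. case k of None \<Rightarrow> z | Some p \<Rightarrow> ?e p)"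
      have K: "finite ?K" "card ?H < card ?K" using fin by (simp_all add: card_image)
      have "F k \<in> ?Z" if "k \<in> ?K" for k using that z sub by (auto simp: F_def)
      from center_dependency[OF assms(1) K this] obtain y where
        "(\<exists>k\<in>?K. y k \<noteq> 0) \<and> (\<Sum>k\<in>?K. opscale (y k) (F k)) = 0" by (rule exE)
      then have y: "\<exists>k\<in>?K. y k \<noteq> 0" "(\<Sum>k\<in>?K. opscale (y k) (F k)) = 0" by simp_all
      let ?s = "\<Sum>p\<in>?H. opscale (y (Some p)) (?e p)"
      have s: "opscale (y None) z + ?s = 0"
        using y(2) fin by (simp add: sum.reindex F_def comp_def del: plus_fun_apply zero_fun_apply)
      have "y None \<noteq> 0"
      proof
        assume "y None = 0"
        then have "?s = 0" using s by (simp del: plus_fun_apply zero_fun_apply)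
        then have "y (Some p) = 0" if "p \<in> ?H" for p by (rule family[where y = "\<lambda>p. y (Some p)"]) (rule that)
        with y(1) \<open>y None = 0\<close> show False by auto
      qed
      moreover have "opscale (y None) z = opscale (- 1) ?s"
        using s by (simp only: eq_neg_iff_add_eq_0 tensor_op.scale_minus_left tensor_op.scale_one)
      ultimately have "z = opscale (1 / y None) (opscale (- 1) ?s)"
        by (metis nonzero_eq_divide_eq tensor_op.scale_one tensor_op.scale_scale)
      moreover have "?s \<in> tensor_op.span (?e ` ?H)"
        by (intro tensor_op.span_sum tensor_op.span_scale tensor_op.span_base) simp
      ultimately show "z \<in> tensor_op.span (?e ` ?H)" by (simp only: tensor_op.span_scale)
    qed
  qed
  with inj indep show ?thesis by blast
qed

end
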